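(* Let $G=(V,E)$ be a connected undirected graph with $n$ vertices and $m$ edges, with edge weights $w\colon E\to\mathbb{N}$, and let $\ell\colon V\to\mathbb{N}$ be vertex lower bounds for $(G,w)$ (as defined in the context) that are given as part of the input. Let $c$ be the number of connected components of the obligatory subgraph $G_\ell$. Then \textsc{Min-Power Symmetric Connectivity} on $(G,w)$ can be solved (i) for any given $\varepsilon\in(0,1)$, by a randomized algorithm in $O\bigl(\ln(1/\varepsilon)\cdot (36e^2/\sqrt{2\pi})^c\cdot \frac{1}{\sqrt{c}}\cdot n^4\bigr)$ time with error probability at most $\varepsilon$ (i.e., it outputs an optimal solution with probability at least $1-\varepsilon$), and (ii) by a deterministic algorithm in $c^{O(c\log c)}\cdot n^{O(1)}$ time.
   Context: \textsc{Min-Power Symmetric Connectivity} (MinPSC): given a connected undirected graph $G=(V,E)$ and edge weights $w\colon E\to\mathbb{N}$, find a connected spanning subgraph $T=(V,F)$ of $G$ (a \emph{solution}) minimizing the cost $\sum_{v\in V}\max_{\{u,v\}\in F} w(\{u,v\})$. Vertex lower bounds: a function $\ell\colon V\to\mathbb{N}$ such that for every solution $T=(V,F)$ and every vertex $v\in V$, $\max_{\{u,v\}\in F}w(\{u,v\})\ge \ell(v)$. The obligatory subgraph $G_\ell$ induced by $\ell$ has vertex set $V$ and edge set consisting of all edges $\{u,v\}\in E$ with $\min\{\ell(u),\ell(v)\}\ge w(\{u,v\})$.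
   Formalization: In (i) the factor ln(1/ε) is read as max(1, ln(1/ε)), since for ε near 1 the literal bound would fall below a single step; ε is given to the algorithm as a fraction p/q with p/q ≤ ε ≤ 2p/q. *)

theory Defs
  imports "HOL-Probability.Probability"
begin

section \<open>Min-Power Symmetric Connectivity\<close>

text \<open>An undirected graph is given by its vertex set and its set of edges, each edge being a
  two-element set of vertices.\<close>

definition simple_graph :: "'a set \<Rightarrow> 'a set set \<Rightarrow> bool" where
  "simple_graph V E \<longleftrightarrow>
     finite V \<and> V \<noteq> {} \<and> (\<forall>e\<in>E. \<exists>u v. u \<in> V \<and> v \<in> V \<and> u \<noteq> v \<and> e = {u, v})"

definition reachable :: "'a set \<Rightarrow> 'a set set \<Rightarrow> ('a \<times> 'a) set" where
  "reachable V E = {(u, v). u \<in> V \<and> v \<in> V \<and> (u, v) \<in> {(x, y). {x, y} \<in> E}\<^sup>*}"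

definition connected_graph :: "'a set \<Rightarrow> 'a set set \<Rightarrow> bool" where
  "connected_graph V E \<longleftrightarrow> (\<forall>u\<in>V. \<forall>v\<in>V. (u, v) \<in> reachable V E)"

definition num_components :: "'a set \<Rightarrow> 'a set set \<Rightarrow> nat" where
  "num_components V E = card (V // reachable V E)"

definition solution :: "'a set \<Rightarrow> 'a set set \<Rightarrow> 'a set set \<Rightarrow> bool" where
  "solution V E F \<longleftrightarrow> F \<subseteq> E \<and> connected_graph V F"

text \<open>The inserted \<open>0\<close> only matters for a vertex without incident edges, which occurs in a solution
  only if the graph has a single vertex: the maximum over the empty set is \<open>0\<close>.\<close>

definition vertex_power :: "('a set \<Rightarrow> nat) \<Rightarrow> 'a set set \<Rightarrow> 'a \<Rightarrow> nat" where
  "vertex_power w F v = Max (insert 0 {w {u, v} | u. {u, v} \<in> F})"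

definition cost :: "'a set \<Rightarrow> ('a set \<Rightarrow> nat) \<Rightarrow> 'a set set \<Rightarrow> nat" where
  "cost V w F = (\<Sum>v\<in>V. vertex_power w F v)"

definition optimal_solution ::
    "'a set \<Rightarrow> 'a set set \<Rightarrow> ('a set \<Rightarrow> nat) \<Rightarrow> 'a set set \<Rightarrow> bool" where
  "optimal_solution V E w F \<longleftrightarrow>
     solution V E F \<and> (\<forall>F'. solution V E F' \<longrightarrow> cost V w F \<le> cost V w F')"

definition vertex_lower_bounds ::
    "'a set \<Rightarrow> 'a set set \<Rightarrow> ('a set \<Rightarrow> nat) \<Rightarrow> ('a \<Rightarrow> nat) \<Rightarrow> bool" where
  "vertex_lower_bounds V E w l \<longleftrightarrow>
     (\<forall>F. solution V E F \<longrightarrow> (\<forall>v\<in>V. l v \<le> vertex_power w F v))"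

definition obligatory_edges :: "'a set set \<Rightarrow> ('a set \<Rightarrow> nat) \<Rightarrow> ('a \<Rightarrow> nat) \<Rightarrow> 'a set set" where
  "obligatory_edges E w l = {{u, v} | u v. {u, v} \<in> E \<and> w {u, v} \<le> min (l u) (l v)}"

section \<open>Random access machines\<close>

text \<open>
  The machine model is a unit-cost random access machine over the natural numbers with addition and
  truncated subtraction, but no multiplication, and with an instruction that draws a uniformly
  distributed number.  The memory is organised in arrays, \<open>M a i\<close> being cell \<open>i\<close> of array \<open>a\<close>.
  Array names in programs are constants, so a program accesses finitely many arrays; interleaving
  these in a single sequence of cells, with indirect addressing, costs a constant factor only.
  Expressions occur literally in the program and hence have constant size, so that it is adequate
  to charge one time unit per execution step.
\<close>

type_synonym memory = "nat \<Rightarrow> nat \<Rightarrow> nat"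

datatype aexp =
    Const nat
  | Read nat aexp
  | Plus aexp aexp
  | Minus aexp aexp

primrec aval :: "aexp \<Rightarrow> memory \<Rightarrow> nat" where
  "aval (Const k) M = k"
| "aval (Read a e) M = M a (aval e M)"
| "aval (Plus e1 e2) M = aval e1 M + aval e2 M"
| "aval (Minus e1 e2) M = aval e1 M - aval e2 M"

text \<open>\<open>Write a i e\<close> stores the value of \<open>e\<close> in cell \<open>i\<close> of array \<open>a\<close>; \<open>Sample a i e\<close> stores there a
  number drawn uniformly at random, and independently of all earlier draws, from \<open>{0..k}\<close> where \<open>k\<close>
  is the value of \<open>e\<close>.  Conditions are true iff they are nonzero.\<close>

datatype com =
    Skip
  | Write nat aexp aexp
  | Sample nat aexp aexp
  | Seq com com
  | Cond aexp com com
  | Loop aexp com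

definition set_cell :: "memory \<Rightarrow> nat \<Rightarrow> nat \<Rightarrow> nat \<Rightarrow> memory" where
  "set_cell M a i x = M(a := (M a)(i := x))"

primrec step :: "com \<Rightarrow> memory \<Rightarrow> (com \<times> memory) pmf" where
  "step Skip M = return_pmf (Skip, M)"
| "step (Write a i e) M = return_pmf (Skip, set_cell M a (aval i M) (aval e M))"
| "step (Sample a i e) M =
     map_pmf (\<lambda>x. (Skip, set_cell M a (aval i M) x)) (pmf_of_set {0..aval e M})"
| "step (Seq p q) M =
     (if p = Skip then return_pmf (q, M)
      else map_pmf (\<lambda>(p', M'). (Seq p' q, M')) (step p M))"
| "step (Cond b p q) M = return_pmf (if aval b M \<noteq> 0 then p else q, M)"
| "step (Loop b p) M =
     return_pmf (if aval b M \<noteq> 0 then Seq p (Loop b p) else Skip, M)"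

text \<open>\<open>run t P M\<close> is the distribution of configurations after \<open>t\<close> steps; a configuration is halted
  iff its program component is \<open>Skip\<close>, and it then no longer changes.\<close>

primrec run :: "nat \<Rightarrow> com \<Rightarrow> memory \<Rightarrow> (com \<times> memory) pmf" where
  "run 0 P M = return_pmf (P, M)"
| "run (Suc t) P M = bind_pmf (run t P M) (\<lambda>(P', M'). step P' M')"

primrec deterministic :: "com \<Rightarrow> bool" where
  "deterministic Skip \<longleftrightarrow> True"
| "deterministic (Write a i e) \<longleftrightarrow> True"
| "deterministic (Sample a i e) \<longleftrightarrow> False"
| "deterministic (Seq p q) \<longleftrightarrow> deterministic p \<and> deterministic q"
| "deterministic (Cond b p q) \<longleftrightarrow> deterministic p \<and> deterministic q"
| "deterministic (Loop b p) \<longleftrightarrow> deterministic p"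

text \<open>The time bound is a worst-case bound: it holds for all outcomes of the random draws.\<close>

definition halts_within :: "com \<Rightarrow> memory \<Rightarrow> real \<Rightarrow> bool" where
  "halts_within P M T \<longleftrightarrow> (\<exists>t. real t \<le> T \<and> (\<forall>(P', M') \<in> set_pmf (run t P M). P' = Skip))"

text \<open>Probability that the program halts within \<open>T\<close> steps in a memory satisfying \<open>Q\<close>.\<close>

definition success_prob :: "com \<Rightarrow> memory \<Rightarrow> real \<Rightarrow> (memory \<Rightarrow> bool) \<Rightarrow> real" where
  "success_prob P M T Q =
     measure_pmf.prob (run (nat \<lfloor>T\<rfloor>) P M) {(P', M'). P' = Skip \<and> Q M'}"

section \<open>Inputs and outputs\<close>

text \<open>An input graph has vertex set \<open>{..<n}\<close>.  Its edges come as a list of endpoint pairs that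
  contains each edge exactly once, in arbitrary order and orientation.\<close>

definition edges_of :: "(nat \<times> nat) list \<Rightarrow> nat set set" where
  "edges_of es = (\<lambda>(u, v). {u, v}) ` set es"

definition minpsc_input ::
    "nat \<Rightarrow> (nat \<times> nat) list \<Rightarrow> (nat set \<Rightarrow> nat) \<Rightarrow> (nat \<Rightarrow> nat) \<Rightarrow> bool" where
  "minpsc_input n es w l \<longleftrightarrow>
     simple_graph {..<n} (edges_of es) \<and> distinct (map (\<lambda>(u, v). {u, v}) es) \<and>
     connected_graph {..<n} (edges_of es) \<and> vertex_lower_bounds {..<n} (edges_of es) w l"

definition load_arrays :: "nat list list \<Rightarrow> memory" where
  "load_arrays xss =
     (\<lambda>a i. if a < length xss \<and> i < length (xss ! a) then xss ! a ! i else 0)"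

text \<open>Arrays 0 to 4 hold the numbers of vertices and edges, the lower bounds, the first and the
  second endpoints of the edges, and the edge weights.  Array 5 holds additional parameters.\<close>

definition input_memory ::
    "nat \<Rightarrow> (nat \<times> nat) list \<Rightarrow> (nat set \<Rightarrow> nat) \<Rightarrow> (nat \<Rightarrow> nat) \<Rightarrow> nat list \<Rightarrow> memory" where
  "input_memory n es w l params =
     load_arrays [[n, length es], map l [0..<n], map fst es, map snd es,
                  map (\<lambda>(u, v). w {u, v}) es, params]"

text \<open>The output is the edge set whose characteristic vector, with respect to the given list of
  edges, is in array 6.\<close>

definition output_edges :: "(nat \<times> nat) list \<Rightarrow> memory \<Rightarrow> nat set set" where
  "output_edges es M = edges_of [es ! i. i \<leftarrow> [0..<length es], M 6 i \<noteq> 0]"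

definition outputs_optimum ::
    "nat \<Rightarrow> (nat \<times> nat) list \<Rightarrow> (nat set \<Rightarrow> nat) \<Rightarrow> memory \<Rightarrow> bool" where
  "outputs_optimum n es w M \<longleftrightarrow>
     optimal_solution {..<n} (edges_of es) w (output_edges es M)"

text \<open>A real parameter \<open>\<epsilon>\<close> is passed to a program as a fraction that approximates it from below,
  up to a factor of two; every rational \<open>\<epsilon> = p / q\<close> may in particular be passed exactly.\<close>

definition represents :: "nat \<Rightarrow> nat \<Rightarrow> real \<Rightarrow> bool" where
  "represents p q \<epsilon> \<longleftrightarrow> 0 < p \<and> 0 < q \<and> real p / real q \<le> \<epsilon> \<and> \<epsilon> \<le> 2 * (real p / real q)"

end

theory Submission
  imports Defs
begin

text \<open>Colour coding is not needed: a single deterministic program is fast enough for both parts.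
  Contract the \<open>c\<close> components of the obligatory subgraph, and give a vertex a copy (a slot) for each
  power level that may be useful for it, weighted by the excess over its lower bound.  Then an optimal
  solution is a cheapest tree of slots that meets every component, where slots in the same component
  are linked for free.  A dynamic program over pairs of a slot and a set of components computes it in
  \<open>O(c)\<close> rounds: a slot may either take over a tree from another slot of its component, or join its
  tree by an edge to a tree of a slot in another component.

  Without bit operations on the machine, disjointness of two sets of components cannot be tested
  cheaply.  Instead, component number \<open>k\<close> has the code \<open>2 ^ c + 2 ^ k\<close>, and codes are simply added.
  Since \<open>2 ^ c - 1\<close> is no sum of fewer than \<open>c\<close> powers of two, only a sum that contains each component
  exactly once reaches the total of all codes.  This costs
  \<open>O(c \<cdot> ((c + 1) 2 ^ c)\<^sup>2 n ^ 4)\<close>, which is at most \<open>O(64 ^ c n ^ 4 / sqrt c)\<close>.\<close>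

section \<open>Running time of deterministic programs\<close>

text \<open>Two features keep every rule local. A slot fixes the power of its vertex in advance, so
  whether an edge may be used depends on its two slots only, not on the trees below them. And since
  overlapping trees can be joined unnoticed, intermediate table entries describe multisets of
  components and of edges, paid for with multiplicity; that only overestimates the cost. Only at the
  total of all codes does multiplicity one follow, for components and hence for edges, so that a sum
  of powers of two becomes a readable edge set. Optimality is a sandwich: each finite entry at the
  total yields a solution costing at most the sum of the lower bounds plus the entry, and each
  solution, through a spanning tree of the contracted graph with one slot per vertex, forces an
  entry at most as large as its excess. That the \<open>l v\<close> are true lower bounds makes this
  excess exact under truncated subtraction. For the constant 64: in
  \<open>c * sqrt c * (c + 1)^2 * 4^c\<close>, the factors \<open>c\<close>, \<open>sqrt c\<close>
  and \<open>c + 1\<close> are each at most \<open>2^c\<close>, and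
  \<open>36 e^2 / sqrt (2 pi)\<close> is about 106.\<close>

primrec dstep :: "com \<Rightarrow> memory \<Rightarrow> com \<times> memory" where
  "dstep Skip M = (Skip, M)"
| "dstep (Write a i e) M = (Skip, set_cell M a (aval i M) (aval e M))"
| "dstep (Sample a i e) M = (Skip, M)"
| "dstep (Seq p q) M =
     (if p = Skip then (q, M) else (Seq (fst (dstep p M)) q, snd (dstep p M)))"
| "dstep (Cond b p q) M = (if aval b M \<noteq> 0 then p else q, M)"
| "dstep (Loop b p) M = (if aval b M \<noteq> 0 then Seq p (Loop b p) else Skip, M)"

text \<open>\<open>dstep\<close> gives \<open>Sample\<close> an arbitrary value;
  \<open>deterministic\<close> excludes that case. Its preservation is included so that the step can
  be iterated.\<close>

lemma deterministic_step:
  "deterministic P \<Longrightarrow> step P M = return_pmf (dstep P M) \<and> deterministic (fst (dstep P M))"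
  by (induction P) (auto simp: case_prod_beta')

text \<open>Counts steps from the front and, by \<open>P \<noteq> Skip\<close>, stops counting at a
  halted program.\<close>

inductive reach :: "nat \<Rightarrow> com \<Rightarrow> memory \<Rightarrow> com \<Rightarrow> memory \<Rightarrow> bool" where
  refl: "reach 0 P M P M"
| step: "P \<noteq> Skip \<Longrightarrow> reach t (fst (dstep P M)) (snd (dstep P M)) P' M' \<Longrightarrow> reach (Suc t) P M P' M'"

lemma reach_trans: "reach s P M P' M' \<Longrightarrow> reach t P' M' P'' M'' \<Longrightarrow> reach (s + t) P M P'' M''"
  by (induction rule: reach.induct) (auto intro: reach.intros)

lemma reach_Seq: "reach t P M P' M' \<Longrightarrow> reach t (Seq P Q) M (Seq P' Q) M'"
  by (induction rule: reach.induct) (auto intro: reach.intros)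

text \<open>\<open>run\<close> appends its last step, whereas \<open>reach\<close> peels off the
  first one; this mediates between them.\<close>

lemma run_Suc: "run (Suc t) P M = bind_pmf (step P M) (\<lambda>(P', M'). run t P' M')"
proof (induction t)
  case 0
  show ?case by (simp add: bind_return_pmf case_prod_beta' bind_return_pmf')
next
  case (Suc t)
  have "run (Suc (Suc t)) P M = bind_pmf (run (Suc t) P M) (\<lambda>(P', M'). step P' M')"
    by simp
  also have "\<dots> = bind_pmf (step P M) (\<lambda>(P', M'). run (Suc t) P' M')"
    unfolding Suc by (simp add: bind_assoc_pmf case_prod_beta')
  finally show ?case .
qed

lemma reach_run:
  "reach t P M P' M' \<Longrightarrow> deterministic P \<Longrightarrow> run t P M = return_pmf (P', M')"
proof (induction rule: reach.induct)
  case (refl P M)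
  show ?case by simp
next
  case (step P t M P' M')
  then show ?case
    using deterministic_step[of P M]
    by (simp only: run_Suc) (simp add: bind_return_pmf case_prod_beta')
qed

lemma run_Skip: "run t Skip M = return_pmf (Skip, M)"
  by (induction t) (auto simp: bind_return_pmf)

lemma run_add: "run (s + t) P M = bind_pmf (run s P M) (\<lambda>(P', M'). run t P' M')"
proof (induction s arbitrary: P M)
  case 0
  show ?case by (simp add: bind_return_pmf)
next
  case (Suc s)
  then show ?case
    unfolding add_Suc run_Suc bind_assoc_pmf by (simp add: case_prod_beta')
qed

text \<open>Total correctness within \<open>T\<close> steps from a fixed start memory, which the
  postcondition may therefore mention.\<close>

definition tc :: "com \<Rightarrow> memory \<Rightarrow> nat \<Rightarrow> (memory \<Rightarrow> bool) \<Rightarrow> bool" where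
  "tc P M T Q \<longleftrightarrow> (\<exists>t\<le>T. \<exists>M'. reach t P M Skip M' \<and> Q M')"

text \<open>\<open>success_prob\<close> looks at exactly \<open>nat \<lfloor>B\<rfloor>\<close>
  steps; the surplus beyond the halting time is spent in \<open>Skip\<close>, which does not
  move.\<close>

lemma tc_halts:
  assumes "tc P M T Q" "deterministic P" "real T \<le> B"
  shows "halts_within P M B" "success_prob P M B Q = 1"
proof -
  obtain t M' where t: "t \<le> T" "reach t P M Skip M'" "Q M'"
    using assms(1) unfolding tc_def by blast
  have r: "run t P M = return_pmf (Skip, M')"
    using reach_run[OF t(2) assms(2)] .
  show "halts_within P M B"
    unfolding halts_within_def using t assms(3) by (intro exI[of _ t]) (auto simp: r)
  have "T \<le> nat \<lfloor>B\<rfloor>" using assms(3) by linarith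
  then obtain k where k: "nat \<lfloor>B\<rfloor> = t + k"
    using t(1) by (metis le_trans nat_le_iff_add)
  have "run (nat \<lfloor>B\<rfloor>) P M = return_pmf (Skip, M')"
    unfolding k run_add r by (simp add: bind_return_pmf run_Skip)
  then show "success_prob P M B Q = 1"
    unfolding success_prob_def using t(3) by simp
qed

lemma tc_mono: "tc P M T Q \<Longrightarrow> (\<And>M'. Q M' \<Longrightarrow> Q' M') \<Longrightarrow> T \<le> T' \<Longrightarrow> tc P M T' Q'"
  unfolding tc_def by (meson le_trans)

lemma tc_Skip: "Q M \<Longrightarrow> tc Skip M T Q"
  unfolding tc_def by (blast intro: reach.refl)

lemma tc_Seq:
  assumes "tc p M T1 R" "\<And>M'. R M' \<Longrightarrow> tc q M' T2 Q" "T1 + T2 + 1 \<le> T"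
  shows "tc (Seq p q) M T Q"
proof -
  obtain t M' where t: "t \<le> T1" "reach t p M Skip M'" "R M'"
    using assms(1) unfolding tc_def by blast
  obtain s M'' where s: "s \<le> T2" "reach s q M' Skip M''" "Q M''"
    using assms(2)[OF t(3)] unfolding tc_def by blast
  have "reach (Suc s) (Seq Skip q) M' Skip M''"
    using s(2) by (auto intro: reach.step)
  then have "reach (t + Suc s) (Seq p q) M Skip M''"
    using reach_trans[OF reach_Seq[OF t(2)]] by blast
  then show ?thesis
    unfolding tc_def using s t assms(3) by (intro exI[of _ "t + Suc s"]) auto
qed

lemma tc_Cond:
  assumes "aval b M \<noteq> 0 \<Longrightarrow> tc p M T Q" "aval b M = 0 \<Longrightarrow> tc q M T Q" "T + 1 \<le> T'"
  shows "tc (Cond b p q) M T' Q"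
proof -
  have "tc (if aval b M \<noteq> 0 then p else q) M T Q" using assms(1,2) by auto
  then obtain t M' where t: "t \<le> T" "reach t (if aval b M \<noteq> 0 then p else q) M Skip M'" "Q M'"
    unfolding tc_def by blast
  have "reach (Suc t) (Cond b p q) M Skip M'"
    using t(2) by (intro reach.step) auto
  then show ?thesis
    unfolding tc_def using t assms(3) by (intro exI[of _ "Suc t"]) auto
qed

text \<open>Each iteration pays 2 extra steps, one to unfold the loop and one to discard the
  finished \<open>Skip\<close>; the failing last test pays the final 1.\<close>

lemma tc_Loop:
  assumes "\<And>k M. k < N \<Longrightarrow> I k M \<Longrightarrow> aval b M \<noteq> 0 \<and> tc p M tb (I (Suc k))"
    and "\<And>M. I N M \<Longrightarrow> aval b M = 0"
    and "I 0 M" "N * (tb + 2) + 1 \<le> T"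
  shows "tc (Loop b p) M T (I N)"
proof -
  have "\<exists>t\<le>(N - k) * (tb + 2) + 1. \<exists>M'. reach t (Loop b p) M Skip M' \<and> I N M'"
    if "I k M" "k \<le> N" for k M
    using that
  proof (induction "N - k" arbitrary: k M)
    case 0
    then have "k = N" by simp
    then have "reach (Suc 0) (Loop b p) M Skip M"
      using assms(2)[of M] 0 by (intro reach.step) (auto intro: reach.refl)
    then show ?case using 0 \<open>k = N\<close> by auto
  next
    case (Suc x)
    then have k: "k < N" by simp
    obtain t M1 where t: "t \<le> tb" "reach t p M Skip M1" "I (Suc k) M1"
      using assms(1)[OF k Suc.prems(1)] unfolding tc_def by blast
    have "\<exists>t\<le>(N - Suc k) * (tb + 2) + 1. \<exists>M'. reach t (Loop b p) M1 Skip M' \<and> I N M'"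
      using Suc.hyps(1)[of "Suc k" M1] Suc.hyps(2) k t(3) by simp
    then obtain s M' where s: "s \<le> (N - Suc k) * (tb + 2) + 1" "reach s (Loop b p) M1 Skip M'" "I N M'"
      by blast
    have "reach (Suc s) (Seq Skip (Loop b p)) M1 Skip M'"
      using s(2) by (auto intro: reach.step)
    then have "reach (t + Suc s) (Seq p (Loop b p)) M Skip M'"
      using reach_trans[OF reach_Seq[OF t(2)]] by blast
    then have "reach (Suc (t + Suc s)) (Loop b p) M Skip M'"
      using assms(1)[OF k Suc.prems(1)] by (intro reach.step) auto
    moreover have "N - k = Suc (N - Suc k)" using k by simp
    then have "Suc (t + Suc s) \<le> (N - k) * (tb + 2) + 1"
      using s(1) t(1) by simp
    ultimately show ?case using s(3) by blast
  qed
  from this[of 0 M] show ?thesis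
    unfolding tc_def using assms(3,4) by (metis diff_zero le_trans zero_le)
qed

section \<open>Frame conditions: arrays that a program leaves unchanged\<close>

primrec writes :: "com \<Rightarrow> nat set" where
  "writes Skip = {}"
| "writes (Write a i e) = {a}"
| "writes (Sample a i e) = {a}"
| "writes (Seq p q) = writes p \<union> writes q"
| "writes (Cond b p q) = writes p \<union> writes q"
| "writes (Loop b p) = writes p"

definition same_outside :: "nat set \<Rightarrow> memory \<Rightarrow> memory \<Rightarrow> bool" where
  "same_outside W M M' \<longleftrightarrow> (\<forall>a. a \<notin> W \<longrightarrow> M' a = M a)"

lemma dstep_writes:
  "writes (fst (dstep P M)) \<subseteq> writes P \<and> same_outside (writes P) M (snd (dstep P M))"
  by (induction P) (auto simp: same_outside_def set_cell_def)

lemma reach_writes: "reach t P M P' M' \<Longrightarrow> same_outside (writes P) M M'"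
proof (induction rule: reach.induct)
  case (step P t M P' M')
  then show ?case using dstep_writes[of P M] by (auto simp: same_outside_def)
qed (simp add: same_outside_def)

text \<open>Lets an invariant mention only what the program changes, since all other arrays are
  carried along.\<close>

lemma tc_frame: "tc P M T Q \<Longrightarrow> tc P M T (\<lambda>M'. Q M' \<and> same_outside (writes P) M M')"
  unfolding tc_def using reach_writes by blast

section \<open>Loop-free programs by symbolic execution\<close>

primrec straight :: "com \<Rightarrow> bool" where
  "straight Skip \<longleftrightarrow> True"
| "straight (Write a i e) \<longleftrightarrow> True"
| "straight (Sample a i e) \<longleftrightarrow> False"
| "straight (Seq p q) \<longleftrightarrow> straight p \<and> straight q"
| "straight (Cond b p q) \<longleftrightarrow> straight p \<and> straight q"
| "straight (Loop b p) \<longleftrightarrow> False"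

primrec effect :: "com \<Rightarrow> memory \<Rightarrow> memory" where
  "effect Skip M = M"
| "effect (Write a i e) M = set_cell M a (aval i M) (aval e M)"
| "effect (Sample a i e) M = M"
| "effect (Seq p q) M = effect q (effect p M)"
| "effect (Cond b p q) M = (if aval b M \<noteq> 0 then effect p M else effect q M)"
| "effect (Loop b p) M = M"

text \<open>The sum over both branches bounds a conditional from above without a maximum, so that
  time bounds simplify to numerals.\<close>

primrec duration :: "com \<Rightarrow> nat" where
  "duration Skip = 0"
| "duration (Write a i e) = 1"
| "duration (Sample a i e) = 1"
| "duration (Seq p q) = duration p + duration q + 1"
| "duration (Cond b p q) = duration p + duration q + 1"
| "duration (Loop b p) = 0"

lemma tc_straight_effect: "straight P \<Longrightarrow> tc P M (duration P) (\<lambda>M'. M' = effect P M)"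
proof (induction P arbitrary: M)
  case (Write a i e)
  have "reach (Suc 0) (Write a i e) M Skip (effect (Write a i e) M)"
    by (intro reach.step) (auto intro: reach.refl)
  then show ?case unfolding tc_def by force
next
  case (Seq p q)
  have "tc p M (duration p) (\<lambda>M'. M' = effect p M)" using Seq by simp
  then show ?case using Seq by (elim tc_Seq) auto
next
  case (Cond b p q)
  then have "tc p M (duration p) (\<lambda>M'. M' = effect p M)" "tc q M (duration q) (\<lambda>M'. M' = effect q M)"
    by auto
  then have "tc p M (duration p + duration q) (\<lambda>M'. M' = effect p M)"
    "tc q M (duration p + duration q) (\<lambda>M'. M' = effect q M)"
    by (elim tc_mono; simp)+
  then show ?case by (intro tc_Cond[where T = "duration p + duration q"]) auto
qed (auto intro: tc_Skip)

lemma tc_straight: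
  "straight P \<Longrightarrow> Q (effect P M) \<Longrightarrow> duration P \<le> T \<Longrightarrow> tc P M T Q"
  using tc_mono[OF tc_straight_effect] by blast

lemma tc_straight_Seq:
  assumes "straight p" "tc q (effect p M) T' Q" "duration p + T' + 1 \<le> T"
  shows "tc (Seq p q) M T Q"
  using assms by (intro tc_Seq[OF tc_straight_effect]) auto

section \<open>Derived expressions and counting loops\<close>

abbreviation Var :: "nat \<Rightarrow> aexp" where
  "Var a \<equiv> Read a (Const 0)"

abbreviation Assign :: "nat \<Rightarrow> aexp \<Rightarrow> com" where
  "Assign a e \<equiv> Write a (Const 0) e"

text \<open>Subtraction truncates, so one of the differences is nonzero exactly if the values
  differ.\<close>

abbreviation Neq :: "aexp \<Rightarrow> aexp \<Rightarrow> aexp" where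
  "Neq e1 e2 \<equiv> Plus (Minus e1 e2) (Minus e2 e1)"

text \<open>The counter starts at 0 and grows by the stride \<open>s\<close> while it is below
  \<open>b\<close>: the truncated \<open>Minus b (Var v)\<close> is a strict comparison. Strides let
  table offsets run through multiples of \<open>n * n\<close> without multiplication.\<close>

definition For :: "nat \<Rightarrow> aexp \<Rightarrow> aexp \<Rightarrow> com \<Rightarrow> com" where
  "For v s b p = Seq (Assign v (Const 0)) (Loop (Minus b (Var v)) (Seq p (Assign v (Plus (Var v) s))))"

lemma writes_For [simp]: "writes (For v s b p) = insert v (writes p)"
  by (auto simp: For_def)

lemma deterministic_For [simp]: "deterministic (For v s b p) = deterministic p"
  by (auto simp: For_def)

text \<open>\<open>J\<close> describes the state after \<open>k\<close> iterations; the counter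
  value and the frame are supplied to the body for free. The 4 per iteration are the 2 of
  \<open>tc_Loop\<close>, the increment and its sequencing; the 3 are the initial assignment, its
  sequencing and the failing test.\<close>

lemma tc_For:
  assumes body: "\<And>k M'. k < N \<Longrightarrow> M' v 0 = k * d \<Longrightarrow> same_outside (insert v (writes p)) M M' \<Longrightarrow>
      J k M' \<Longrightarrow> tc p M' tb (J (Suc k))"
    and exprs: "\<And>M'. same_outside (insert v (writes p)) M M' \<Longrightarrow> aval b M' = B \<and> aval s M' = d"
    and bound: "\<And>k. k < N \<longleftrightarrow> k * d < B"
    and v: "v \<notin> writes p"
    and stable: "\<And>k M' x. J k M' \<Longrightarrow> J k (set_cell M' v 0 x)"
    and init: "J 0 M"
    and time: "N * (tb + 4) + 3 \<le> T"
    and post: "\<And>M'. J N M' \<Longrightarrow> same_outside (insert v (writes p)) M M' \<Longrightarrow> Q M'"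
  shows "tc (For v s b p) M T Q"
proof -
  let ?W = "insert v (writes p)"
  let ?I = "\<lambda>k M'. M' v 0 = k * d \<and> same_outside ?W M M' \<and> J k M'"
  have "tc (Loop (Minus b (Var v)) (Seq p (Assign v (Plus (Var v) s)))) (set_cell M v 0 0)
      (N * (tb + 2 + 2) + 1) (?I N)"
  proof (rule tc_Loop)
    fix k M' assume k: "k < N" and I: "?I k M'"
    have "tc p M' tb (\<lambda>M''. J (Suc k) M'' \<and> same_outside (writes p) M' M'')"
      using body[OF k] I by (intro tc_frame) auto
    then have "tc (Seq p (Assign v (Plus (Var v) s))) M' (tb + 2) (?I (Suc k))"
    proof (rule tc_Seq)
      fix M'' assume M'': "J (Suc k) M'' \<and> same_outside (writes p) M' M''"
      then have so: "same_outside ?W M M''" using I by (auto simp: same_outside_def)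
      have "M'' v 0 = k * d" using M'' I v by (simp add: same_outside_def)
      then show "tc (Assign v (Plus (Var v) s)) M'' 1 (?I (Suc k))"
        using exprs[OF so] so M'' stable
        by (intro tc_straight) (auto simp: set_cell_def same_outside_def)
    qed simp
    then show "aval (Minus b (Var v)) M' \<noteq> 0 \<and>
        tc (Seq p (Assign v (Plus (Var v) s))) M' (tb + 2) (?I (Suc k))"
      using exprs[of M'] I bound k by auto
  next
    fix M' assume "?I N M'"
    then show "aval (Minus b (Var v)) M' = 0"
      using exprs[of M'] bound[of N] by auto
  next
    show "?I 0 (set_cell M v 0 0)"
      using stable[OF init] by (auto simp: set_cell_def same_outside_def)
  qed simp
  then have "tc (For v s b p) M (N * (tb + 4) + 3) (?I N)"
    unfolding For_def by (intro tc_straight_Seq) (auto simp: numeral_eq_Suc)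
  then show ?thesis
    by (rule tc_mono) (use post time in auto)
qed

section \<open>Sums of powers of two\<close>

text \<open>Parity makes the number of coins of value 1 odd. Removing one of them, exchanging the
  others in pairs for coins of value 2 and halving all values gives the same equation with one value
  fewer. Each exchange lowers the number of coins, so equality leaves no exchange. The factor
  \<open>q\<close> is arbitrary because missing offsets may be made up by powers of two.\<close>

lemma coins_at_least:
  fixes x :: "nat \<Rightarrow> nat"
  assumes "(\<Sum>i<c. x i * 2 ^ i) + 1 = q * 2 ^ c"
  shows "c \<le> (\<Sum>i<c. x i) \<and> ((\<Sum>i<c. x i) = c \<longrightarrow> (\<forall>i<c. x i = 1))"
  using assms
proof (induction c arbitrary: x)
  case 0
  then show ?case by simp
next
  case (Suc c)
  have split: "(\<Sum>i<Suc c. g i) = g 0 + (\<Sum>i<c. g (Suc i))" for g :: "nat \<Rightarrow> nat"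
    by (rule sum.lessThan_Suc_shift)
  have eq: "x 0 + 2 * (\<Sum>i<c. x (Suc i) * 2 ^ i) + 1 = 2 * (q * 2 ^ c)"
    using Suc.prems unfolding split by (simp add: sum_distrib_left algebra_simps)
  then have "odd (x 0)" by presburger
  then obtain a where a: "x 0 = 2 * a + 1" by (elim oddE)
  define y where "y = (\<lambda>i. x (Suc i) + (if i = 0 then a else 0))"
  show ?case
  \<comment> \<open>With a single value there is no coin of value 2 to receive the exchanged
    pairs.\<close>
  proof (cases "c = 0")
    case True
    then show ?thesis using a by (auto simp: split)
  next
    case False
    then obtain d where d: "c = Suc d" by (cases c) auto
    have ysum: "(\<Sum>i<c. y i) = (\<Sum>i<c. x (Suc i)) + a"
      "(\<Sum>i<c. y i * 2 ^ i) = (\<Sum>i<c. x (Suc i) * 2 ^ i) + a"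
      unfolding d sum.lessThan_Suc_shift y_def by (simp_all add: algebra_simps)
    have "(\<Sum>i<c. y i * 2 ^ i) + 1 = q * 2 ^ c"
      using eq a ysum by simp
    from Suc.IH[OF this] have IH: "c \<le> (\<Sum>i<c. y i)" "(\<Sum>i<c. y i) = c \<longrightarrow> (\<forall>i<c. y i = 1)"
      by auto
    have tot: "(\<Sum>i<Suc c. x i) = (\<Sum>i<c. y i) + a + 1"
      unfolding split ysum using a by simp
    have "\<forall>i<Suc c. x i = 1" if "(\<Sum>i<Suc c. x i) = Suc c"
    proof -
      have "a = 0" "(\<Sum>i<c. y i) = c" using that tot IH(1) by auto
      then have "\<forall>i<c. x (Suc i) = 1" "x 0 = 1" using IH(2) a by (auto simp: y_def)
      then show ?thesis by (simp add: All_less_Suc2)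
    qed
    moreover have "Suc c \<le> (\<Sum>i<Suc c. x i)" using tot IH(1) by linarith
    ultimately show ?thesis by blast
  qed
qed

lemma sum_power2_eq: "(\<Sum>i<c. 2 ^ i) + 1 = (2::nat) ^ c"
  by (induction c) auto

text \<open>Splitting off the offsets leaves a sum of powers of two that is -1 modulo
  \<open>2 ^ c\<close>, while the offsets bound the number of coins by \<open>c\<close>. By
  \<open>coins_at_least\<close> that number is also at least \<open>c\<close>, and the equality case
  applies.\<close>

lemma coins_with_offset:
  fixes x :: "nat \<Rightarrow> nat"
  assumes eq: "(\<Sum>i<c. x i * (2 ^ c + 2 ^ i)) = (\<Sum>i<c. 2 ^ c + 2 ^ i)" and i: "i < c"
  shows "x i = 1"
proof -
  let ?h = "\<Sum>i<c. x i" and ?v = "\<Sum>i<c. x i * 2 ^ i"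
  note pw = sum_power2_eq[of c]
  have "?h * 2 ^ c + ?v + 1 = c * 2 ^ c + ((\<Sum>i<c. 2 ^ i) + 1)"
    using eq by (simp add: sum.distrib distrib_left sum_distrib_right)
  then have eq': "?h * 2 ^ c + ?v + 1 = (c + 1) * 2 ^ c"
    unfolding pw by simp
  then have "?h * 2 ^ c < (c + 1) * 2 ^ c" by linarith
  then have "?h < c + 1" using mult_less_cancel2 by blast
  then have "?h \<le> c" by simp
  have "?v + 1 = (c + 1 - ?h) * 2 ^ c"
    using eq' \<open>?h \<le> c\<close> by (simp add: diff_mult_distrib)
  from coins_at_least[OF this] show ?thesis
    using \<open>?h \<le> c\<close> i by auto
qed

lemma sum_power2_bound: "finite S \<Longrightarrow> S \<subseteq> {..<k} \<Longrightarrow> (\<Sum>e\<in>S. 2 ^ e) < (2::nat) ^ k"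
proof -
  assume "finite S" "S \<subseteq> {..<k}"
  then have "(\<Sum>e\<in>S. 2 ^ e) \<le> (\<Sum>e<k. 2 ^ e :: nat)" by (intro sum_mono2) auto
  also have "\<dots> < 2 ^ k" by (induction k) auto
  finally show ?thesis .
qed

section \<open>Reachability\<close>

definition adj_rel :: "'a set set \<Rightarrow> ('a \<times> 'a) set" where
  "adj_rel F = {(x, y). {x, y} \<in> F}"

lemma sym_adj_rel: "sym (adj_rel F)"
  by (auto simp: sym_def adj_rel_def insert_commute)

lemma adj_rel_mono: "F \<subseteq> F' \<Longrightarrow> (adj_rel F)\<^sup>* \<subseteq> (adj_rel F')\<^sup>*"
  by (intro rtrancl_mono) (auto simp: adj_rel_def)

lemma rtrancl_crossing:
  assumes "(x, y) \<in> r\<^sup>*" "P x" "\<not> P y"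
  shows "\<exists>a b. (a, b) \<in> r \<and> P a \<and> \<not> P b"
  using assms by (induction rule: rtrancl_induct) auto

section \<open>Instances with labelled obligatory components\<close>

locale minpsc =
  fixes n :: nat and es :: "(nat \<times> nat) list" and w :: "nat set \<Rightarrow> nat" and l :: "nat \<Rightarrow> nat"
  assumes input: "minpsc_input n es w l"
begin

abbreviation "E \<equiv> edges_of es"
abbreviation "m \<equiv> length es"
abbreviation "Obl \<equiv> obligatory_edges E w l"

definition edge :: "nat \<Rightarrow> nat set" where
  "edge e = {fst (es ! e), snd (es ! e)}"

lemma n_pos: "0 < n"
  using input by (auto simp: minpsc_input_def simple_graph_def)

lemma E_edge: "E = edge ` {..<m}"
proof -
  have "set es = (!) es ` {..<m}" by (auto simp: set_conv_nth)
  then show ?thesis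
    unfolding edges_of_def edge_def case_prod_beta' by (simp add: image_image)
qed

lemma inj_edge: "inj_on edge {..<m}"
proof (rule inj_onI)
  fix a b assume ab: "a \<in> {..<m}" "b \<in> {..<m}" "edge a = edge b"
  have "distinct (map (\<lambda>(u, v). {u, v}) es)" using input by (simp add: minpsc_input_def)
  then show "a = b"
    using ab unfolding distinct_conv_nth edge_def by (auto simp: case_prod_beta)
qed

lemma E_cases: "{u, v} \<in> E \<Longrightarrow> u < n \<and> v < n \<and> u \<noteq> v"
proof -
  assume "{u, v} \<in> E"
  then obtain a b where "a < n" "b < n" "a \<noteq> b" "{u, v} = {a, b}"
    using input unfolding minpsc_input_def simple_graph_def by (metis lessThan_iff)
  then show ?thesis by (auto simp: doubleton_eq_iff)
qed

lemma nth_edge: "e < m \<Longrightarrow> fst (es ! e) < n \<and> snd (es ! e) < n \<and> fst (es ! e) \<noteq> snd (es ! e)"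
  using E_cases[of "fst (es ! e)" "snd (es ! e)"] unfolding E_edge edge_def by blast

lemma E_doubleton: "f \<in> E \<Longrightarrow> \<exists>u v. f = {u, v} \<and> u < n \<and> v < n \<and> u \<noteq> v"
  unfolding E_edge using nth_edge by (auto simp: edge_def)

lemma m_le: "m \<le> n * n"
proof -
  have "inj_on (\<lambda>e. es ! e) {..<m}"
    using inj_edge by (auto simp: inj_on_def edge_def)
  moreover have "(\<lambda>e. es ! e) ` {..<m} \<subseteq> {..<n} \<times> {..<n}"
    unfolding image_subset_iff mem_Times_iff using nth_edge by blast
  ultimately have "card {..<m} \<le> card ({..<n} \<times> {..<n})"
    by (intro card_inj_on_le) auto
  then show ?thesis by (simp add: card_cartesian_product)
qed

lemma Obl_subset: "Obl \<subseteq> E"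
  by (auto simp: obligatory_edges_def)

lemma Obl_iff: "{u, v} \<in> Obl \<longleftrightarrow> {u, v} \<in> E \<and> w {u, v} \<le> l u \<and> w {u, v} \<le> l v"
  by (auto simp: obligatory_edges_def doubleton_eq_iff insert_commute)

lemma finite_power_set: "finite {w {u, v} |v. {u, v} \<in> F}" if "F \<subseteq> E"
proof -
  have "{w {u, v} |v. {u, v} \<in> F} \<subseteq> (\<lambda>v. w {u, v}) ` {..<n}"
    using that E_cases by blast
  then show ?thesis by (rule finite_subset) auto
qed

lemma vertex_power_eq: "vertex_power w F u = Max (insert 0 {w {u, v} |v. {u, v} \<in> F})"
  unfolding vertex_power_def by (simp add: insert_commute)

lemma vertex_power_ge: "F \<subseteq> E \<Longrightarrow> {u, v} \<in> F \<Longrightarrow> w {u, v} \<le> vertex_power w F u"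
  unfolding vertex_power_eq by (intro Max_ge) (auto simp: finite_power_set)

lemma vertex_power_le:
  "F \<subseteq> E \<Longrightarrow> (\<And>v. {u, v} \<in> F \<Longrightarrow> w {u, v} \<le> b) \<Longrightarrow> vertex_power w F u \<le> b"
  unfolding vertex_power_eq by (subst Max_le_iff) (auto simp: finite_power_set)

lemma vertex_power_mono: "F \<subseteq> F' \<Longrightarrow> F' \<subseteq> E \<Longrightarrow> vertex_power w F u \<le> vertex_power w F' u"
  by (intro vertex_power_le) (auto intro: vertex_power_ge)

lemma vertex_power_attained:
  assumes "F \<subseteq> E"
  shows "vertex_power w F u = 0 \<or> (\<exists>v. {u, v} \<in> F \<and> vertex_power w F u = w {u, v})"
proof -
  have "vertex_power w F u \<in> insert 0 {w {u, v} |v. {u, v} \<in> F}"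
    unfolding vertex_power_eq using assms by (intro Max_in) (auto simp: finite_power_set)
  then show ?thesis by auto
qed

text \<open>The slot \<open>n * u + v\<close> stands for vertex \<open>u\<close> with power \<open>w {u, v}\<close>, or with power \<open>0\<close> if
  there is no such edge.\<close>

definition slot_power :: "nat \<Rightarrow> nat" where
  "slot_power i = (if {i div n, i mod n} \<in> E then w {i div n, i mod n} else 0)"

text \<open>Truncation makes powers up to the lower bound free, since that bound is charged to every
  vertex in advance.\<close>

definition slot_weight :: "nat \<Rightarrow> nat" where
  "slot_weight i = slot_power i - l (i div n)"

lemma slot_div_mod [simp]: "v < n \<Longrightarrow> (n * u + v) div n = u" "v < n \<Longrightarrow> (n * u + v) mod n = v"
  by auto

lemma slot_less: "u < n \<Longrightarrow> v < n \<Longrightarrow> n * u + v < n * n"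
proof -
  assume "u < n" "v < n"
  then have "n * u + v < n * (u + 1)" by simp
  also have "\<dots> \<le> n * n" using \<open>u < n\<close> by (intro mult_left_mono) auto
  finally show ?thesis .
qed

lemma slot_vertex: "i < n * n \<Longrightarrow> i div n < n"
  by (simp add: less_mult_imp_div_less)

end

text \<open>\<open>K\<close> stays abstract because it will be the array that the program computes;
  which representatives arise depends on the edge list.\<close>

locale minpsc_comps = minpsc +
  fixes K :: "nat \<Rightarrow> nat"
  assumes K_reachable: "u < n \<Longrightarrow> v < n \<Longrightarrow> K u = K v \<longleftrightarrow> (u, v) \<in> (adj_rel Obl)\<^sup>*"
    and K_less: "u < n \<Longrightarrow> K u < n"
    and K_idem: "u < n \<Longrightarrow> K (K u) = K u"
begin

definition R :: "nat set" where
  "R = {v. v < n \<and> K v = v}"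

definition c :: nat where
  "c = card R"

definition rank :: "nat \<Rightarrow> nat" where
  "rank k = card {v \<in> R. v < k}"

definition code :: "nat \<Rightarrow> nat" where
  "code k = 2 ^ c + 2 ^ rank k"

definition target :: nat where
  "target = (\<Sum>k\<in>R. code k)"

lemma finite_R [simp]: "finite R"
  by (simp add: R_def)

lemma K_in_R: "u < n \<Longrightarrow> K u \<in> R"
  by (simp add: R_def K_less K_idem)

lemma R_eq: "R = K ` {..<n}"
  using K_in_R by (force simp: R_def image_iff)

text \<open>The classes are the fibres of \<open>K\<close>, and each fibre contains exactly one
  fixed point of \<open>K\<close>.\<close>

lemma num_components_eq: "num_components {..<n} Obl = c"
proof -
  let ?rel = "reachable {..<n} Obl"
  have cls: "?rel `` {u} = {v. v < n \<and> K v = K u}" if "u < n" for u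
    using that K_reachable[of u] unfolding reachable_def adj_rel_def[symmetric] Image_singleton
    by (intro Collect_cong) (simp, metis)
  have "{..<n} // ?rel = (\<lambda>u. ?rel `` {u}) ` {..<n}"
    unfolding quotient_def by blast
  also have "\<dots> = (\<lambda>u. {v. v < n \<and> K v = K u}) ` {..<n}"
    using cls by (intro image_cong) simp_all
  finally have "{..<n} // ?rel = (\<lambda>k. {v. v < n \<and> K v = k}) ` R"
    unfolding R_eq image_image .
  moreover have "inj_on (\<lambda>k. {v. v < n \<and> K v = k}) R"
  proof (rule inj_onI)
    fix a b assume ab: "a \<in> R" "{v. v < n \<and> K v = a} = {v. v < n \<and> K v = b}"
    have "a \<in> {v. v < n \<and> K v = a}" using ab(1) by (simp add: R_def)
    then have "K a = b" unfolding ab(2) by simp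
    then show "a = b" using ab(1) by (simp add: R_def)
  qed
  ultimately show ?thesis
    unfolding num_components_def c_def by (simp add: card_image)
qed

lemma c_pos: "0 < c"
  unfolding c_def using K_in_R[OF n_pos] by (auto simp: card_gt_0_iff)

lemma rank_bij: "bij_betw rank R {..<c}"
proof -
  have less: "rank a < rank b" if "a \<in> R" "a < b" for a b
    unfolding rank_def using that by (intro psubset_card_mono) auto
  have inj: "inj_on rank R"
    by (rule inj_onI) (metis less less_irrefl linorder_neqE_nat)
  have "rank k < c" if "k \<in> R" for k
    unfolding rank_def c_def using that by (intro psubset_card_mono) auto
  then have "rank ` R \<subseteq> {..<c}" by auto
  moreover have "card (rank ` R) = card {..<c}"
    using card_image[OF inj] by (simp add: c_def)
  ultimately have "rank ` R = {..<c}" by (intro card_subset_eq) auto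
  then show ?thesis using inj by (simp add: bij_betw_def)
qed

lemma sum_rank: "(\<Sum>k\<in>R. g (rank k)) = (\<Sum>i<c. g i)"
  using sum.reindex_bij_betw[OF rank_bij] .

text \<open>\<open>target + 1\<close> is the number of codes that the table loops visit, hence the
  factor \<open>(c + 1) * 2 ^ c\<close> in the time bound.\<close>

lemma target_eq: "target + 1 = (c + 1) * 2 ^ c"
proof -
  have "target = (\<Sum>i<c. 2 ^ c + 2 ^ i)"
    unfolding target_def code_def using sum_rank[of "\<lambda>i. 2 ^ c + 2 ^ i"] .
  moreover have "(\<Sum>i<c. 2 ^ i) + 1 = (2::nat) ^ c" using sum_power2_eq .
  ultimately show ?thesis by (simp add: sum.distrib)
qed

text \<open>Replaces a disjointness test: \<open>rank\<close> turns multiplicities of components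
  into numbers of coins, and \<open>coins_with_offset\<close> applies.\<close>

lemma code_sum_target:
  assumes "set_mset A \<subseteq> R" "(\<Sum>k\<in>#A. code k) = target" "k \<in> R"
  shows "count A k = 1"
proof -
  define g where "g = inv_into R rank"
  have g: "g (rank k) = k" if "k \<in> R" for k
    using that rank_bij by (simp add: g_def bij_betw_def)
  have "(\<Sum>k\<in>#A. code k) = (\<Sum>k\<in>R. count A k * code k)"
    using assms(1)
  proof (induction A)
    case (add x A)
    have "(\<Sum>k\<in>R. count (add_mset x A) k * code k) =
        (\<Sum>k\<in>R. count A k * code k + (if k = x then code x else 0))"
      by (intro sum.cong) auto
    then show ?case using add by (simp add: sum.distrib)
  qed simp
  also have "\<dots> = (\<Sum>k\<in>R. count A (g (rank k)) * (2 ^ c + 2 ^ rank k))"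
    by (intro sum.cong) (auto simp: g code_def)
  also have "\<dots> = (\<Sum>i<c. count A (g i) * (2 ^ c + 2 ^ i))"
    using sum_rank[of "\<lambda>i. count A (g i) * (2 ^ c + 2 ^ i)"] .
  finally have "(\<Sum>i<c. count A (g i) * (2 ^ c + 2 ^ i)) = (\<Sum>i<c. 2 ^ c + 2 ^ i)"
    using assms(2) sum_rank[of "\<lambda>i. 2 ^ c + 2 ^ i :: nat"] unfolding target_def code_def by simp
  moreover have "rank k < c" using rank_bij assms(3) by (auto simp: bij_betw_def)
  ultimately show ?thesis
    using coins_with_offset g[OF assms(3)] by metis
qed

end

context minpsc_comps
begin

section \<open>Soundness of the dynamic program\<close>

text \<open>A table entry for slot \<open>i\<close> and component code \<open>s\<close>, with value \<open>d\<close> and edge code \<open>f\<close>, is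
  witnessed by a connected collection \<open>A\<close> of components, a collection \<open>B\<close> of edges connecting it, and
  powers \<open>q\<close> that allow these edges and exceed the lower bounds by at most \<open>d\<close> in total.  Both
  collections may contain repetitions, but if \<open>A\<close> does not, then neither does \<open>B\<close>.\<close>

definition witnessed :: "nat \<Rightarrow> nat \<Rightarrow> nat \<Rightarrow> nat \<Rightarrow> bool" where
  "witnessed i s d f \<longleftrightarrow> (\<exists>A B q.
     set_mset A \<subseteq> R \<and> s = (\<Sum>k\<in>#A. code k) \<and> f = (\<Sum>e\<in>#B. 2 ^ e) \<and>
     (\<forall>e\<in>#B. e < m \<and> (\<forall>x\<in>edge e. K x \<in># A \<and> w (edge e) \<le> q x)) \<and>
     ((\<forall>k. count A k \<le> 1) \<longrightarrow> (\<forall>e. count B e \<le> 1)) \<and>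
     (\<forall>x<n. \<forall>y<n. K x \<in># A \<longrightarrow> K y \<in># A \<longrightarrow> (x, y) \<in> (adj_rel (Obl \<union> edge ` set_mset B))\<^sup>*) \<and>
     K (i div n) \<in># A \<and> slot_power i \<le> q (i div n) \<and> (\<Sum>x<n. q x - l x) \<le> d)"

text \<open>The edge joins the vertices of the slots; the powers of the slots may come from other,
  heavier edges.\<close>

definition compatible :: "nat \<Rightarrow> nat \<Rightarrow> bool" where
  "compatible i j \<longleftrightarrow> {i div n, j div n} \<in> E \<and> w {i div n, j div n} \<le> slot_power i \<and>
     w {i div n, j div n} \<le> slot_power j \<and> K (i div n) \<noteq> K (j div n)"

text \<open>Obligatory edges already connect the single component, and power 0 elsewhere has no
  excess.\<close>

lemma witnessed_base:
  assumes i: "i < n * n"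
  shows "witnessed i (code (K (i div n))) (slot_weight i) 0"
proof -
  let ?u = "i div n"
  let ?q = "\<lambda>x. if x = ?u then slot_power i else 0"
  have u: "?u < n" using slot_vertex[OF i] .
  have "(\<Sum>x<n. ?q x - l x) = (\<Sum>x<n. if x = ?u then slot_weight i else 0)"
    by (intro sum.cong) (auto simp: slot_weight_def)
  then have "(\<Sum>x<n. ?q x - l x) \<le> slot_weight i" using u by simp
  moreover have "(x, y) \<in> (adj_rel Obl)\<^sup>*" if "x < n" "y < n" "K x = K ?u" "K y = K ?u" for x y
    using that K_reachable[of x y] by simp
  ultimately show ?thesis
    unfolding witnessed_def using K_in_R[OF u]
    by (intro exI[of _ "{#K ?u#}"] exI[of _ "{#}"] exI[of _ ?q]) auto
qed

text \<open>Moving the root inside a component raises the power at the new vertex to the maximum of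
  old and new. The full \<open>slot_weight i\<close> is charged even if that vertex had power
  before; only an upper bound is claimed.\<close>

lemma witnessed_jump:
  assumes "witnessed j s d f" and i: "i < n * n" and eq: "K (i div n) = K (j div n)"
  shows "witnessed i s (d + slot_weight i) f"
proof -
  let ?u = "i div n"
  have u: "?u < n" using slot_vertex[OF i] .
  obtain A B q where AB: "set_mset A \<subseteq> R" "s = (\<Sum>k\<in>#A. code k)" "f = (\<Sum>e\<in>#B. 2 ^ e)"
     "\<forall>e\<in>#B. e < m \<and> (\<forall>x\<in>edge e. K x \<in># A \<and> w (edge e) \<le> q x)"
     "(\<forall>k. count A k \<le> 1) \<longrightarrow> (\<forall>e. count B e \<le> 1)"
     "\<forall>x<n. \<forall>y<n. K x \<in># A \<longrightarrow> K y \<in># A \<longrightarrow> (x, y) \<in> (adj_rel (Obl \<union> edge ` set_mset B))\<^sup>*"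
     "K (j div n) \<in># A" "(\<Sum>x<n. q x - l x) \<le> d"
    using assms(1) unfolding witnessed_def by blast
  let ?q = "\<lambda>x. if x = ?u then max (q x) (slot_power i) else q x"
  have "(\<Sum>x<n. ?q x - l x) \<le> (\<Sum>x<n. (q x - l x) + (if x = ?u then slot_weight i else 0))"
    by (intro sum_mono) (auto simp: slot_weight_def)
  also have "\<dots> \<le> d + slot_weight i" using u AB(8) by (simp add: sum.distrib)
  finally have "(\<Sum>x<n. ?q x - l x) \<le> d + slot_weight i" .
  moreover have "\<forall>e\<in>#B. e < m \<and> (\<forall>x\<in>edge e. K x \<in># A \<and> w (edge e) \<le> ?q x)"
    using AB(4) by (auto simp: le_max_iff_disj)
  ultimately show ?thesis
    unfolding witnessed_def using AB eq
    by (intro exI[of _ A] exI[of _ B] exI[of _ ?q]) auto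
qed

text \<open>The pointwise maximum of the powers has at most the sum of the two excesses. If the
  components stay distinct, so do the edges: those of the two parts lie over disjoint sets of
  components, and the new edge lies over both.\<close>

lemma witnessed_merge:
  assumes w1: "witnessed i s1 d1 f1" and w2: "witnessed j s2 d2 f2"
    and i: "i < n * n" and j: "j < n * n" and comp: "compatible i j"
    and e: "e < m" "edge e = {i div n, j div n}"
  shows "witnessed i (s1 + s2) (d1 + d2) (f1 + f2 + 2 ^ e)"
proof -
  let ?u = "i div n" and ?v = "j div n"
  have u: "?u < n" and v: "?v < n" using slot_vertex i j by auto
  obtain A1 B1 q1 where A1: "set_mset A1 \<subseteq> R" "s1 = (\<Sum>k\<in>#A1. code k)"
     "f1 = (\<Sum>e\<in>#B1. 2 ^ e)"
     "\<forall>e\<in>#B1. e < m \<and> (\<forall>x\<in>edge e. K x \<in># A1 \<and> w (edge e) \<le> q1 x)"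
     "(\<forall>k. count A1 k \<le> 1) \<longrightarrow> (\<forall>e. count B1 e \<le> 1)"
     "\<forall>x<n. \<forall>y<n. K x \<in># A1 \<longrightarrow> K y \<in># A1 \<longrightarrow> (x, y) \<in> (adj_rel (Obl \<union> edge ` set_mset B1))\<^sup>*"
     "K ?u \<in># A1" "slot_power i \<le> q1 ?u" "(\<Sum>x<n. q1 x - l x) \<le> d1"
    using w1 unfolding witnessed_def by blast
  obtain A2 B2 q2 where A2: "set_mset A2 \<subseteq> R" "s2 = (\<Sum>k\<in>#A2. code k)"
     "f2 = (\<Sum>e\<in>#B2. 2 ^ e)"
     "\<forall>e\<in>#B2. e < m \<and> (\<forall>x\<in>edge e. K x \<in># A2 \<and> w (edge e) \<le> q2 x)"
     "(\<forall>k. count A2 k \<le> 1) \<longrightarrow> (\<forall>e. count B2 e \<le> 1)"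
     "\<forall>x<n. \<forall>y<n. K x \<in># A2 \<longrightarrow> K y \<in># A2 \<longrightarrow> (x, y) \<in> (adj_rel (Obl \<union> edge ` set_mset B2))\<^sup>*"
     "K ?v \<in># A2" "slot_power j \<le> q2 ?v" "(\<Sum>x<n. q2 x - l x) \<le> d2"
    using w2 unfolding witnessed_def by blast
  let ?A = "A1 + A2" and ?B = "add_mset e (B1 + B2)" and ?q = "\<lambda>x. max (q1 x) (q2 x)"
  have we: "w (edge e) \<le> q1 ?u" "w (edge e) \<le> q2 ?v"
    using comp A1(8) A2(8) unfolding compatible_def e(2) by auto
  have edges: "\<forall>e\<in>#?B. e < m \<and> (\<forall>x\<in>edge e. K x \<in># ?A \<and> w (edge e) \<le> ?q x)"
  proof
    fix g assume "g \<in># ?B"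
    then consider "g = e" | "g \<in># B1" | "g \<in># B2" by auto
    then show "g < m \<and> (\<forall>x\<in>edge g. K x \<in># ?A \<and> w (edge g) \<le> ?q x)"
    proof cases
      case 1
      then show ?thesis using e we A1(7) A2(7) by auto
    qed (use A1(4) A2(4) in \<open>auto simp: le_max_iff_disj\<close>)
  qed
  have distinct: "\<forall>g. count ?B g \<le> 1" if A: "\<forall>k. count ?A k \<le> 1"
  proof
    fix g
    have c1: "\<forall>k. count A1 k \<le> 1" and c2: "\<forall>k. count A2 k \<le> 1"
      using A by (auto intro: le_trans add_leD1 add_leD2)
    have disj: "\<not> (k \<in># A1 \<and> k \<in># A2)" for k
    proof
      assume "k \<in># A1 \<and> k \<in># A2"
      then have "1 \<le> count A1 k" "1 \<le> count A2 k" by (auto simp: Suc_le_eq)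
      then show False using A[rule_format, of k] unfolding count_union by linarith
    qed
    have ne: "\<exists>x. x \<in> edge g" by (auto simp: edge_def)
    have B12: "g \<notin># B2" if "g \<in># B1" using that A1(4) A2(4) disj ne by blast
    have e1: "e \<notin># B1" using A1(4) A2(7) e(2) disj by blast
    have e2: "e \<notin># B2" using A2(4) A1(7) e(2) disj by blast
    have "count B1 g \<le> 1" "count B2 g \<le> 1" using A1(5) A2(5) c1 c2 by auto
    then show "count ?B g \<le> 1"
      using B12 e1 e2 by (cases "g = e"; cases "g \<in># B1") (auto simp: not_in_iff)
  qed
  have conn: "(x, y) \<in> (adj_rel (Obl \<union> edge ` set_mset ?B))\<^sup>*"
    if "x < n" "y < n" "K x \<in># ?A" "K y \<in># ?A" for x y
  proof -
    let ?r = "(adj_rel (Obl \<union> edge ` set_mset ?B))\<^sup>*"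
    have sub: "(adj_rel (Obl \<union> edge ` set_mset B1))\<^sup>* \<subseteq> ?r" "(adj_rel (Obl \<union> edge ` set_mset B2))\<^sup>* \<subseteq> ?r"
      by (intro adj_rel_mono; auto)+
    have vu: "(?v, ?u) \<in> ?r"
      using e by (intro r_into_rtrancl) (auto simp: adj_rel_def insert_commute)
    have *: "(z, ?u) \<in> ?r" if "z < n" "K z \<in># ?A" for z
    proof (cases "K z \<in># A1")
      case True
      then have "(z, ?u) \<in> (adj_rel (Obl \<union> edge ` set_mset B1))\<^sup>*"
        using A1(6,7) that(1) u by blast
      then show ?thesis using sub by blast
    next
      case False
      then have "K z \<in># A2" using that by simp
      then have "(z, ?v) \<in> (adj_rel (Obl \<union> edge ` set_mset B2))\<^sup>*"
        using A2(6,7) that(1) v by blast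
      then have "(z, ?v) \<in> ?r" using sub by blast
      then show ?thesis using vu by (rule rtrancl_trans)
    qed
    have "(?u, y) \<in> ?r"
      using *[OF that(2,4)] sym_rtrancl[OF sym_adj_rel] by (meson symD)
    then show ?thesis using *[OF that(1,3)] by (meson rtrancl_trans)
  qed
  have "(\<Sum>x<n. ?q x - l x) \<le> (\<Sum>x<n. (q1 x - l x) + (q2 x - l x))"
    by (intro sum_mono) auto
  then have sum: "(\<Sum>x<n. ?q x - l x) \<le> d1 + d2"
    using A1(9) A2(9) by (simp add: sum.distrib)
  have "set_mset ?A \<subseteq> R" using A1(1) A2(1) by simp
  moreover have "s1 + s2 = (\<Sum>k\<in>#?A. code k)" using A1(2) A2(2) by simp
  moreover have "f1 + f2 + 2 ^ e = (\<Sum>e\<in>#?B. 2 ^ e)" using A1(3) A2(3) by simp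
  moreover have "K ?u \<in># ?A" using A1(7) by simp
  moreover have "slot_power i \<le> ?q ?u" using A1(8) by (simp add: le_max_iff_disj)
  moreover have "\<forall>x<n. \<forall>y<n. K x \<in># ?A \<longrightarrow> K y \<in># ?A \<longrightarrow>
      (x, y) \<in> (adj_rel (Obl \<union> edge ` set_mset ?B))\<^sup>*"
    using conn by blast
  moreover have "(\<forall>k. count ?A k \<le> 1) \<longrightarrow> (\<forall>e. count ?B e \<le> 1)"
    using distinct by blast
  ultimately show ?thesis
    unfolding witnessed_def using edges sum
    by (intro exI[of _ ?A] exI[of _ ?B] exI[of _ ?q] conjI) assumption+
qed

text \<open>At \<open>target\<close> each component occurs once, so the edge code is that of a set
  and all vertices are connected. A power is at most \<open>l x\<close> through obligatory edges and
  at most \<open>q x\<close> through the others.\<close>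

lemma witnessed_target:
  assumes "witnessed i target d f"
  shows "\<exists>S. S \<subseteq> {..<m} \<and> f = (\<Sum>e\<in>S. 2 ^ e) \<and> solution {..<n} E (Obl \<union> edge ` S) \<and>
    cost {..<n} w (Obl \<union> edge ` S) \<le> (\<Sum>x<n. l x) + d"
proof -
  obtain A B q where A: "set_mset A \<subseteq> R" "target = (\<Sum>k\<in>#A. code k)"
     "f = (\<Sum>e\<in>#B. 2 ^ e)"
     "\<forall>e\<in>#B. e < m \<and> (\<forall>x\<in>edge e. K x \<in># A \<and> w (edge e) \<le> q x)"
     "(\<forall>k. count A k \<le> 1) \<longrightarrow> (\<forall>e. count B e \<le> 1)"
     "\<forall>x<n. \<forall>y<n. K x \<in># A \<longrightarrow> K y \<in># A \<longrightarrow> (x, y) \<in> (adj_rel (Obl \<union> edge ` set_mset B))\<^sup>*"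
     "(\<Sum>x<n. q x - l x) \<le> d"
    using assms unfolding witnessed_def by blast
  let ?S = "set_mset B" and ?F = "Obl \<union> edge ` set_mset B"
  have one: "count A k = 1" if "k \<in> R" for k
    using code_sum_target[OF A(1) A(2)[symmetric] that] .
  have "count A k \<le> 1" for k
  proof (cases "k \<in> R")
    case False
    then have "k \<notin># A" using A(1) by blast
    then show ?thesis by (simp add: not_in_iff)
  qed (simp add: one)
  then have B1: "count B e \<le> 1" for e using A(5) by blast
  have "B = mset_set ?S"
  proof (rule multiset_eqI)
    fix e show "count B e = count (mset_set ?S) e"
      using B1[of e] count_greater_zero_iff[of B e]
      by (cases "e \<in># B") (auto simp: not_in_iff simp del: count_greater_zero_iff)
  qed
  then have f: "f = (\<Sum>e\<in>?S. 2 ^ e)"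
    using A(3) by (metis sum_unfold_sum_mset)
  have FE: "?F \<subseteq> E" using A(4) Obl_subset by (auto simp: E_edge)
  have mem: "K x \<in># A" if "x < n" for x
    using one[OF K_in_R[OF that]] by (metis count_eq_zero_iff zero_neq_one)
  have "connected_graph {..<n} ?F"
    unfolding connected_graph_def reachable_def adj_rel_def[symmetric]
    using A(6) mem by auto
  then have sol: "solution {..<n} E ?F" using FE by (simp add: solution_def)
  \<comment> \<open>By truncation, \<open>l x + (q x - l x)\<close> is the maximum of
    \<open>l x\<close> and \<open>q x\<close>.\<close>
  have "vertex_power w ?F x \<le> l x + (q x - l x)" for x
  proof (rule vertex_power_le[OF FE])
    fix v assume "{x, v} \<in> ?F"
    then consider "{x, v} \<in> Obl" | e where "e \<in># B" "edge e = {x, v}" by auto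
    then show "w {x, v} \<le> l x + (q x - l x)"
    proof cases
      case 1
      then show ?thesis by (simp add: Obl_iff)
    next
      case 2
      then have "w {x, v} \<le> q x" using A(4) by fastforce
      then show ?thesis by simp
    qed
  qed
  then have "cost {..<n} w ?F \<le> (\<Sum>x<n. l x + (q x - l x))"
    unfolding cost_def by (intro sum_mono)
  also have "\<dots> \<le> (\<Sum>x<n. l x) + d" using A(7) by (simp add: sum.distrib)
  finally show ?thesis using f sol A(4) by (intro exI[of _ ?S]) auto
qed

section \<open>Completeness of the dynamic program\<close>

text \<open>Trees in the contracted graph.  The rule \<open>join\<close> is symmetric, so that a tree can be decomposed
  at any of its edges.\<close>

inductive tree :: "nat set \<Rightarrow> nat set set \<Rightarrow> bool" where
  single: "k \<in> R \<Longrightarrow> tree {k} {}"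
| join: "tree Q1 F1 \<Longrightarrow> tree Q2 F2 \<Longrightarrow> Q1 \<inter> Q2 = {} \<Longrightarrow> {u, v} \<in> E \<Longrightarrow> K u \<in> Q1 \<Longrightarrow> K v \<in> Q2 \<Longrightarrow>
    tree (Q1 \<union> Q2) (insert {u, v} (F1 \<union> F2))"

lemma tree_basics: "tree Q F \<Longrightarrow> Q \<subseteq> R \<and> F \<subseteq> E \<and> finite F \<and> (\<forall>f\<in>F. K ` f \<subseteq> Q)"
proof (induction rule: tree.induct)
  case (join Q1 F1 Q2 F2 u v)
  have "\<forall>f\<in>insert {u, v} (F1 \<union> F2). K ` f \<subseteq> Q1 \<union> Q2"
    using join by blast
  then show ?case using join by simp
qed simp

lemma Union_edges: "F \<subseteq> E \<Longrightarrow> \<Union>F \<subseteq> {..<n}"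
proof (rule Union_least)
  fix f assume "F \<subseteq> E" "f \<in> F"
  then obtain u v where "f = {u, v}" "u < n" "v < n" using E_doubleton[of f] by blast
  then show "f \<subseteq> {..<n}" by simp
qed

lemma tree_finite_Union: "tree Q F \<Longrightarrow> finite (\<Union>F)"
  using tree_basics Union_edges finite_subset[OF _ finite_lessThan] by metis

text \<open>Everything follows from the images under \<open>K\<close>: a vertex on an edge of
  \<open>F1\<close> lies over \<open>Q1\<close>, one on an edge of \<open>F2\<close> over
  \<open>Q2\<close>.\<close>

lemma join_disjoint:
  assumes "tree Q1 F1" "tree Q2 F2" "Q1 \<inter> Q2 = {}" "K u \<in> Q1" "K v \<in> Q2"
  shows "F1 \<inter> F2 = {}" "{u, v} \<notin> F1 \<union> F2" "\<Union>F1 \<inter> \<Union>F2 = {}" "v \<notin> \<Union>F1" "u \<notin> \<Union>F2"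
    "card (insert {u, v} (F1 \<union> F2)) = card F1 + card F2 + 1"
proof -
  note b1 = tree_basics[OF assms(1)] and b2 = tree_basics[OF assms(2)]
  have K1: "K x \<in> Q1" if "x \<in> \<Union>F1" for x
    using that b1 by (meson UnionE image_subset_iff)
  have K2: "K x \<in> Q2" if "x \<in> \<Union>F2" for x
    using that b2 by (meson UnionE image_subset_iff)
  show un: "\<Union>F1 \<inter> \<Union>F2 = {}" "v \<notin> \<Union>F1" "u \<notin> \<Union>F2"
    using K1 K2 assms(3-5) by (meson disjoint_iff)+
  show dj: "F1 \<inter> F2 = {}"
  proof (rule ccontr)
    assume "F1 \<inter> F2 \<noteq> {}"
    then obtain f where f: "f \<in> F1" "f \<in> F2" by blast
    then obtain x where "x \<in> f" using E_doubleton b1 by blast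
    then show False using f un(1) by blast
  qed
  show ni: "{u, v} \<notin> F1 \<union> F2" using un by blast
  show "card (insert {u, v} (F1 \<union> F2)) = card F1 + card F2 + 1"
    using ni dj b1 b2 by (simp add: card_Un_disjoint)
qed

lemma tree_card: "tree Q F \<Longrightarrow> card F + 1 = card Q"
proof (induction rule: tree.induct)
  case (join Q1 F1 Q2 F2 u v)
  have "finite Q1" "finite Q2" using join(1,2) tree_basics finite_R by (meson finite_subset)+
  then have "card (Q1 \<union> Q2) = card Q1 + card Q2" using join(3) by (simp add: card_Un_disjoint)
  then show ?case using join_disjoint(6)[OF join(1-3,5,6)] join.IH by linarith
qed simp

text \<open>Deleting an inner edge of one part leaves two pieces; the outer edge
  \<open>{a, b}\<close> is reattached to the piece that contains its end.\<close>

lemma tree_split: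
  "tree Q F \<Longrightarrow> {u, v} \<in> F \<Longrightarrow> \<exists>Q1 F1 Q2 F2. tree Q1 F1 \<and> tree Q2 F2 \<and> Q1 \<inter> Q2 = {} \<and>
     K u \<in> Q1 \<and> K v \<in> Q2 \<and> Q = Q1 \<union> Q2 \<and> F = insert {u, v} (F1 \<union> F2)"
proof (induction rule: tree.induct)
  case (single k)
  then show ?case by simp
next
  case (join Q1 F1 Q2 F2 a b)
  consider "u = a" "v = b" | "u = b" "v = a" | "{u, v} \<in> F1" | "{u, v} \<in> F2"
    using join.prems by (auto simp: doubleton_eq_iff)
  then show ?case
  proof cases
    case 1
    then show ?thesis using join.hyps by blast
  next
    case 2
    have "Q2 \<inter> Q1 = {}" using join.hyps(3) by blast
    moreover have "Q1 \<union> Q2 = Q2 \<union> Q1" "insert {a, b} (F1 \<union> F2) = insert {b, a} (F2 \<union> F1)"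
      by (auto simp: insert_commute)
    ultimately show ?thesis using 2 join.hyps by metis
  next
    case 3
    obtain P1 G1 P2 G2 where P: "tree P1 G1" "tree P2 G2" "P1 \<inter> P2 = {}" "K u \<in> P1" "K v \<in> P2"
      "Q1 = P1 \<union> P2" "F1 = insert {u, v} (G1 \<union> G2)"
      using join.IH(1)[OF 3] by blast
    show ?thesis
    proof (cases "K a \<in> P1")
      case True
      have "tree (P1 \<union> Q2) (insert {a, b} (G1 \<union> F2))"
        by (rule tree.join[OF P(1) join.hyps(2) _ join.hyps(4) True join.hyps(6)]) (use P(6) join.hyps(3) in blast)+
      moreover have "(P1 \<union> Q2) \<inter> (P2) = {}" "K u \<in> P1 \<union> Q2" "K v \<in> P2"
        "Q1 \<union> Q2 = (P1 \<union> Q2) \<union> (P2)"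
        using P(3-6) join.hyps(3) by blast+
      moreover have "insert {a, b} (F1 \<union> F2) = insert {u, v} ((insert {a, b} (G1 \<union> F2)) \<union> (G2))"
        unfolding P(7) by blast
      ultimately show ?thesis
        using P(1,2) by (intro exI[of _ "P1 \<union> Q2"] exI[of _ "insert {a, b} (G1 \<union> F2)"] exI[of _ "P2"] exI[of _ "G2"] conjI) assumption+
    next
      case False
      then have Ka: "K a \<in> P2" using P(6) join.hyps(5) by blast
      have "tree (P2 \<union> Q2) (insert {a, b} (G2 \<union> F2))"
        by (rule tree.join[OF P(2) join.hyps(2) _ join.hyps(4) Ka join.hyps(6)]) (use P(6) join.hyps(3) in blast)+
      moreover have "(P1) \<inter> (P2 \<union> Q2) = {}" "K u \<in> P1" "K v \<in> P2 \<union> Q2"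
        "Q1 \<union> Q2 = (P1) \<union> (P2 \<union> Q2)"
        using P(3-6) join.hyps(3) by blast+
      moreover have "insert {a, b} (F1 \<union> F2) = insert {u, v} ((G1) \<union> (insert {a, b} (G2 \<union> F2)))"
        unfolding P(7) by blast
      ultimately show ?thesis
        using P(1,2) by (intro exI[of _ "P1"] exI[of _ "G1"] exI[of _ "P2 \<union> Q2"] exI[of _ "insert {a, b} (G2 \<union> F2)"] conjI) assumption+
    qed
  next
    case 4
    obtain P1 G1 P2 G2 where P: "tree P1 G1" "tree P2 G2" "P1 \<inter> P2 = {}" "K u \<in> P1" "K v \<in> P2"
      "Q2 = P1 \<union> P2" "F2 = insert {u, v} (G1 \<union> G2)"
      using join.IH(2)[OF 4] by blast
    show ?thesis
    proof (cases "K b \<in> P1")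
      case True
      have "tree (Q1 \<union> P1) (insert {a, b} (F1 \<union> G1))"
        by (rule tree.join[OF join.hyps(1) P(1) _ join.hyps(4,5) True]) (use P(6) join.hyps(3) in blast)+
      moreover have "(Q1 \<union> P1) \<inter> (P2) = {}" "K u \<in> Q1 \<union> P1" "K v \<in> P2"
        "Q1 \<union> Q2 = (Q1 \<union> P1) \<union> (P2)"
        using P(3-6) join.hyps(3) by blast+
      moreover have "insert {a, b} (F1 \<union> F2) = insert {u, v} ((insert {a, b} (F1 \<union> G1)) \<union> (G2))"
        unfolding P(7) by blast
      ultimately show ?thesis
        using P(1,2) by (intro exI[of _ "Q1 \<union> P1"] exI[of _ "insert {a, b} (F1 \<union> G1)"] exI[of _ "P2"] exI[of _ "G2"] conjI) assumption+
    next
      case False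
      then have Kb: "K b \<in> P2" using P(6) join.hyps(6) by blast
      have "tree (Q1 \<union> P2) (insert {a, b} (F1 \<union> G2))"
        by (rule tree.join[OF join.hyps(1) P(2) _ join.hyps(4,5) Kb]) (use P(6) join.hyps(3) in blast)+
      moreover have "(P1) \<inter> (Q1 \<union> P2) = {}" "K u \<in> P1" "K v \<in> Q1 \<union> P2"
        "Q1 \<union> Q2 = (P1) \<union> (Q1 \<union> P2)"
        using P(3-6) join.hyps(3) by blast+
      moreover have "insert {a, b} (F1 \<union> F2) = insert {u, v} ((G1) \<union> (insert {a, b} (F1 \<union> G2)))"
        unfolding P(7) by blast
      ultimately show ?thesis
        using P(1,2) by (intro exI[of _ "P1"] exI[of _ "G1"] exI[of _ "Q1 \<union> P2"] exI[of _ "insert {a, b} (F1 \<union> G2)"] conjI) assumption+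
    qed
  qed
qed

text \<open>A part without inner edges is a single component, and that one is met by the joining
  edge.\<close>

lemma tree_incident: "tree Q F \<Longrightarrow> F \<noteq> {} \<Longrightarrow> k \<in> Q \<Longrightarrow> \<exists>u v. {u, v} \<in> F \<and> K u = k"
proof (induction rule: tree.induct)
  case (join Q1 F1 Q2 F2 u v)
  have singleton: "x = y" if "tree P {}" "x \<in> P" "y \<in> P" for P x y
    using tree_card[OF that(1)] that(2,3) by (metis One_nat_def add_0 card.empty card_1_singletonE singletonD)
  show ?case
  proof (cases "k \<in> Q1")
    case True
    then show ?thesis using join singleton[of Q1 k "K u"] by (cases "F1 = {}") blast+
  next
    case False
    then have "k \<in> Q2" using join.prems by blast
    moreover have "{v, u} \<in> insert {u, v} (F1 \<union> F2)" by (simp add: insert_commute)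
    ultimately show ?thesis using join singleton[of Q2 k "K v"] by (cases "F2 = {}") blast+
  qed
qed simp

text \<open>Grows a tree one component at a time: a path in \<open>F\<close> from a covered to an
  uncovered component contains an edge that leaves the covered ones.\<close>

lemma tree_exists:
  assumes "solution {..<n} E F"
  shows "\<exists>F'\<subseteq>F. tree R F'"
proof -
  have FE: "F \<subseteq> E" using assms by (simp add: solution_def)
  have conn: "(x, y) \<in> (adj_rel F)\<^sup>*" if "x < n" "y < n" for x y
    using assms that unfolding solution_def connected_graph_def reachable_def adj_rel_def by blast
  have "\<exists>Q F'. tree Q F' \<and> F' \<subseteq> F \<and> card Q = Suc j" if "j < c" for j
    using that
  proof (induction j)
    case 0
    have "tree {K 0} {}" using K_in_R[OF n_pos] by (rule tree.single)
    then show ?case by force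
  next
    case (Suc j)
    then obtain Q F' where Q: "tree Q F'" "F' \<subseteq> F" "card Q = Suc j" by auto
    have QR: "Q \<subseteq> R" using tree_basics[OF Q(1)] by blast
    then have "Q \<subset> R" using Suc.prems Q(3) by (auto simp: c_def)
    then obtain y where y: "y \<in> R" "y \<notin> Q" by blast
    obtain x where x: "x \<in> Q" using Q(3) by fastforce
    have xy: "x < n" "y < n" "K x = x" "K y = y" using x y QR by (auto simp: R_def)
    have "\<exists>a b. (a, b) \<in> adj_rel F \<and> K a \<in> Q \<and> \<not> K b \<in> Q"
      using rtrancl_crossing[where P = "\<lambda>z. K z \<in> Q", OF conn[OF xy(1,2)]] x y(2) xy(3,4) by simp
    then obtain a b where ab: "{a, b} \<in> F" "K a \<in> Q" "K b \<notin> Q"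
      by (auto simp: adj_rel_def)
    have "tree {K b} {}" using E_cases[of a b] ab(1) FE K_in_R by (intro tree.single) blast
    then have "tree (Q \<union> {K b}) (insert {a, b} (F' \<union> {}))"
      using tree.join[OF Q(1), of "{K b}" "{}" a b] ab FE by blast
    moreover have "card (Q \<union> {K b}) = Suc (Suc j)"
      using ab(3) Q(3) by (simp add: card_ge_0_finite)
    ultimately show ?case using ab(1) Q(2) by blast
  qed
  from this[of "c - 1"] obtain Q F' where Q: "tree Q F'" "F' \<subseteq> F" "card Q = c"
    using c_pos by auto
  have "Q = R"
    using tree_basics[OF Q(1)] Q(3) by (intro card_subset_eq) (auto simp: c_def)
  then show ?thesis using Q by blast
qed

text \<open>After \<open>t\<close> rounds, the table entry for slot \<open>i\<close> and component code \<open>s\<close> is at most \<open>d\<close>.\<close>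

inductive bounded :: "nat \<Rightarrow> nat \<Rightarrow> nat \<Rightarrow> nat \<Rightarrow> bool" where
  base: "i < n * n \<Longrightarrow> bounded 0 i (code (K (i div n))) (slot_weight i)"
| keep: "bounded t i s d \<Longrightarrow> bounded (Suc t) i s d"
| jump: "bounded t j s d \<Longrightarrow> i < n * n \<Longrightarrow> K (i div n) = K (j div n) \<Longrightarrow>
    bounded (Suc t) i s (d + slot_weight i)"
| merge: "bounded t i s1 d1 \<Longrightarrow> bounded t j s2 d2 \<Longrightarrow> compatible i j \<Longrightarrow>
    bounded (Suc t) i (s1 + s2) (d1 + d2)"

lemma bounded_slot: "bounded t i s d \<Longrightarrow> i < n * n"
  by (induction rule: bounded.induct) auto

lemma bounded_mono: "bounded t i s d \<Longrightarrow> t \<le> t' \<Longrightarrow> bounded t' i s d"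
  by (induction t') (auto simp: le_Suc_eq intro: bounded.keep)

text \<open>A power is 0 or attained at an edge, which names the slot. For power 0 the slot
  \<open>n * u + u\<close> serves, as there are no loops.\<close>

lemma exists_slots:
  assumes "F \<subseteq> E"
  shows "\<exists>\<tau>. \<forall>u<n. \<tau> u < n * n \<and> \<tau> u div n = u \<and> slot_power (\<tau> u) = vertex_power w F u"
proof -
  have "\<exists>i<n * n. i div n = u \<and> slot_power i = vertex_power w F u" if u: "u < n" for u
    using vertex_power_attained[OF assms, of u]
  proof
    assume "vertex_power w F u = 0"
    moreover have "{u, u} \<notin> E" using E_cases by blast
    ultimately show ?thesis
      using u slot_less[OF u u] by (intro exI[of _ "n * u + u"]) (simp add: slot_power_def)
  next
    assume "\<exists>v. {u, v} \<in> F \<and> vertex_power w F u = w {u, v}"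
    then obtain v where v: "{u, v} \<in> F" "vertex_power w F u = w {u, v}" by blast
    then have "{u, v} \<in> E" "v < n" using assms E_cases by blast+
    then show ?thesis
      using v slot_less[OF u] by (intro exI[of _ "n * u + v"]) (simp add: slot_power_def)
  qed
  then show ?thesis by metis
qed

text \<open>At an endpoint \<open>u\<close> of a tree edge, split the tree there and merge the two
  halves, rooted at the two ends. At any other vertex of the component, do this at an endpoint and
  then jump. Every vertex keeps its one slot given by \<open>\<tau>\<close> and the halves share no
  vertex, so no weight is paid twice.\<close>

lemma tree_bounded:
  assumes F0: "F0 \<subseteq> E"
    and \<tau>: "\<And>u. u < n \<Longrightarrow> \<tau> u < n * n \<and> \<tau> u div n = u \<and> slot_power (\<tau> u) = vertex_power w F0 u"
  shows "tree Q F \<Longrightarrow> F \<subseteq> F0 \<Longrightarrow> u < n \<Longrightarrow> K u \<in> Q \<Longrightarrow>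
    bounded (2 * card F + (if u \<in> \<Union>F \<or> F = {} then 0 else 1)) (\<tau> u) (\<Sum>k\<in>Q. code k)
      (\<Sum>x\<in>insert u (\<Union>F). slot_weight (\<tau> x))"
proof (induction "card F" arbitrary: Q F u rule: less_induct)
  case less
  have at_edge: "bounded (2 * card F) (\<tau> u) (\<Sum>k\<in>Q. code k) (\<Sum>x\<in>\<Union>F. slot_weight (\<tau> x))"
    if uF: "u \<in> \<Union>F" and u: "u < n" for u
  proof -
    have FE: "F \<subseteq> E" using tree_basics[OF less.prems(1)] by blast
    obtain f where f: "f \<in> F" "u \<in> f" using uF by blast
    then obtain v where v: "f = {u, v}" using FE E_doubleton by blast
    then have vE: "{u, v} \<in> E" "v < n" using f FE E_cases by blast+
    obtain Q1 F1 Q2 F2 where S: "tree Q1 F1" "tree Q2 F2" "Q1 \<inter> Q2 = {}" "K u \<in> Q1" "K v \<in> Q2"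
      "Q = Q1 \<union> Q2" "F = insert {u, v} (F1 \<union> F2)"
      using tree_split[OF less.prems(1)] f v by blast
    note dj = join_disjoint[OF S(1-5)]
    note b1 = tree_basics[OF S(1)] and b2 = tree_basics[OF S(2)]
    have card: "card F = card F1 + card F2 + 1" using dj(6) S(7) by simp
    have lt1: "card F1 < card F" and lt2: "card F2 < card F" using card by simp_all
    have sub1: "F1 \<subseteq> F0" and sub2: "F2 \<subseteq> F0" using S(7) less.prems(2) by simp_all
    have IH1: "bounded (2 * card F1 + 1) (\<tau> u) (\<Sum>k\<in>Q1. code k) (\<Sum>x\<in>insert u (\<Union>F1). slot_weight (\<tau> x))"
      by (rule bounded_mono[OF less.hyps[OF lt1 S(1) sub1 u S(4)]]) simp
    have IH2: "bounded (2 * card F2 + 1) (\<tau> v) (\<Sum>k\<in>Q2. code k) (\<Sum>x\<in>insert v (\<Union>F2). slot_weight (\<tau> x))"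
      by (rule bounded_mono[OF less.hyps[OF lt2 S(2) sub2 vE(2) S(5)]]) simp
    have "{u, v} \<in> F0" using f v less.prems(2) by blast
    then have "w {u, v} \<le> vertex_power w F0 u" "w {u, v} \<le> vertex_power w F0 v"
      using vertex_power_ge[OF F0, of u v] vertex_power_ge[OF F0, of v u]
      by (auto simp: insert_commute)
    then have comp: "compatible (\<tau> u) (\<tau> v)"
      unfolding compatible_def using \<tau>[OF u] \<tau>[OF vE(2)] vE(1) S(3-5) by auto
    \<comment> \<open>Each half may end with a jump before the merge, hence 2 rounds per
      edge.\<close>
    have m1: "2 * card F1 + 1 \<le> 2 * card F - 1" "2 * card F2 + 1 \<le> 2 * card F - 1"
      "2 * card F = Suc (2 * card F - 1)"
      using card by auto
    have "u \<noteq> v" using S(3-5) by blast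
    then have disj: "insert u (\<Union>F1) \<inter> insert v (\<Union>F2) = {}" using dj by auto
    have un: "\<Union>F = insert u (\<Union>F1) \<union> insert v (\<Union>F2)" using S(7) by auto
    have "finite Q1" "finite Q2" using b1 b2 finite_R by (meson finite_subset)+
    then have codes: "(\<Sum>k\<in>Q. code k) = (\<Sum>k\<in>Q1. code k) + (\<Sum>k\<in>Q2. code k)"
      unfolding S(6) using S(3) by (simp add: sum.union_disjoint)
    have weights: "(\<Sum>x\<in>\<Union>F. slot_weight (\<tau> x)) =
        (\<Sum>x\<in>insert u (\<Union>F1). slot_weight (\<tau> x)) + (\<Sum>x\<in>insert v (\<Union>F2). slot_weight (\<tau> x))"
      unfolding un using tree_finite_Union[OF S(1)] tree_finite_Union[OF S(2)] disj by (intro sum.union_disjoint) auto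
    show ?thesis
      unfolding codes weights
      by (subst m1(3)) (intro bounded.merge[OF _ _ comp] bounded_mono[OF IH1] bounded_mono[OF IH2] m1)
  qed
  show ?case
  proof (cases "F = {}")
    case True
    then obtain k where "Q = {k}"
      using tree_card[OF less.prems(1)] by (metis One_nat_def add_0 card.empty card_1_singletonE)
    then have "Q = {K u}" using less.prems(4) by auto
    then show ?thesis
      using True bounded.base[of "\<tau> u"] \<tau>[OF less.prems(3)] by simp
  next
    case False
    show ?thesis
    proof (cases "u \<in> \<Union>F")
      case True
      then show ?thesis using at_edge[OF True less.prems(3)] by (simp add: insert_absorb)
    next
      case nu: False
      obtain u' v where u': "{u', v} \<in> F" "K u' = K u"
        using tree_incident[OF less.prems(1) False less.prems(4)] by blast
      have "u' < n" using u'(1) tree_basics[OF less.prems(1)] E_cases by blast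
      moreover have "u' \<in> \<Union>F" using u'(1) by blast
      ultimately have "bounded (2 * card F) (\<tau> u') (\<Sum>k\<in>Q. code k) (\<Sum>x\<in>\<Union>F. slot_weight (\<tau> x))"
        by (intro at_edge)
      then have *: "bounded (Suc (2 * card F)) (\<tau> u) (\<Sum>k\<in>Q. code k)
          ((\<Sum>x\<in>\<Union>F. slot_weight (\<tau> x)) + slot_weight (\<tau> u))"
        using \<tau>[OF less.prems(3)] \<tau>[OF \<open>u' < n\<close>] u'(2) by (intro bounded.jump) auto
      have "finite (\<Union>F)" using tree_finite_Union[OF less.prems(1)] .
      then show ?thesis using * nu False by (simp add: add.commute)
    qed
  qed
qed

text \<open>A spanning tree inside the solution suffices, since dropping edges does not raise
  powers.\<close>

lemma solution_bounded:
  assumes sol: "solution {..<n} E F"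
  shows "\<exists>i d. bounded (2 * c) i target d \<and> (\<Sum>x<n. l x) + d \<le> cost {..<n} w F"
proof -
  have FE: "F \<subseteq> E" using sol by (simp add: solution_def)
  obtain F0 where F0: "F0 \<subseteq> F" "tree R F0" using tree_exists[OF sol] by blast
  have F0E: "F0 \<subseteq> E" using F0 FE by blast
  obtain \<tau> where \<tau>: "\<forall>u<n. \<tau> u < n * n \<and> \<tau> u div n = u \<and> slot_power (\<tau> u) = vertex_power w F0 u"
    using exists_slots[OF F0E] by blast
  \<comment> \<open>Vertex 0 is an arbitrary root; it may lie off the tree and then costs a final
    jump.\<close>
  let ?d = "\<Sum>x\<in>insert 0 (\<Union>F0). slot_weight (\<tau> x)"
  have "bounded (2 * card F0 + (if 0 \<in> \<Union>F0 \<or> F0 = {} then 0 else 1)) (\<tau> 0) target ?d"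
    unfolding target_def using tree_bounded[OF F0E _ F0(2) order.refl n_pos K_in_R[OF n_pos]] \<tau> by blast
  moreover have "card F0 + 1 = c" using tree_card[OF F0(2)] by (simp add: c_def)
  ultimately have b: "bounded (2 * c) (\<tau> 0) target ?d" by (elim bounded_mono) auto
  have sub: "insert 0 (\<Union>F0) \<subseteq> {..<n}"
    using Union_edges[OF F0E] n_pos by simp
  have "?d \<le> (\<Sum>x<n. slot_weight (\<tau> x))" using sub by (intro sum_mono2) auto
  also have "\<dots> \<le> (\<Sum>x<n. vertex_power w F x - l x)"
    using \<tau> vertex_power_mono[OF F0(1) FE] by (intro sum_mono) (auto simp: slot_weight_def diff_le_mono)
  finally have d: "?d \<le> (\<Sum>x<n. vertex_power w F x - l x)" .
  \<comment> \<open>Here \<open>l\<close> must be a true lower bound: then the subtraction does not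
    truncate.\<close>
  have lb: "l x \<le> vertex_power w F x" if "x < n" for x
    using input sol that by (auto simp: minpsc_input_def vertex_lower_bounds_def)
  have "cost {..<n} w F = (\<Sum>x<n. l x + (vertex_power w F x - l x))"
    unfolding cost_def using lb by (intro sum.cong) auto
  then have "(\<Sum>x<n. l x) + ?d \<le> cost {..<n} w F" using d by (simp add: sum.distrib)
  then show ?thesis using b by blast
qed

end

section \<open>The program\<close>

text \<open>Arrays 7 to 14 hold the component representative of each vertex, the code of each
  representative (multiplied by the number \<open>n * n\<close> of slots), the multiples of \<open>n\<close>, the vertex and
  the power of each slot, the adjacency matrix with entry \<open>2 ^ e\<close> for edge \<open>e\<close>, and the table: cell
  \<open>n * n * s + i\<close> of array 13 is \<open>0\<close> for the value infinity and the successor of the value otherwise,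
  and the corresponding cell of array 14 is the sum of \<open>2 ^ e\<close> over the edges \<open>e\<close> used.  The arrays
  from 20 on are scalar variables: 25 is the number \<open>2 * c\<close> of rounds, 27 the number of slots, 28 the
  offset in the table of the code of all components, and 29 its successor.\<close>

abbreviation "num_vertices \<equiv> Read 0 (Const 0)"
abbreviation "num_edges \<equiv> Read 0 (Const 1)"

text \<open>The condition is nonzero iff the weight exceeds one of the two lower bounds. Obligatory
  edges are marked in the output array at once, and the label of the second endpoint is replaced
  everywhere by that of the first.\<close>

definition label_step :: com where
  "label_step =
     Cond (Plus (Minus (Read 4 (Var 20)) (Read 1 (Read 2 (Var 20))))
                (Minus (Read 4 (Var 20)) (Read 1 (Read 3 (Var 20)))))
       Skip
       (Seq (Write 6 (Var 20) (Const 1))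
       (Seq (Assign 22 (Read 7 (Read 2 (Var 20))))
       (Seq (Assign 23 (Read 7 (Read 3 (Var 20))))
            (For 21 (Const 1) num_vertices
              (Cond (Neq (Read 7 (Var 21)) (Var 23)) Skip (Write 7 (Var 21) (Var 22)))))))"

definition label_prog :: com where
  "label_prog =
     Seq (For 20 (Const 1) num_vertices (Write 7 (Var 20) (Var 20)))
         (For 20 (Const 1) num_edges label_step)"

text \<open>A counter that is never reset yields multiples of \<open>n\<close>, quotients by
  \<open>n\<close> and finally \<open>n * n\<close>, without multiplication or division.\<close>

definition slot_prog :: com where
  "slot_prog =
     Seq (Assign 27 (Const 0))
         (For 20 (Const 1) num_vertices
           (Seq (Write 9 (Var 20) (Var 27))
                (For 21 (Const 1) num_vertices
                  (Seq (Write 10 (Var 27) (Var 20)) (Assign 27 (Plus (Var 27) (Const 1)))))))"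

definition matrix_prog :: com where
  "matrix_prog =
     Seq (Assign 24 (Const 1))
         (For 20 (Const 1) num_edges
           (Seq (Assign 21 (Plus (Read 9 (Read 2 (Var 20))) (Read 3 (Var 20))))
           (Seq (Assign 22 (Plus (Read 9 (Read 3 (Var 20))) (Read 2 (Var 20))))
           (Seq (Write 11 (Var 21) (Read 4 (Var 20)))
           (Seq (Write 11 (Var 22) (Read 4 (Var 20)))
           (Seq (Write 12 (Var 21) (Var 24))
           (Seq (Write 12 (Var 22) (Var 24))
                (Assign 24 (Plus (Var 24) (Var 24))))))))))"

definition rank_prog :: com where
  "rank_prog =
     Seq (Assign 24 (Var 27))
         (For 20 (Const 1) num_vertices
           (Cond (Neq (Read 7 (Var 20)) (Var 20)) Skip
             (Seq (Write 8 (Var 20) (Var 24))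
             (Seq (Assign 24 (Plus (Var 24) (Var 24)))
                  (Assign 25 (Plus (Var 25) (Const 2)))))))"

text \<open>A second pass, because the offset \<open>2 ^ c\<close> is known only after all
  components have been counted; \<open>rank_prog\<close> leaves it, scaled, in variable 24.\<close>

definition code_prog :: com where
  "code_prog =
     Seq (For 20 (Const 1) num_vertices
           (Cond (Neq (Read 7 (Var 20)) (Var 20)) Skip
             (Seq (Write 8 (Var 20) (Plus (Read 8 (Var 20)) (Var 24)))
                  (Assign 28 (Plus (Var 28) (Read 8 (Var 20)))))))
         (Assign 29 (Plus (Var 28) (Const 1)))"

definition base_prog :: com where
  "base_prog =
     For 20 (Const 1) (Var 27)
       (Write 13 (Plus (Read 8 (Read 7 (Read 10 (Var 20)))) (Var 20))
         (Plus (Minus (Read 11 (Var 20)) (Read 1 (Read 10 (Var 20)))) (Const 1)))"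

text \<open>The condition is nonzero iff the entry is infinite or exceeds \<open>d\<close>. Writing
  array 14 first is safe as long as \<open>k\<close> and \<open>d\<close> do not read it.\<close>

definition improve :: "aexp \<Rightarrow> aexp \<Rightarrow> aexp \<Rightarrow> com" where
  "improve k d f =
     Cond (Plus (Minus (Const 1) (Read 13 k)) (Minus (Read 13 k) d))
       (Seq (Write 14 k f) (Write 13 k d)) Skip"

text \<open>Variables 31 and 32 are the offsets of two codes, 33 and 34 two slots. A merge adds two
  successors, hence its subtraction of 1. Results beyond \<open>target\<close> are stored too, but
  never serve as sources.\<close>

definition relax :: com where
  "relax =
     (let i = Var 33; j = Var 34; si = Plus (Var 31) i; sj = Plus (Var 32) j;
          ij = Plus (Read 9 (Read 10 i)) (Read 10 j)
      in Cond (Read 13 sj)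
           (Cond (Neq (Read 7 (Read 10 i)) (Read 7 (Read 10 j)))
             (Cond (Read 13 si)
               (Cond (Read 12 ij)
                 (Cond (Plus (Minus (Read 11 ij) (Read 11 i)) (Minus (Read 11 ij) (Read 11 j)))
                   Skip
                   (improve (Plus (Var 32) si)
                     (Minus (Plus (Read 13 si) (Read 13 sj)) (Const 1))
                     (Plus (Plus (Read 14 si) (Read 14 sj)) (Read 12 ij))))
                 Skip)
               Skip)
             (improve (Plus (Var 32) i)
               (Plus (Read 13 sj) (Minus (Read 11 i) (Read 1 (Read 10 i))))
               (Read 14 sj)))
           Skip)"

definition round_prog :: com where
  "round_prog =
     For 31 (Var 27) (Var 29) (For 32 (Var 27) (Var 29)
       (For 33 (Const 1) (Var 27) (For 34 (Const 1) (Var 27) relax)))"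

definition pick_prog :: com where
  "pick_prog =
     For 33 (Const 1) (Var 27)
       (Cond (Read 13 (Plus (Var 28) (Var 33)))
         (Cond (Plus (Minus (Const 1) (Var 38)) (Minus (Var 38) (Read 13 (Plus (Var 28) (Var 33)))))
           (Seq (Assign 38 (Read 13 (Plus (Var 28) (Var 33))))
                (Assign 39 (Read 14 (Plus (Var 28) (Var 33)))))
           Skip)
         Skip)"

text \<open>The machine cannot halve, so bits are read from the highest edge down, each power of two
  being fetched from the adjacency matrix. The condition is nonzero iff variable 22 is at most
  variable 39.\<close>

definition decode_prog :: com where
  "decode_prog =
     For 20 (Const 1) num_edges
       (Seq (Assign 21 (Minus (Minus num_edges (Const 1)) (Var 20)))
       (Seq (Assign 22 (Read 12 (Plus (Read 9 (Read 2 (Var 21))) (Read 3 (Var 21)))))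
            (Cond (Minus (Plus (Var 39) (Const 1)) (Var 22))
              (Seq (Write 6 (Var 21) (Const 1)) (Assign 39 (Minus (Var 39) (Var 22))))
              Skip)))"

definition minpsc_prog :: com where
  "minpsc_prog =
     Seq label_prog (Seq slot_prog (Seq matrix_prog (Seq rank_prog (Seq code_prog (Seq base_prog
     (Seq (For 30 (Const 1) (Var 25) round_prog) (Seq pick_prog decode_prog)))))))"

lemma deterministic_minpsc_prog: "deterministic minpsc_prog"
  by (simp add: minpsc_prog_def label_prog_def label_step_def slot_prog_def matrix_prog_def
      rank_prog_def code_prog_def base_prog_def round_prog_def relax_def improve_def pick_prog_def
      decode_prog_def Let_def)

lemmas so_def = same_outside_def

section \<open>Verification of the preprocessing\<close>

context minpsc
begin

definition inputs :: "memory \<Rightarrow> bool" where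
  "inputs M \<longleftrightarrow> M 0 0 = n \<and> M 0 (Suc 0) = m \<and> (\<forall>v<n. M 1 v = l v) \<and>
     (\<forall>e<m. M 2 e = fst (es ! e) \<and> M 3 e = snd (es ! e) \<and> M 4 e = w (edge e))"

lemma inputs_same: "inputs M \<Longrightarrow> same_outside W M M' \<Longrightarrow> W \<inter> {..4} = {} \<Longrightarrow> inputs M'"
proof -
  assume a: "inputs M" "same_outside W M M'" "W \<inter> {..4} = {}"
  have "M' a = M a" if "a \<le> 4" for a using a(2,3) that by (auto simp: so_def disjoint_iff)
  then show ?thesis using a(1) unfolding inputs_def by simp
qed

text \<open>The assumptions on \<open>K\<close> in \<open>minpsc_comps\<close>, for a growing edge
  set.\<close>

definition labelling :: "nat set set \<Rightarrow> (nat \<Rightarrow> nat) \<Rightarrow> bool" where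
  "labelling F k \<longleftrightarrow> (\<forall>u<n. \<forall>v<n. k u = k v \<longleftrightarrow> (u, v) \<in> (adj_rel F)\<^sup>*) \<and>
     (\<forall>u<n. k u < n \<and> k (k u) = k u)"

lemma labelling_cong: "labelling F k \<Longrightarrow> (\<And>u. u < n \<Longrightarrow> k' u = k u) \<Longrightarrow> labelling F k'"
  unfolding labelling_def by simp

text \<open>The new labels are constant along every edge. Conversely, equal new labels with
  different old ones mean that both vertices are linked to \<open>a\<close>, one of them through the
  new edge.\<close>

lemma labelling_insert:
  assumes k: "labelling F k" and F: "F \<subseteq> E" and ab: "{a, b} \<in> E"
  shows "labelling (insert {a, b} F) (\<lambda>x. if k x = k b then k a else k x)"
proof -
  let ?k = "\<lambda>x. if k x = k b then k a else k x" and ?r = "(adj_rel (insert {a, b} F))\<^sup>*"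
  have ab': "a < n" "b < n" using E_cases[OF ab] by auto
  have sub: "(adj_rel F)\<^sup>* \<subseteq> ?r" by (intro adj_rel_mono) auto
  have kr: "k u = k v \<longleftrightarrow> (u, v) \<in> (adj_rel F)\<^sup>*" if "u < n" "v < n" for u v
    using k that by (auto simp: labelling_def)
  have step: "(a, b) \<in> ?r" by (intro r_into_rtrancl) (simp add: adj_rel_def)
  have sym: "(v, u) \<in> ?r" if "(u, v) \<in> ?r" for u v
    using that sym_rtrancl[OF sym_adj_rel] by (meson symD)
  have "?k u = ?k v \<longleftrightarrow> (u, v) \<in> ?r" if uv: "u < n" "v < n" for u v
  proof
    assume "(u, v) \<in> ?r"
    then show "?k u = ?k v"
    proof (induction rule: rtrancl_induct)
      case (step y z)
      then consider "{y, z} = {a, b}" | "{y, z} \<in> F" by (auto simp: adj_rel_def)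
      then have "?k y = ?k z"
      proof cases
        case 1
        then show ?thesis by (auto simp: doubleton_eq_iff)
      next
        case 2
        then have "y < n" "z < n" "(y, z) \<in> (adj_rel F)\<^sup>*"
          using F E_cases by (auto simp: adj_rel_def)
        then have "k y = k z" using kr by blast
        then show ?thesis by simp
      qed
      then show ?case using step.IH by simp
    qed simp
  next
    assume eq: "?k u = ?k v"
    have link: "(x, a) \<in> ?r" if "x < n" "k x = k b" for x
      using that kr[of x b] ab' sub sym[OF step] by (meson rtrancl_trans subsetD)
    have link': "(x, a) \<in> ?r" if "x < n" "k x = k a" for x
      using that kr[of x a] ab' sub by (meson subsetD)
    show "(u, v) \<in> ?r"
    proof (cases "k u = k v")
      case True
      then show ?thesis using kr[OF uv] sub by blast
    next
      case False
      then have "(u, a) \<in> ?r" "(v, a) \<in> ?r"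
        using eq link link' uv by (auto split: if_splits)
      then show ?thesis using sym by (meson rtrancl_trans)
    qed
  qed
  moreover have "?k u < n \<and> ?k (?k u) = ?k u" if "u < n" for u
  proof -
    have "k u < n" "k a < n" "k (k u) = k u" "k (k a) = k a"
      using k that ab' by (simp_all add: labelling_def)
    then show ?thesis by simp
  qed
  ultimately show ?thesis unfolding labelling_def by blast
qed

definition labelled :: "nat \<Rightarrow> memory \<Rightarrow> bool" where
  "labelled k M \<longleftrightarrow> labelling (edge ` {e. e < k \<and> edge e \<in> Obl}) (M 7) \<and>
     (\<forall>e. M 6 e \<noteq> 0 \<longleftrightarrow> e < k \<and> edge e \<in> Obl)"

lemma edge_Obl_iff:
  "e < m \<Longrightarrow> edge e \<in> Obl \<longleftrightarrow> w (edge e) \<le> l (fst (es ! e)) \<and> w (edge e) \<le> l (snd (es ! e))"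
  using Obl_iff[of "fst (es ! e)" "snd (es ! e)"] by (simp add: E_edge edge_def)

lemma tc_label_step:
  assumes e: "e < m" and M: "inputs M" "M 20 0 = e" "labelled e M"
  shows "tc label_step M (6 * n + 11) (labelled (Suc e))"
proof -
  let ?a = "fst (es ! e)" and ?b = "snd (es ! e)"
  have ab: "?a < n" "?b < n" using nth_edge[OF e] by auto
  have in_e: "M 2 e = ?a" "M 3 e = ?b" "M 4 e = w (edge e)" "M 1 ?a = l ?a" "M 1 ?b = l ?b"
    using M(1) e ab by (auto simp: inputs_def)
  show ?thesis
    unfolding label_step_def
  proof (rule tc_Cond)
    assume "aval (Plus (Minus (Read 4 (Var 20)) (Read 1 (Read 2 (Var 20))))
                (Minus (Read 4 (Var 20)) (Read 1 (Read 3 (Var 20))))) M \<noteq> 0"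
    then have "edge e \<notin> Obl" using edge_Obl_iff[OF e] M(2) in_e by auto
    then have "{e'. e' < Suc e \<and> edge e' \<in> Obl} = {e'. e' < e \<and> edge e' \<in> Obl}"
      by (auto simp: less_Suc_eq)
    then show "tc Skip M (6 * n + 10) (labelled (Suc e))"
      using M(3) by (intro tc_Skip) (auto simp: labelled_def less_Suc_eq \<open>edge e \<notin> Obl\<close>)
  next
    assume "aval (Plus (Minus (Read 4 (Var 20)) (Read 1 (Read 2 (Var 20))))
                (Minus (Read 4 (Var 20)) (Read 1 (Read 3 (Var 20))))) M = 0"
    then have obl: "edge e \<in> Obl" using edge_Obl_iff[OF e] M(2) in_e by auto
    \<comment> \<open>Both labels are saved before the loop, since it overwrites array 7, also at
      the second endpoint.\<close>
    let ?M1 = "set_cell (set_cell (set_cell M 6 e 1) 22 0 (M 7 ?a)) 23 0 (M 7 ?b)"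
    let ?k = "\<lambda>x. if M 7 x = M 7 ?b then M 7 ?a else M 7 x"
    have "tc (For 21 (Const 1) num_vertices
              (Cond (Neq (Read 7 (Var 21)) (Var 23)) Skip (Write 7 (Var 21) (Var 22)))) ?M1
          (6 * n + 3) (labelled (Suc e))"
    proof (rule tc_For[where N = n and d = 1 and B = n and tb = 2 and
          J = "\<lambda>k M'. \<forall>x. M' 7 x = (if x < k then ?k x else M 7 x)"])
      fix k M' assume k: "k < n" "M' 21 0 = k * 1"
        "same_outside (insert 21 (writes (Cond (Neq (Read 7 (Var 21)) (Var 23)) Skip (Write 7 (Var 21) (Var 22))))) ?M1 M'"
        "\<forall>x. M' 7 x = (if x < k then ?k x else M 7 x)"
      then have "M' 22 0 = M 7 ?a" "M' 23 0 = M 7 ?b"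
        by (auto simp: so_def set_cell_def)
      then show "tc (Cond (Neq (Read 7 (Var 21)) (Var 23)) Skip (Write 7 (Var 21) (Var 22))) M' 2
          (\<lambda>M'. \<forall>x. M' 7 x = (if x < Suc k then ?k x else M 7 x))"
        using k(2,4) by (intro tc_straight) (auto simp: set_cell_def less_Suc_eq)
    next
      fix M' assume J: "\<forall>x. M' 7 x = (if x < n then ?k x else M 7 x)"
        and so: "same_outside (insert 21 (writes (Cond (Neq (Read 7 (Var 21)) (Var 23)) Skip (Write 7 (Var 21) (Var 22))))) ?M1 M'"
      have eqs: "{e'. e' < Suc e \<and> edge e' \<in> Obl} = insert e {e'. e' < e \<and> edge e' \<in> Obl}"
        using obl by (auto simp: less_Suc_eq)
      have "labelling (insert {?a, ?b} (edge ` {e'. e' < e \<and> edge e' \<in> Obl})) ?k"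
        using M(3) obl Obl_subset by (intro labelling_insert) (auto simp: labelled_def edge_def)
      then have "labelling (edge ` {e'. e' < Suc e \<and> edge e' \<in> Obl}) (M' 7)"
        unfolding eqs image_insert edge_def[of e] using J by (elim labelling_cong) simp
      moreover have "M' 6 = (M 6)(e := 1)" using so by (simp add: so_def set_cell_def)
      ultimately show "labelled (Suc e) M'"
        using M(3) obl by (auto simp: labelled_def less_Suc_eq)
    qed (use M(1) in \<open>auto simp: so_def set_cell_def inputs_def\<close>)
    then show "tc (Seq (Write 6 (Var 20) (Const 1))
       (Seq (Assign 22 (Read 7 (Read 2 (Var 20))))
       (Seq (Assign 23 (Read 7 (Read 3 (Var 20))))
            (For 21 (Const 1) num_vertices
              (Cond (Neq (Read 7 (Var 21)) (Var 23)) Skip (Write 7 (Var 21) (Var 22))))))) M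
        (6 * n + 10) (labelled (Suc e))"
      using M(2) in_e
      by (intro tc_straight_Seq[where T' = "6 * n + 7"] tc_straight_Seq[where T' = "6 * n + 5"]
          tc_straight_Seq[where T' = "6 * n + 3"]) (auto simp: set_cell_def)
  qed simp
qed

lemma tc_label_prog:
  assumes M: "inputs M" "\<And>e. M 6 e = 0"
  shows "tc label_prog M (5 * n + m * (6 * n + 15) + 7) (labelled m)"
  unfolding label_prog_def
proof (rule tc_Seq)
  show "tc (For 20 (Const 1) num_vertices (Write 7 (Var 20) (Var 20))) M (n * (1 + 4) + 3)
      (\<lambda>M'. labelled 0 M' \<and> inputs M')"
  proof (rule tc_For[where N = n and d = 1 and B = n and tb = 1 and
        J = "\<lambda>k M'. \<forall>x<k. M' 7 x = x"])
    fix M' assume J: "\<forall>x<n. M' 7 x = x"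
      and so: "same_outside (insert 20 (writes (Write 7 (Var 20) (Var 20)))) M M'"
    have "(adj_rel {})\<^sup>* = (Id :: nat rel)" by (simp add: adj_rel_def)
    then have "labelling {} (M' 7)" using J by (simp add: labelling_def)
    moreover have "M' 6 = M 6" using so by (auto simp: so_def)
    moreover have "inputs M'" using M(1) so by (rule inputs_same) auto
    ultimately show "labelled 0 M' \<and> inputs M'"
      using M(2) by (auto simp: labelled_def)
  qed (use M in \<open>auto simp: so_def set_cell_def inputs_def less_Suc_eq intro!: tc_straight\<close>)
next
  fix M1 assume M1: "labelled 0 M1 \<and> inputs M1"
  show "tc (For 20 (Const 1) num_edges label_step) M1 (m * (6 * n + 15) + 3) (labelled m)"
  proof (rule tc_For[where N = m and d = 1 and B = m and tb = "6 * n + 11" and J = labelled])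
    fix k M' assume k: "k < m" "M' 20 0 = k * 1" "same_outside (insert 20 (writes label_step)) M1 M'"
      "labelled k M'"
    have "inputs M'" using conjunct2[OF M1] k(3) by (rule inputs_same) (auto simp: label_step_def)
    then show "tc label_step M' (6 * n + 11) (labelled (Suc k))"
      using k by (intro tc_label_step) auto
  qed (use M1 in \<open>auto simp: so_def set_cell_def inputs_def labelled_def label_step_def\<close>)
qed auto

lemma labelled_Obl: "labelled m M \<Longrightarrow> labelling Obl (M 7)"
proof -
  have "edge ` {e. e < m \<and> edge e \<in> Obl} = Obl" using Obl_subset E_edge by auto
  then show "labelled m M \<Longrightarrow> labelling Obl (M 7)" by (simp add: labelled_def)
qed

section \<open>Slots and the adjacency matrix\<close>

definition slots :: "memory \<Rightarrow> bool" where
  "slots M \<longleftrightarrow> M 27 0 = n * n \<and> (\<forall>u<n. M 9 u = n * u) \<and> (\<forall>i<n * n. M 10 i = i div n)"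

lemma tc_slot_prog:
  assumes M: "inputs M"
  shows "tc slot_prog M (n * (7 * n + 9) + 5) slots"
  unfolding slot_prog_def
proof (rule tc_straight_Seq)
  let ?in = "Seq (Write 10 (Var 27) (Var 20)) (Assign 27 (Plus (Var 27) (Const 1)))"
  let ?out = "Seq (Write 9 (Var 20) (Var 27)) (For 21 (Const 1) num_vertices ?in)"
  let ?M0 = "effect (Assign 27 (Const 0)) M"
  let ?J = "\<lambda>k M'. M' 27 0 = n * k \<and> (\<forall>u<k. M' 9 u = n * u) \<and> (\<forall>i<n * k. M' 10 i = i div n)"
  show "tc (For 20 (Const 1) num_vertices ?out) ?M0 (n * (7 * n + 5 + 4) + 3) slots"
  proof (rule tc_For[where N = n and d = 1 and B = n and tb = "7 * n + 5" and J = ?J])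
    fix k M' assume k: "k < n" "M' 20 0 = k * 1" "same_outside (insert 20 (writes ?out)) ?M0 M'" "?J k M'"
    let ?M1 = "effect (Write 9 (Var 20) (Var 27)) M'"
    have M'0: "M' 0 0 = n" using k(3) M by (auto simp: so_def set_cell_def inputs_def)
    have "tc (For 21 (Const 1) num_vertices ?in) ?M1 (n * (3 + 4) + 3) (?J (Suc k))"
    proof (rule tc_For[where N = n and d = 1 and B = n and tb = 3 and
          J = "\<lambda>j M''. M'' 27 0 = n * k + j \<and> (\<forall>i<n * k + j. M'' 10 i = i div n)"])
      fix j M'' assume j: "j < n" "M'' 21 0 = j * 1" "same_outside (insert 21 (writes ?in)) ?M1 M''"
        "M'' 27 0 = n * k + j \<and> (\<forall>i<n * k + j. M'' 10 i = i div n)"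
      then have "M'' 20 0 = k" using k(2) by (auto simp: so_def set_cell_def)
      then show "tc ?in M'' 3 (\<lambda>M''. M'' 27 0 = n * k + Suc j \<and> (\<forall>i<n * k + Suc j. M'' 10 i = i div n))"
        using j by (intro tc_straight) (auto simp: set_cell_def less_Suc_eq)
    next
      fix M'' assume j: "M'' 27 0 = n * k + n \<and> (\<forall>i<n * k + n. M'' 10 i = i div n)"
        "same_outside (insert 21 (writes ?in)) ?M1 M''"
      then have "M'' 9 = (M' 9)(k := n * k)" using k(2,4) by (auto simp: so_def set_cell_def)
      then show "?J (Suc k) M''" using j(1) k(4) by (auto simp: less_Suc_eq add.commute)
    qed (use k M'0 in \<open>auto simp: so_def set_cell_def\<close>)
    then show "tc ?out M' (7 * n + 5) (?J (Suc k))"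
      by (rule tc_straight_Seq[rotated]) auto
  qed (use M in \<open>auto simp: so_def set_cell_def inputs_def slots_def\<close>)
qed auto

lemma slot_eq_iff: "v < n \<Longrightarrow> n * u + v = i \<longleftrightarrow> u = i div n \<and> v = i mod n"
  by auto

text \<open>The power of two is written as a sum with at most one nonzero term, by
  \<open>inj_edge\<close>; it is 0 for non-edges and extends by one term per edge.\<close>

definition matrix :: "nat \<Rightarrow> memory \<Rightarrow> bool" where
  "matrix k M \<longleftrightarrow> (\<forall>i<n * n.
     M 11 i = (if \<exists>e<k. edge e = {i div n, i mod n} then w {i div n, i mod n} else 0) \<and>
     M 12 i = (\<Sum>e<k. if edge e = {i div n, i mod n} then 2 ^ e else 0))"

lemma matrix_power: "matrix m M \<Longrightarrow> i < n * n \<Longrightarrow> M 11 i = slot_power i"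
  unfolding matrix_def slot_power_def E_edge by (auto simp: image_iff)

lemma matrix_bit:
  assumes "matrix m M" "u < n" "v < n"
  shows "M 12 (n * u + v) \<noteq> 0 \<longleftrightarrow> {u, v} \<in> E"
    and "e < m \<Longrightarrow> edge e = {u, v} \<Longrightarrow> M 12 (n * u + v) = 2 ^ e"
proof -
  have M12: "M 12 (n * u + v) = (\<Sum>e<m. if edge e = {u, v} then 2 ^ e else 0)"
    using assms slot_less[OF assms(2,3)] unfolding matrix_def by simp
  show "M 12 (n * u + v) = 2 ^ e" if "e < m" "edge e = {u, v}" for e
  proof -
    have "(\<Sum>e'<m. if edge e' = {u, v} then 2 ^ e' else 0) = (\<Sum>e'<m. if e' = e then 2 ^ e' else (0::nat))"
      using that inj_edge by (intro sum.cong) (auto dest: inj_onD)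
    then show ?thesis using M12 that by simp
  qed
  show "M 12 (n * u + v) \<noteq> 0 \<longleftrightarrow> {u, v} \<in> E"
    unfolding M12 E_edge by (auto simp: image_iff split: if_splits)
qed

lemma tc_matrix_prog:
  assumes M: "inputs M" "slots M" "\<And>i. M 11 i = 0" "\<And>i. M 12 i = 0"
  shows "tc matrix_prog M (17 * m + 5) (matrix m)"
  unfolding matrix_prog_def
proof (rule tc_straight_Seq)
  let ?M0 = "effect (Assign 24 (Const 1)) M"
  let ?p = "Seq (Assign 21 (Plus (Read 9 (Read 2 (Var 20))) (Read 3 (Var 20))))
           (Seq (Assign 22 (Plus (Read 9 (Read 3 (Var 20))) (Read 2 (Var 20))))
           (Seq (Write 11 (Var 21) (Read 4 (Var 20)))
           (Seq (Write 11 (Var 22) (Read 4 (Var 20)))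
           (Seq (Write 12 (Var 21) (Var 24))
           (Seq (Write 12 (Var 22) (Var 24))
                (Assign 24 (Plus (Var 24) (Var 24))))))))"
  show "tc (For 20 (Const 1) num_edges ?p) ?M0 (m * (13 + 4) + 3) (matrix m)"
  proof (rule tc_For[where N = m and d = 1 and B = m and tb = 13 and
        J = "\<lambda>k M'. M' 24 0 = 2 ^ k \<and> matrix k M'"])
    fix k M' assume k: "k < m" "M' 20 0 = k * 1" "same_outside (insert 20 (writes ?p)) ?M0 M'"
      "M' 24 0 = 2 ^ k \<and> matrix k M'"
    let ?a = "fst (es ! k)" and ?b = "snd (es ! k)"
    have ab: "?a < n" "?b < n" "?a \<noteq> ?b" using nth_edge[OF k(1)] by auto
    have "M' a = M a" if "a \<in> {2,3,4,9}" for a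
      using k(3) that by (auto simp: so_def set_cell_def)
    then have in_k: "M' 2 k = ?a" "M' 3 k = ?b" "M' 4 k = w (edge k)" "M' 9 ?a = n * ?a" "M' 9 ?b = n * ?b"
      using M(1,2) k(1) ab by (auto simp: inputs_def slots_def)
    define M2 where "M2 = effect ?p M'"
    have M'': "M2 24 0 = 2 ^ Suc k"
      "M2 11 = (M' 11)(n * ?a + ?b := w (edge k), n * ?b + ?a := w (edge k))"
      "M2 12 = (M' 12)(n * ?a + ?b := 2 ^ k, n * ?b + ?a := 2 ^ k)"
      using k(2,4) in_k by (simp_all add: set_cell_def M2_def)
    have "matrix (Suc k) (M2)"
      unfolding matrix_def
    proof (intro allI impI)
      fix i assume i: "i < n * n"
      let ?e = "{i div n, i mod n}"
      have mi: "M' 11 i = (if \<exists>e<k. edge e = ?e then w ?e else 0)"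
        "M' 12 i = (\<Sum>e<k. if edge e = ?e then 2 ^ e else 0)"
        using k(4) i by (auto simp: matrix_def)
      have iff: "edge k = ?e \<longleftrightarrow> i = n * ?a + ?b \<or> i = n * ?b + ?a"
        using slot_eq_iff[of ?b ?a i] slot_eq_iff[of ?a ?b i] ab
        unfolding edge_def by (auto simp: doubleton_eq_iff)
      show "M2 11 i = (if \<exists>e<Suc k. edge e = ?e then w ?e else 0) \<and>
        M2 12 i = (\<Sum>e<Suc k. if edge e = ?e then 2 ^ e else 0)"
      proof (cases "edge k = ?e")
        case True
        \<comment> \<open>No earlier edge has these endpoints, so overwriting the cell agrees with
          adding a term.\<close>
        then have "edge e \<noteq> ?e" if "e < k" for e
          using inj_edge that k(1) by (metis inj_onD lessThan_iff less_irrefl less_trans)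
        then have "(\<Sum>e<k. if edge e = ?e then 2 ^ e else (0::nat)) = 0" by simp
        moreover have "M2 11 i = w (edge k)" "M2 12 i = 2 ^ k"
          using True iff unfolding M'' by auto
        ultimately show ?thesis using True by auto
      next
        case False
        then have "M2 11 i = M' 11 i" "M2 12 i = M' 12 i"
          using iff unfolding M'' by auto
        moreover have "(\<exists>e<Suc k. edge e = ?e) = (\<exists>e<k. edge e = ?e)"
          using False by (auto simp: less_Suc_eq)
        ultimately show ?thesis using False mi by simp
      qed
    qed
    then show "tc ?p M' 13 (\<lambda>M'. M' 24 0 = 2 ^ Suc k \<and> matrix (Suc k) M')"
      using M''(1) by (intro tc_straight) (auto simp: M2_def[symmetric] simp del: effect.simps)
  qed (use M in \<open>auto simp: so_def set_cell_def inputs_def matrix_def\<close>)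
qed auto

end

section \<open>Verification of the dynamic program\<close>

text \<open>As in the table, \<open>0\<close> stands for infinity.\<close>

definition better :: "(nat \<Rightarrow> nat) \<Rightarrow> (nat \<Rightarrow> nat) \<Rightarrow> bool" where
  "better D D' \<longleftrightarrow> (\<forall>k. D k \<noteq> 0 \<longrightarrow> D' k \<noteq> 0 \<and> D' k \<le> D k)"

lemma better_refl [simp]: "better D D"
  by (simp add: better_def)

lemma better_trans: "better D1 D2 \<Longrightarrow> better D2 D3 \<Longrightarrow> better D1 D3"
  unfolding better_def by (meson le_trans)

lemma div_mod_of_less: "(i::nat) < a \<Longrightarrow> (a * s + i) div a = s \<and> (a * s + i) mod a = i"
  by auto

context minpsc_comps
begin

abbreviation "N \<equiv> n * n"

lemma N_pos: "0 < N"
  using n_pos by simp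

lemma index_eq [simp]: "i < N \<Longrightarrow> (N * s + i) div N = s" "i < N \<Longrightarrow> (N * s + i) mod N = i"
  using div_mod_of_less[of i N s] by auto

lemma R_less: "{v \<in> R. v < n} = R"
  by (auto simp: R_def)

lemma R_Suc:
  "k < n \<Longrightarrow> {v \<in> R. v < Suc k} = (if K k = k then insert k {v \<in> R. v < k} else {v \<in> R. v < k})"
  by (auto simp: R_def less_Suc_eq)

lemma tc_rank_prog:
  assumes M: "inputs M" "slots M" "M 7 = K" "M 25 0 = 0"
  shows "tc rank_prog M (10 * n + 5)
    (\<lambda>M'. M' 24 0 = N * 2 ^ c \<and> M' 25 0 = 2 * c \<and> (\<forall>v\<in>R. M' 8 v = N * 2 ^ rank v))"
  unfolding rank_prog_def
proof (rule tc_straight_Seq)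
  let ?M0 = "effect (Assign 24 (Var 27)) M"
  let ?p = "Cond (Neq (Read 7 (Var 20)) (Var 20)) Skip
             (Seq (Write 8 (Var 20) (Var 24))
             (Seq (Assign 24 (Plus (Var 24) (Var 24)))
                  (Assign 25 (Plus (Var 25) (Const 2)))))"
  let ?J = "\<lambda>k M'. M' 24 0 = N * 2 ^ card {v \<in> R. v < k} \<and> M' 25 0 = 2 * card {v \<in> R. v < k} \<and>
      (\<forall>v\<in>R. v < k \<longrightarrow> M' 8 v = N * 2 ^ rank v)"
  show "tc (For 20 (Const 1) num_vertices ?p) ?M0 (n * (6 + 4) + 3)
    (\<lambda>M'. M' 24 0 = N * 2 ^ c \<and> M' 25 0 = 2 * c \<and> (\<forall>v\<in>R. M' 8 v = N * 2 ^ rank v))"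
  proof (rule tc_For[where N = n and d = 1 and B = n and tb = 6 and J = ?J])
    fix k M' assume k: "k < n" "M' 20 0 = k * 1" "same_outside (insert 20 (writes ?p)) ?M0 M'" "?J k M'"
    have M': "M' 7 = K" using k(3) M by (simp add: so_def set_cell_def)
    have rank: "card {v \<in> R. v < k} = rank k" by (simp add: rank_def)
    show "tc ?p M' 6 (?J (Suc k))"
    proof (cases "K k = k")
      case True
      have card: "card {v \<in> R. v < Suc k} = Suc (rank k)"
        unfolding R_Suc[OF k(1)] using True by (simp add: rank)
      have "effect ?p M' 24 0 = N * 2 ^ rank k + N * 2 ^ rank k" "effect ?p M' 25 0 = 2 * rank k + 2"
        "effect ?p M' 8 = (M' 8)(k := N * 2 ^ rank k)"
        using k(2,4) M' True by (simp_all add: set_cell_def rank)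
      then have "?J (Suc k) (effect ?p M')"
        using k(4) unfolding card by (simp del: effect.simps add: less_Suc_eq)
      then show ?thesis by (intro tc_straight) simp_all
    next
      case False
      then have "k \<notin> R" by (simp add: R_def)
      then have "v < Suc k \<longleftrightarrow> v < k" if "v \<in> R" for v using that less_Suc_eq by metis
      moreover have "effect ?p M' = M'" using k(2) M' False by simp
      ultimately have "?J (Suc k) (effect ?p M')"
        using k(4) False by (simp del: effect.simps add: R_Suc[OF k(1)])
      then show ?thesis by (intro tc_straight) simp_all
    qed
  next
    fix M' assume "?J n M'"
    then show "M' 24 0 = N * 2 ^ c \<and> M' 25 0 = 2 * c \<and> (\<forall>v\<in>R. M' 8 v = N * 2 ^ rank v)"
      unfolding R_less c_def by (auto simp: R_def)
  qed (use M in \<open>auto simp: so_def set_cell_def inputs_def slots_def\<close>)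
qed auto

lemma tc_code_prog:
  assumes M: "inputs M" "M 7 = K" "M 28 0 = 0" "M 24 0 = N * 2 ^ c" "\<forall>v\<in>R. M 8 v = N * 2 ^ rank v"
  shows "tc code_prog M (8 * n + 5)
    (\<lambda>M'. (\<forall>v\<in>R. M' 8 v = N * code v) \<and> M' 28 0 = N * target \<and> M' 29 0 = N * target + 1)"
  unfolding code_prog_def
proof (rule tc_Seq)
  let ?p = "Cond (Neq (Read 7 (Var 20)) (Var 20)) Skip
             (Seq (Write 8 (Var 20) (Plus (Read 8 (Var 20)) (Var 24)))
                  (Assign 28 (Plus (Var 28) (Read 8 (Var 20)))))"
  \<comment> \<open>Array 8 is in transition: representatives from \<open>k\<close> on still lack
    the offset.\<close>
  let ?J = "\<lambda>k M'. (\<forall>v\<in>R. M' 8 v = N * (if v < k then code v else 2 ^ rank v)) \<and>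
      M' 28 0 = N * (\<Sum>v\<in>{v \<in> R. v < k}. code v)"
  let ?Q = "\<lambda>M'. (\<forall>v\<in>R. M' 8 v = N * code v) \<and> M' 28 0 = N * target"
  show "tc (For 20 (Const 1) num_vertices ?p) M (n * (4 + 4) + 3) ?Q"
  proof (rule tc_For[where N = n and d = 1 and B = n and tb = 4 and J = ?J])
    fix k M' assume k: "k < n" "M' 20 0 = k * 1" "same_outside (insert 20 (writes ?p)) M M'" "?J k M'"
    have M': "M' 7 = K" "M' 24 0 = N * 2 ^ c" using k(3) M by (simp_all add: so_def)
    show "tc ?p M' 4 (?J (Suc k))"
    proof (cases "K k = k")
      case True
      then have kR: "k \<in> R" using k(1) by (simp add: R_def)
      have "M' 8 k + N * 2 ^ c = N * code k"
        using k(4) kR by (simp add: code_def algebra_simps)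
      then have eff: "effect ?p M' 8 = (M' 8)(k := N * code k)"
        "effect ?p M' 28 0 = N * (\<Sum>v\<in>{v \<in> R. v < k}. code v) + N * code k"
        using k(2,4) M' True by (simp_all add: set_cell_def)
      have "(\<Sum>v\<in>{v \<in> R. v < Suc k}. code v) = code k + (\<Sum>v\<in>{v \<in> R. v < k}. code v)"
        unfolding R_Suc[OF k(1)] using True by simp
      then have "?J (Suc k) (effect ?p M')"
        using k(4) eff by (simp del: effect.simps add: less_Suc_eq distrib_left)
      then show ?thesis by (intro tc_straight) simp_all
    next
      case False
      then have "k \<notin> R" by (simp add: R_def)
      then have "v < Suc k \<longleftrightarrow> v < k" if "v \<in> R" for v using that less_Suc_eq by metis
      moreover have "effect ?p M' = M'" using k(2) M' False by simp
      ultimately have "?J (Suc k) (effect ?p M')"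
        using k(4) False by (simp del: effect.simps add: R_Suc[OF k(1)])
      then show ?thesis by (intro tc_straight) simp_all
    qed
  next
    fix M' assume "?J n M'"
    then show "?Q M'" unfolding R_less target_def by (auto simp: R_def)
  qed (use M in \<open>auto simp: so_def set_cell_def inputs_def\<close>)
next
  fix M' :: memory assume "(\<forall>v\<in>R. M' 8 v = N * code v) \<and> M' 28 0 = N * target"
  then show "tc (Assign 29 (Plus (Var 28) (Const 1))) M' 1
    (\<lambda>M'. (\<forall>v\<in>R. M' 8 v = N * code v) \<and> M' 28 0 = N * target \<and> M' 29 0 = N * target + 1)"
    by (intro tc_straight) (auto simp: set_cell_def)
qed auto

section \<open>Invariants of the table and a single update\<close>

definition sound :: "memory \<Rightarrow> bool" where
  "sound M \<longleftrightarrow> (\<forall>k. M 13 k \<noteq> 0 \<longrightarrow> witnessed (k mod N) (k div N) (M 13 k - 1) (M 14 k))"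

text \<open>Only upper bounds are claimed: updates are in place, so a round may already use entries
  improved in the same round.\<close>

definition complete :: "nat \<Rightarrow> memory \<Rightarrow> bool" where
  "complete r M \<longleftrightarrow> (\<forall>i s d. bounded r i s d \<and> s \<le> target \<longrightarrow>
     M 13 (N * s + i) \<noteq> 0 \<and> M 13 (N * s + i) \<le> d + 1)"

lemma tc_base_prog:
  assumes M: "inputs M" "slots M" "matrix m M" "M 7 = K" "\<forall>v\<in>R. M 8 v = N * code v"
    "\<And>k. M 13 k = 0" "\<And>k. M 14 k = 0"
  shows "tc base_prog M (5 * N + 3) (\<lambda>M'. sound M' \<and> complete 0 M')"
  unfolding base_prog_def
proof (rule tc_For[where N = N and d = 1 and B = N and tb = 1])
  let ?p = "Write 13 (Plus (Read 8 (Read 7 (Read 10 (Var 20)))) (Var 20))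
         (Plus (Minus (Read 11 (Var 20)) (Read 1 (Read 10 (Var 20)))) (Const 1))"
  let ?J = "\<lambda>k M'. \<forall>a. M' 13 a =
      (if a mod N < k \<and> a div N = code (K (a mod N div n)) then slot_weight (a mod N) + 1 else 0)"
  {
    fix k M' assume k: "k < N" "M' 20 0 = k * 1" "same_outside (insert 20 (writes ?p)) M M'" "?J k M'"
    have "M' a = M a" if "a \<in> {1,7,8,10,11}" for a using k(3) that by (auto simp: so_def)
    then have *: "M' 10 k = k div n" "M' 7 = K" "M' 8 (K (k div n)) = N * code (K (k div n))"
      "M' 11 k = slot_power k" "M' 1 (k div n) = l (k div n)"
      using M k(1) matrix_power[of M k] K_in_R[OF slot_vertex[OF k(1)]] slot_vertex[OF k(1)]
      by (auto simp: inputs_def slots_def)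
    define a where "a = N * code (K (k div n)) + k"
    \<comment> \<open>Each slot owns one initial cell, so this write affects the description of slot
      \<open>k\<close> only.\<close>
    have a: "b = a \<longleftrightarrow> b mod N = k \<and> b div N = code (K (b mod N div n))" for b
    proof
      assume "b mod N = k \<and> b div N = code (K (b mod N div n))"
      then show "b = a" unfolding a_def by (metis mult_div_mod_eq)
    qed (use k(1) in \<open>simp add: a_def\<close>)
    have "effect ?p M' 13 = (M' 13)(a := slot_weight k + 1)"
      using k(2) * by (simp add: set_cell_def slot_weight_def a_def)
    then have "?J (Suc k) (effect ?p M')"
      using k(4) by (auto simp: a less_Suc_eq)
    then show "tc ?p M' 1 (?J (Suc k))"
      by (intro tc_straight) auto
  next
    fix M' assume J: "?J N M'" and so: "same_outside (insert 20 (writes ?p)) M M'"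
    have "M' 14 k = 0" for k using so M(7) by (simp add: so_def)
    then have "sound M'"
      unfolding sound_def using J N_pos witnessed_base by auto
    moreover have "complete 0 M'"
      unfolding complete_def
    proof (intro allI impI)
      fix i s d assume "bounded 0 i s d \<and> s \<le> target"
      then have "i < N" "s = code (K (i div n))" "d = slot_weight i"
        by (auto elim: bounded.cases)
      then show "M' 13 (N * s + i) \<noteq> 0 \<and> M' 13 (N * s + i) \<le> d + 1"
        using J by simp
    qed
    ultimately show "sound M' \<and> complete 0 M'" by blast
  }
qed (use M in \<open>auto simp: so_def set_cell_def slots_def\<close>)

definition progress :: "memory \<Rightarrow> memory \<Rightarrow> bool" where
  "progress M M' \<longleftrightarrow> better (M 13) (M' 13) \<and> (sound M \<longrightarrow> sound M')"

lemma effect_improve: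
  assumes "aval k M = a" "aval d M = v" "aval f M = g"
    and "\<And>x y. aval k (set_cell M 14 x y) = a" "\<And>x y. aval d (set_cell M 14 x y) = v"
    and "0 < v" "sound M \<Longrightarrow> witnessed (a mod N) (a div N) (v - 1) g"
  shows "progress M (effect (improve k d f) M) \<and> effect (improve k d f) M 13 a \<noteq> 0 \<and>
    effect (improve k d f) M 13 a \<le> v"
proof (cases "M 13 a = 0 \<or> v < M 13 a")
  case True
  define M' where "M' = effect (improve k d f) M"
  have M': "M' 13 = (M 13)(a := v)" "M' 14 = (M 14)(a := g)"
    unfolding M'_def improve_def using True assms(1-5) by (auto simp: set_cell_def)
  have "progress M M'"
    unfolding progress_def better_def sound_def M' using True assms(6,7) by (auto simp: sound_def)
  then show ?thesis using assms(6) M' unfolding M'_def[symmetric] by simp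
next
  case False
  then have "effect (improve k d f) M = M"
    unfolding improve_def using assms(1,2) by auto
  then show ?thesis using False by (simp add: progress_def)
qed

definition ready :: "memory \<Rightarrow> bool" where
  "ready M \<longleftrightarrow> inputs M \<and> slots M \<and> matrix m M \<and> M 7 = K \<and> M 25 0 = 2 * c \<and>
     M 28 0 = N * target \<and> M 29 0 = N * target + 1"

lemma ready_same:
  assumes "ready M" "same_outside W M M'" "W \<inter> ({..4} \<union> {7, 9, 10, 11, 12, 25, 27, 28, 29}) = {}"
  shows "ready M'"
proof -
  have "M' a = M a" if "a \<in> {7, 9, 10, 11, 12, 25, 27, 28, 29}" for a
    using assms(2,3) that unfolding so_def by blast
  moreover have "inputs M'"
    using assms unfolding ready_def by (intro inputs_same[of M W M']) auto
  ultimately show ?thesis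
    using assms(1) unfolding ready_def slots_def matrix_def by simp
qed

text \<open>The guarantee of a single relaxation, stated for the value arrays alone so that
  \<open>covers_mono\<close> can stretch it over a whole round.\<close>

definition covers :: "nat \<Rightarrow> nat \<Rightarrow> nat \<Rightarrow> nat \<Rightarrow> (nat \<Rightarrow> nat) \<Rightarrow> (nat \<Rightarrow> nat) \<Rightarrow> bool" where
  "covers s1 s2 i j D D' \<longleftrightarrow>
     (K (i div n) = K (j div n) \<and> D (N * s2 + j) \<noteq> 0 \<longrightarrow>
        D' (N * s2 + i) \<noteq> 0 \<and> D' (N * s2 + i) \<le> D (N * s2 + j) + slot_weight i) \<and>
     (compatible i j \<and> D (N * s1 + i) \<noteq> 0 \<and> D (N * s2 + j) \<noteq> 0 \<longrightarrow>
        D' (N * (s1 + s2) + i) \<noteq> 0 \<and>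
        D' (N * (s1 + s2) + i) \<le> D (N * s1 + i) + D (N * s2 + j) - 1)"

text \<open>Smaller results and larger sources keep the guarantee, so in-place changes before and
  after the relaxation do no harm.\<close>

lemma covers_mono:
  assumes "covers s1 s2 i j D1 D2" "better D0 D1" "better D2 D3"
  shows "covers s1 s2 i j D0 D3"
proof -
  have D01: "D0 k \<noteq> 0 \<Longrightarrow> D1 k \<noteq> 0 \<and> D1 k \<le> D0 k" for k
    using assms(2) by (simp add: better_def)
  have D23: "D2 k \<noteq> 0 \<Longrightarrow> D3 k \<noteq> 0 \<and> D3 k \<le> D2 k" for k
    using assms(3) by (simp add: better_def)
  note c = assms(1)[unfolded covers_def]
  show ?thesis
    unfolding covers_def
  proof (intro conjI impI; elim conjE)
    assume "K (i div n) = K (j div n)" "D0 (N * s2 + j) \<noteq> 0"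
    then show "D3 (N * s2 + i) \<noteq> 0" "D3 (N * s2 + i) \<le> D0 (N * s2 + j) + slot_weight i"
      using c D01[of "N * s2 + j"] D23[of "N * s2 + i"] by linarith+
  next
    assume "compatible i j" "D0 (N * s1 + i) \<noteq> 0" "D0 (N * s2 + j) \<noteq> 0"
    then show "D3 (N * (s1 + s2) + i) \<noteq> 0"
      "D3 (N * (s1 + s2) + i) \<le> D0 (N * s1 + i) + D0 (N * s2 + j) - 1"
      using c D01[of "N * s1 + i"] D01[of "N * s2 + j"] D23[of "N * (s1 + s2) + i"] by linarith+
  qed
qed

lemma effect_relax:
  assumes M: "ready M" and ij: "i < N" "j < N"
    and vars: "M 31 0 = s1 * N" "M 32 0 = s2 * N" "M 33 0 = i" "M 34 0 = j"
  shows "progress M (effect relax M) \<and> covers s1 s2 i j (M 13) (effect relax M 13)"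
proof -
  let ?u = "i div n" and ?v = "j div n"
  let ?si = "Plus (Var 31) (Var 33)" and ?sj = "Plus (Var 32) (Var 34)"
  let ?ij = "Plus (Read 9 (Read 10 (Var 33))) (Read 10 (Var 34))"
  let ?k = "n * ?u + ?v"
  have uv: "?u < n" "?v < n" using ij slot_vertex by auto
  have k: "?k < N" using slot_less[OF uv] .
  have M': "M 10 i = ?u" "M 10 j = ?v" "M 9 ?u = n * ?u" "M 7 = K" "M 11 i = slot_power i"
    "M 11 j = slot_power j" "M 1 ?u = l ?u" "M 11 ?k = (if {?u, ?v} \<in> E then w {?u, ?v} else 0)"
    using M ij uv k matrix_power[of M] unfolding ready_def inputs_def slots_def
    by (auto simp: slot_power_def)
  have bit: "M 12 ?k \<noteq> 0 \<longleftrightarrow> {?u, ?v} \<in> E" "e < m \<Longrightarrow> edge e = {?u, ?v} \<Longrightarrow> M 12 ?k = 2 ^ e" for e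
    using matrix_bit[OF _ uv] M by (auto simp: ready_def)
  define jump where "jump = improve (Plus (Var 32) (Var 33))
               (Plus (Read 13 ?sj) (Minus (Read 11 (Var 33)) (Read 1 (Read 10 (Var 33)))))
               (Read 14 ?sj)"
  define merge where "merge = improve (Plus (Var 32) ?si)
                     (Minus (Plus (Read 13 ?si) (Read 13 ?sj)) (Const 1))
                     (Plus (Plus (Read 14 ?si) (Read 14 ?sj)) (Read 12 ?ij))"
  have eff: "effect relax M = (if M 13 (N * s2 + j) = 0 then M
      else if K ?u = K ?v then effect jump M
      else if M 13 (N * s1 + i) \<noteq> 0 \<and> compatible i j then effect merge M else M)"
    unfolding relax_def Let_def jump_def[symmetric] merge_def[symmetric]
    using M' vars bit(1) by (auto simp: compatible_def mult.commute)
  have comp: "compatible i j \<Longrightarrow> K ?u \<noteq> K ?v" by (simp add: compatible_def)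
  consider (idle) "effect relax M = M" "M 13 (N * s2 + j) = 0 \<or> K ?u \<noteq> K ?v"
      "M 13 (N * s2 + j) = 0 \<or> M 13 (N * s1 + i) = 0 \<or> \<not> compatible i j"
    | (jump) "effect relax M = effect jump M" "M 13 (N * s2 + j) \<noteq> 0" "K ?u = K ?v"
    | (merge) "effect relax M = effect merge M" "M 13 (N * s2 + j) \<noteq> 0" "M 13 (N * s1 + i) \<noteq> 0"
      "compatible i j"
    unfolding eff using comp
    by (cases "M 13 (N * s2 + j) = 0"; cases "K ?u = K ?v"; cases "M 13 (N * s1 + i) = 0";
        cases "compatible i j") simp_all
  then show ?thesis
  proof cases
    case idle
    then show ?thesis by (auto simp: progress_def covers_def)
  next
    case jump
    let ?d = "M 13 (N * s2 + j) + slot_weight i"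
    have "progress M (effect jump M) \<and> effect jump M 13 (N * s2 + i) \<noteq> 0 \<and>
        effect jump M 13 (N * s2 + i) \<le> ?d"
      unfolding jump_def
    proof (rule effect_improve[where g = "M 14 (N * s2 + j)"])
      assume "sound M"
      then have "witnessed j s2 (M 13 (N * s2 + j) - 1) (M 14 (N * s2 + j))"
        using jump(2) ij(2) unfolding sound_def by (metis index_eq)
      then have "witnessed i s2 (M 13 (N * s2 + j) - 1 + slot_weight i) (M 14 (N * s2 + j))"
        using ij(1) jump(3) by (intro witnessed_jump)
      then show "witnessed ((N * s2 + i) mod N) ((N * s2 + i) div N) (?d - 1) (M 14 (N * s2 + j))"
        using ij(1) jump(2) by simp
    qed (use jump(2) M' vars in \<open>auto simp: set_cell_def slot_weight_def mult.commute\<close>)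
    then show ?thesis
      unfolding jump(1) covers_def using jump(3) by (auto simp: compatible_def)
  next
    case merge
    let ?d = "M 13 (N * s1 + i) + M 13 (N * s2 + j) - 1"
    have "{?u, ?v} \<in> E" using merge(4) by (simp add: compatible_def)
    then obtain e where e: "e < m" "edge e = {?u, ?v}" unfolding E_edge by auto
    have "progress M (effect merge M) \<and> effect merge M 13 (N * (s1 + s2) + i) \<noteq> 0 \<and>
        effect merge M 13 (N * (s1 + s2) + i) \<le> ?d"
      unfolding merge_def
    proof (rule effect_improve[where g = "M 14 (N * s1 + i) + M 14 (N * s2 + j) + 2 ^ e"])
      assume s: "sound M"
      have "witnessed i s1 (M 13 (N * s1 + i) - 1) (M 14 (N * s1 + i))"
        "witnessed j s2 (M 13 (N * s2 + j) - 1) (M 14 (N * s2 + j))"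
        using s merge(2,3) ij unfolding sound_def by (metis index_eq)+
      then have "witnessed i (s1 + s2) (M 13 (N * s1 + i) - 1 + (M 13 (N * s2 + j) - 1))
          (M 14 (N * s1 + i) + M 14 (N * s2 + j) + 2 ^ e)"
        using ij merge(4) e by (rule witnessed_merge)
      moreover have "M 13 (N * s1 + i) - 1 + (M 13 (N * s2 + j) - 1) = ?d - 1"
        using merge(2,3) by simp
      ultimately show "witnessed ((N * (s1 + s2) + i) mod N) ((N * (s1 + s2) + i) div N) (?d - 1)
          (M 14 (N * s1 + i) + M 14 (N * s2 + j) + 2 ^ e)"
        using index_eq[OF ij(1)] by metis
    qed (use merge(2,3) M' vars bit(2)[OF e] in \<open>auto simp: set_cell_def algebra_simps\<close>)
    then show ?thesis
      unfolding merge(1) covers_def using merge(4) by (auto simp: compatible_def)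
  qed
qed

section \<open>Updates accumulated over nested loops\<close>

lemma progress_refl: "progress M M"
  by (simp add: progress_def)

lemma progress_trans: "progress M1 M2 \<Longrightarrow> progress M2 M3 \<Longrightarrow> progress M1 M3"
  unfolding progress_def using better_trans by blast

lemma progress_set_cell:
  "v \<notin> {13, 14} \<Longrightarrow> progress M M' \<Longrightarrow> progress M (set_cell M' v x y)"
  by (auto simp: progress_def sound_def set_cell_def)

text \<open>An iteration guarantees \<open>C\<close> between its own start and end; monotonicity
  extends this back to the start of the loop and forward to its end.\<close>

lemma tc_For_progress:
  assumes body: "\<And>k M'. k < cnt \<Longrightarrow> M' v 0 = k * d \<Longrightarrow> same_outside (insert v (writes p)) M M' \<Longrightarrow>
      tc p M' tb (\<lambda>M''. progress M' M'' \<and> C k (M' 13) (M'' 13))"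
    and exprs: "\<And>M'. same_outside (insert v (writes p)) M M' \<Longrightarrow> aval b M' = B \<and> aval s M' = d"
    and bound: "\<And>k. k < cnt \<longleftrightarrow> k * d < B"
    and v: "v \<notin> writes p" "v \<notin> {13, 14}"
    and mono: "\<And>k D0 D1 D2 D3. C k D1 D2 \<Longrightarrow> better D0 D1 \<Longrightarrow> better D2 D3 \<Longrightarrow> C k D0 D3"
    and time: "cnt * (tb + 4) + 3 \<le> T"
  shows "tc (For v s b p) M T (\<lambda>M'. progress M M' \<and> (\<forall>k<cnt. C k (M 13) (M' 13)))"
proof (rule tc_For[where N = cnt and d = d and B = B and tb = tb and
      J = "\<lambda>k M'. progress M M' \<and> (\<forall>k'<k. C k' (M 13) (M' 13))"])
  fix k M' assume k: "k < cnt" "M' v 0 = k * d" "same_outside (insert v (writes p)) M M'"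
    "progress M M' \<and> (\<forall>k'<k. C k' (M 13) (M' 13))"
  show "tc p M' tb (\<lambda>M'. progress M M' \<and> (\<forall>k'<Suc k. C k' (M 13) (M' 13)))"
  proof (rule tc_mono[OF body[OF k(1-3)]])
    fix M'' assume M'': "progress M' M'' \<and> C k (M' 13) (M'' 13)"
    have b: "better (M 13) (M' 13)" "better (M' 13) (M'' 13)"
      using k(4) M'' by (simp_all add: progress_def)
    have "C k' (M 13) (M'' 13)" if "k' < Suc k" for k'
    proof (cases "k' = k")
      case True
      then show ?thesis using mono[OF _ b(1) better_refl] M'' by blast
    next
      case False
      then have "C k' (M 13) (M' 13)" using k(4) that by simp
      then show ?thesis using mono[OF _ better_refl b(2)] by blast
    qed
    then show "progress M M'' \<and> (\<forall>k'<Suc k. C k' (M 13) (M'' 13))"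
      using k(4) M'' progress_trans by blast
  qed simp
next
  fix k M' x assume "progress M M' \<and> (\<forall>k'<k. C k' (M 13) (M' 13))"
  moreover have "set_cell M' v 0 x 13 = M' 13" using v(2) by (auto simp: set_cell_def)
  ultimately show "progress M (set_cell M' v 0 x) \<and> (\<forall>k'<k. C k' (M 13) (set_cell M' v 0 x 13))"
    using progress_set_cell[OF v(2)] by simp
qed (use exprs bound v time progress_refl in auto)

text \<open>Four nested loops around the 13 steps of \<open>relax\<close>, each adding 4 per
  iteration and 3 once.\<close>

definition round_time :: nat where
  "round_time = (target + 1) * ((target + 1) * (N * (N * 17 + 7) + 7) + 7) + 3"

lemma writes_relax: "writes relax = {13, 14}"
  by (auto simp: relax_def improve_def Let_def)

lemma duration_relax: "duration relax = 13"
  by (simp add: relax_def improve_def Let_def)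

lemma straight_relax: "straight relax"
  by (simp add: relax_def improve_def Let_def)

lemma tc_round_prog:
  assumes M: "ready M"
  shows "tc round_prog M round_time (\<lambda>M'. progress M M' \<and>
    (\<forall>s1<target + 1. \<forall>s2<target + 1. \<forall>i<N. \<forall>j<N. covers s1 s2 i j (M 13) (M' 13)))"
proof -
  let ?pj = "For 34 (Const 1) (Var 27) relax"
  let ?pi = "For 33 (Const 1) (Var 27) ?pj"
  let ?p2 = "For 32 (Var 27) (Var 29) ?pi"
  \<comment> \<open>The \<open>+ 1\<close> in variable 29 makes the strict loop test include the
    offset of \<open>target\<close> itself.\<close>
  have bound: "k < target + 1 \<longleftrightarrow> k * N < N * target + 1" for k
  proof -
    have "k < target + 1 \<longleftrightarrow> N * k \<le> N * target" using N_pos by auto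
    then show ?thesis by (simp add: mult.commute less_Suc_eq_le)
  qed
  have ready: "ready M'" if "same_outside {30, 31, 32, 33, 34, 13, 14} M M'" for M'
    using M that by (rule ready_same) auto
  have vals: "M' 27 0 = N" "M' 29 0 = N * target + 1"
    if "same_outside {30, 31, 32, 33, 34, 13, 14} M M'" for M'
    using ready[OF that] by (auto simp: ready_def slots_def)
  show ?thesis
    unfolding round_prog_def
  proof (rule tc_For_progress[where B = "N * target + 1" and d = N and
        tb = "(target + 1) * (N * (N * 17 + 7) + 7) + 3"])
    fix s1 M1 assume s1: "M1 31 0 = s1 * N" "same_outside (insert 31 (writes ?p2)) M M1"
    show "tc ?p2 M1 ((target + 1) * (N * (N * 17 + 7) + 7) + 3) (\<lambda>M'. progress M1 M' \<and>
      (\<forall>s2<target + 1. \<forall>i<N. \<forall>j<N. covers s1 s2 i j (M1 13) (M' 13)))"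
    proof (rule tc_For_progress[where B = "N * target + 1" and d = N and tb = "N * (N * 17 + 7) + 3"])
      fix s2 M2 assume s2: "M2 32 0 = s2 * N" "same_outside (insert 32 (writes ?pi)) M1 M2"
      show "tc ?pi M2 (N * (N * 17 + 7) + 3) (\<lambda>M'. progress M2 M' \<and>
        (\<forall>i<N. \<forall>j<N. covers s1 s2 i j (M2 13) (M' 13)))"
      proof (rule tc_For_progress[where B = N and d = 1 and tb = "N * 17 + 3"])
        fix i M3 assume i: "i < N" "M3 33 0 = i * 1" "same_outside (insert 33 (writes ?pj)) M2 M3"
        show "tc ?pj M3 (N * 17 + 3) (\<lambda>M'. progress M3 M' \<and>
          (\<forall>j<N. covers s1 s2 i j (M3 13) (M' 13)))"
        proof (rule tc_For_progress[where B = N and d = 1 and tb = 13])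
          fix j M4 assume j: "j < N" "M4 34 0 = j * 1" "same_outside (insert 34 (writes relax)) M3 M4"
          have "ready M4" using s1(2) s2(2) i(3) j(3)
            by (intro ready) (simp add: so_def writes_relax)
          moreover have "M4 31 0 = s1 * N" "M4 32 0 = s2 * N" "M4 33 0 = i" "M4 34 0 = j"
            using s1 s2 i j by (simp_all add: so_def writes_relax)
          ultimately have "progress M4 (effect relax M4) \<and> covers s1 s2 i j (M4 13) (effect relax M4 13)"
            using i(1) j(1) by (intro effect_relax)
          then show "tc relax M4 13 (\<lambda>M'. progress M4 M' \<and> covers s1 s2 i j (M4 13) (M' 13))"
            by (intro tc_straight) (simp_all add: straight_relax duration_relax)
        next
          fix M4 assume "same_outside (insert 34 (writes relax)) M3 M4"
          then have "same_outside {30, 31, 32, 33, 34, 13, 14} M M4"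
            using s1(2) s2(2) i(3) by (simp add: so_def writes_relax)
          then show "aval (Var 27) M4 = N \<and> aval (Const 1) M4 = 1" using vals by simp
        qed (auto simp: writes_relax intro: covers_mono)
      next
        fix M4 assume "same_outside (insert 33 (writes ?pj)) M2 M4"
        then have "same_outside {30, 31, 32, 33, 34, 13, 14} M M4"
          using s1(2) s2(2) by (simp add: so_def writes_relax)
        then show "aval (Var 27) M4 = N \<and> aval (Const 1) M4 = 1" using vals by simp
      qed (auto simp: writes_relax intro: covers_mono)
    next
      fix M4 assume "same_outside (insert 32 (writes ?pi)) M1 M4"
      then have "same_outside {30, 31, 32, 33, 34, 13, 14} M M4"
        using s1(2) by (simp add: so_def writes_relax)
      then show "aval (Var 29) M4 = N * target + 1 \<and> aval (Var 27) M4 = N" using vals by simp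
    qed (use bound in \<open>auto simp: writes_relax intro: covers_mono\<close>)
  next
    fix M4 assume "same_outside (insert 31 (writes ?p2)) M M4"
    then have "same_outside {30, 31, 32, 33, 34, 13, 14} M M4"
      by (simp add: so_def writes_relax)
    then show "aval (Var 29) M4 = N * target + 1 \<and> aval (Var 27) M4 = N" using vals by simp
  qed (use bound in \<open>auto simp: writes_relax round_time_def intro: covers_mono\<close>)
qed

text \<open>The rules \<open>jump\<close> and \<open>merge\<close> of \<open>bounded\<close> match
  the two clauses of \<open>covers\<close>; codes add up in a merge, so both parts stay within
  \<open>target\<close>.\<close>

lemma complete_Suc:
  assumes "complete r M" "progress M M'"
    and covers: "\<forall>s1<target + 1. \<forall>s2<target + 1. \<forall>i<N. \<forall>j<N. covers s1 s2 i j (M 13) (M' 13)"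
  shows "complete (Suc r) M'"
  unfolding complete_def
proof (intro allI impI)
  fix i s d assume b: "bounded (Suc r) i s d \<and> s \<le> target"
  have old: "M 13 (N * s + i) \<noteq> 0 \<and> M 13 (N * s + i) \<le> d + 1" if "bounded r i s d" "s \<le> target" for i s d
    using assms(1) that by (simp add: complete_def)
  from b have "bounded (Suc r) i s d" by blast
  then show "M' 13 (N * s + i) \<noteq> 0 \<and> M' 13 (N * s + i) \<le> d + 1"
  proof cases
    case keep
    then show ?thesis
      using old[of i s d] b assms(2) unfolding progress_def better_def by (meson le_trans)
  next
    case (jump j d')
    \<comment> \<open>A jump does not involve the first code, for which 0 is an arbitrary
      choice.\<close>
    then have "covers 0 s i j (M 13) (M' 13)" using covers b bounded_slot[OF jump(2)] by simp
    then show ?thesis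
      using old[OF jump(2)] b jump unfolding covers_def by fastforce
  next
    case (merge s1 d1 j s2 d2)
    then have "covers s1 s2 i j (M 13) (M' 13)"
      using covers b bounded_slot[OF merge(3)] bounded_slot[OF merge(4)] by simp
    moreover have "M 13 (N * s1 + i) \<noteq> 0 \<and> M 13 (N * s1 + i) \<le> d1 + 1"
      "M 13 (N * s2 + j) \<noteq> 0 \<and> M 13 (N * s2 + j) \<le> d2 + 1"
      using old merge b by simp_all
    ultimately show ?thesis
      using merge unfolding covers_def by fastforce
  qed
qed

lemma tc_rounds:
  assumes M: "ready M" "sound M" "complete 0 M"
  shows "tc (For 30 (Const 1) (Var 25) round_prog) M (2 * c * (round_time + 4) + 3)
    (\<lambda>M'. sound M' \<and> complete (2 * c) M')"
proof -
  have w: "insert 30 (writes round_prog) = {30, 31, 32, 33, 34, 13, 14}"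
    by (auto simp: round_prog_def writes_relax)
  have ready: "ready M'" if "same_outside (insert 30 (writes round_prog)) M M'" for M'
    using M(1) that by (rule ready_same) (auto simp: w)
  show ?thesis
  proof (rule tc_For[where N = "2 * c" and d = 1 and B = "2 * c" and tb = round_time and
        J = "\<lambda>r M'. sound M' \<and> complete r M'"])
    fix k M' assume k: "same_outside (insert 30 (writes round_prog)) M M'" "sound M' \<and> complete k M'"
    show "tc round_prog M' round_time (\<lambda>M'. sound M' \<and> complete (Suc k) M')"
      by (rule tc_mono[OF tc_round_prog[OF ready[OF k(1)]]])
        (use k(2) complete_Suc in \<open>auto simp: progress_def\<close>)
  next
    fix M' assume "same_outside (insert 30 (writes round_prog)) M M'"
    then show "aval (Var 25) M' = 2 * c \<and> aval (Const 1) M' = 1"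
      using ready by (auto simp: ready_def)
  qed (use M in \<open>auto simp: set_cell_def sound_def complete_def round_prog_def writes_relax\<close>)
qed

section \<open>Extraction of the solution\<close>

definition encodes_optimum :: "nat \<Rightarrow> nat set \<Rightarrow> bool" where
  "encodes_optimum f S \<longleftrightarrow> S \<subseteq> {..<m} \<and> f = (\<Sum>e\<in>S. 2 ^ e) \<and>
     optimal_solution {..<n} E w (Obl \<union> edge ` S)"

text \<open>Soundness turns the minimum into a solution; completeness gives each competitor an
  entry, which the minimum does not exceed. The common sum of the lower bounds cancels.\<close>

lemma minimum_encodes_optimum:
  assumes M: "sound M" "complete (2 * c) M"
    and i: "i < N" "M 13 (N * target + i) \<noteq> 0"
    and min: "\<And>j. j < N \<Longrightarrow> M 13 (N * target + j) \<noteq> 0 \<Longrightarrow> M 13 (N * target + i) \<le> M 13 (N * target + j)"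
  shows "\<exists>S. encodes_optimum (M 14 (N * target + i)) S"
proof -
  let ?d = "M 13 (N * target + i) - 1"
  have "witnessed i target ?d (M 14 (N * target + i))"
    using M(1) i unfolding sound_def by (metis index_eq)
  from witnessed_target[OF this] obtain S where S: "S \<subseteq> {..<m}"
    "M 14 (N * target + i) = (\<Sum>e\<in>S. 2 ^ e)" "solution {..<n} E (Obl \<union> edge ` S)"
    "cost {..<n} w (Obl \<union> edge ` S) \<le> (\<Sum>x<n. l x) + ?d" by blast
  have "cost {..<n} w (Obl \<union> edge ` S) \<le> cost {..<n} w F" if sol: "solution {..<n} E F" for F
  proof -
    obtain j d where j: "bounded (2 * c) j target d" "(\<Sum>x<n. l x) + d \<le> cost {..<n} w F"
      using solution_bounded[OF sol] by blast
    then have "M 13 (N * target + j) \<noteq> 0 \<and> M 13 (N * target + j) \<le> d + 1"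
      using M(2) unfolding complete_def by blast
    then have "?d \<le> d" using min[OF bounded_slot[OF j(1)]] by linarith
    then show ?thesis using S(4) j(2) by linarith
  qed
  then show ?thesis
    using S unfolding encodes_optimum_def optimal_solution_def by blast
qed

lemma tc_pick_prog:
  assumes M: "ready M" "sound M" "complete (2 * c) M" "M 38 0 = 0"
  shows "tc pick_prog M (9 * N + 3) (\<lambda>M'. \<exists>S. encodes_optimum (M' 39 0) S)"
  unfolding pick_prog_def
proof (rule tc_For[where N = N and d = 1 and B = N and tb = 5])
  let ?p = "Cond (Read 13 (Plus (Var 28) (Var 33)))
         (Cond (Plus (Minus (Const 1) (Var 38)) (Minus (Var 38) (Read 13 (Plus (Var 28) (Var 33)))))
           (Seq (Assign 38 (Read 13 (Plus (Var 28) (Var 33))))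
                (Assign 39 (Read 14 (Plus (Var 28) (Var 33)))))
           Skip)
         Skip"
  let ?D = "\<lambda>i. M 13 (N * target + i)"
  let ?J = "\<lambda>k M'. (M' 38 0 \<noteq> 0 \<longrightarrow> (\<exists>i<k. ?D i = M' 38 0 \<and> M 14 (N * target + i) = M' 39 0)) \<and>
      (\<forall>i<k. ?D i \<noteq> 0 \<longrightarrow> M' 38 0 \<noteq> 0 \<and> M' 38 0 \<le> ?D i)"
  {
    fix k M' assume k: "k < N" "M' 33 0 = k * 1" "same_outside (insert 33 (writes ?p)) M M'" "?J k M'"
    have M': "M' 13 = M 13" "M' 14 = M 14" "M' 28 0 = N * target"
      using k(3) M(1) by (auto simp: so_def ready_def)
    let ?new = "?D k \<noteq> 0 \<and> (M' 38 0 = 0 \<or> ?D k < M' 38 0)"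
    define M2 where "M2 = effect ?p M'"
    have M2: "M2 38 0 = (if ?new then ?D k else M' 38 0)"
      "M2 39 0 = (if ?new then M 14 (N * target + k) else M' 39 0)"
      using k(2) M' by (simp_all add: set_cell_def M2_def)
    have "?J (Suc k) M2"
    proof (cases ?new)
      case True
      then have "M2 38 0 = ?D k" "M2 39 0 = M 14 (N * target + k)" using M2 by simp_all
      moreover have "?D k \<le> ?D i" if "i < k" "?D i \<noteq> 0" for i
        using conjunct2[OF k(4), rule_format, OF that] True by linarith
      ultimately show ?thesis
        using True by (auto simp: less_Suc_eq)
    next
      case False
      then have "M2 38 0 = M' 38 0" "M2 39 0 = M' 39 0" unfolding M2 by (simp_all only: if_False)
      then show ?thesis
        using k(4) False by (auto simp: less_Suc_eq)
    qed
    then show "tc ?p M' 5 (?J (Suc k))"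
      by (intro tc_straight) (simp_all add: M2_def)
  next
    fix M' assume J: "?J N M'"
    \<comment> \<open>All edges together form a solution, so some entry at \<open>target\<close> is
      finite.\<close>
    have "solution {..<n} E E" using input by (simp add: minpsc_input_def solution_def)
    then obtain j d where "bounded (2 * c) j target d" using solution_bounded by blast
    then have "j < N" "?D j \<noteq> 0" using M(3) bounded_slot unfolding complete_def by blast+
    then obtain i where i: "i < N" "?D i = M' 38 0" "M 14 (N * target + i) = M' 39 0" "M' 38 0 \<noteq> 0"
      using J by blast
    then have "\<exists>S. encodes_optimum (M 14 (N * target + i)) S"
      using J by (intro minimum_encodes_optimum[OF M(2,3)]) auto
    then show "\<exists>S. encodes_optimum (M' 39 0) S" using i(3) by simp
  }
qed (use M in \<open>auto simp: so_def set_cell_def ready_def slots_def\<close>)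

end

section \<open>Reading the edge set off its code\<close>

context minpsc
begin

lemma output_edges_eq: "output_edges es M = edge ` {e. e < m \<and> M 6 e \<noteq> 0}"
proof -
  have "set [es ! i. i \<leftarrow> [0..<m], M 6 i \<noteq> 0] = (!) es ` {e. e < m \<and> M 6 e \<noteq> 0}"
    by (auto split: if_splits)
  then show ?thesis
    unfolding output_edges_def edges_of_def case_prod_beta' by (simp add: image_image edge_def)
qed

end

context minpsc_comps
begin

text \<open>Once the higher edges are removed, the smaller ones sum to less than the current power
  of two, so comparing with it decides membership. The marks of obligatory edges are kept.\<close>

lemma tc_decode_prog:
  assumes M: "inputs M" "slots M" "matrix m M" "encodes_optimum (M 39 0) S"
    "\<And>e. M 6 e \<noteq> 0 \<longleftrightarrow> e < m \<and> edge e \<in> Obl"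
  shows "tc decode_prog M (12 * m + 3) (outputs_optimum n es w)"
  unfolding decode_prog_def
proof (rule tc_For[where N = m and d = 1 and B = m and tb = 8])
  let ?p = "Seq (Assign 21 (Minus (Minus num_edges (Const 1)) (Var 20)))
       (Seq (Assign 22 (Read 12 (Plus (Read 9 (Read 2 (Var 21))) (Read 3 (Var 21)))))
            (Cond (Minus (Plus (Var 39) (Const 1)) (Var 22))
              (Seq (Write 6 (Var 21) (Const 1)) (Assign 39 (Minus (Var 39) (Var 22))))
              Skip))"
  let ?J = "\<lambda>k M'. M' 39 0 = (\<Sum>e\<in>S \<inter> {..<m - k}. 2 ^ e) \<and>
      (\<forall>e<m. M' 6 e \<noteq> 0 \<longleftrightarrow> edge e \<in> Obl \<or> m - k \<le> e \<and> e \<in> S)"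
  have S: "S \<subseteq> {..<m}" "M 39 0 = (\<Sum>e\<in>S. 2 ^ e)"
    "optimal_solution {..<n} E w (Obl \<union> edge ` S)"
    using M(4) by (simp_all add: encodes_optimum_def)
  have finS: "finite S" using S(1) finite_subset by blast
  {
    fix k M' assume k: "k < m" "M' 20 0 = k * 1" "same_outside (insert 20 (writes ?p)) M M'" "?J k M'"
    define x where "x = m - 1 - k"
    have x: "x < m" "m - k = Suc x" "m - Suc k = x" using k(1) by (auto simp: x_def)
    have "M' a = M a" if "a \<in> {0,2,3,9,12}" for a using k(3) that by (auto simp: so_def)
    then have M': "M' 0 (Suc 0) = m" "M' 2 x = fst (es ! x)" "M' 3 x = snd (es ! x)"
      "M' 9 (fst (es ! x)) = n * fst (es ! x)"
      "M' 12 (n * fst (es ! x) + snd (es ! x)) = 2 ^ x"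
      using M(1,2) x(1) nth_edge[OF x(1)] matrix_bit(2)[OF M(3) _ _ x(1)]
      by (auto simp: inputs_def slots_def edge_def)
    let ?rest = "\<Sum>e\<in>S \<inter> {..<x}. 2 ^ e :: nat"
    have rest: "?rest < 2 ^ x" using finS by (intro sum_power2_bound) auto
    have split: "S \<inter> {..<Suc x} = (if x \<in> S then insert x (S \<inter> {..<x}) else S \<inter> {..<x})"
      by (auto simp: less_Suc_eq)
    have M39: "M' 39 0 = (if x \<in> S then 2 ^ x else 0) + ?rest"
      using k(4) finS unfolding x(2) split by auto
    define M2 where "M2 = effect ?p M'"
    have M2: "M2 39 0 = (if 2 ^ x \<le> M' 39 0 then M' 39 0 - 2 ^ x else M' 39 0)"
      "M2 6 = (if 2 ^ x \<le> M' 39 0 then (M' 6)(x := 1) else M' 6)"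
      using k(2) M' by (simp_all add: set_cell_def M2_def x_def)
    have iff: "2 ^ x \<le> M' 39 0 \<longleftrightarrow> x \<in> S" using M39 rest by auto
    have "?J (Suc k) M2"
    proof (cases "x \<in> S")
      case True
      then have "M2 39 0 = ?rest" "M2 6 = (M' 6)(x := 1)" using M2 iff M39 by simp_all
      then show ?thesis using k(4) True unfolding x by (auto simp: Suc_le_eq le_less)
    next
      case False
      then have "M2 39 0 = ?rest" "M2 6 = M' 6" using M2 iff M39 by simp_all
      moreover have "Suc x \<le> e \<and> e \<in> S \<longleftrightarrow> x \<le> e \<and> e \<in> S" for e
        using False by (auto simp: Suc_le_eq le_less)
      ultimately show ?thesis using k(4) unfolding x by simp
    qed
    then show "tc ?p M' 8 (?J (Suc k))"
      by (intro tc_straight) (simp_all add: M2_def)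
  next
    fix M' :: memory assume J: "?J m M'"
    have "{e. e < m \<and> M' 6 e \<noteq> 0} = {e. e < m \<and> edge e \<in> Obl} \<union> S"
      using J S(1) by auto
    moreover have "edge ` {e. e < m \<and> edge e \<in> Obl} = Obl" using Obl_subset E_edge by auto
    ultimately have "output_edges es M' = Obl \<union> edge ` S"
      unfolding output_edges_eq by (simp add: image_Un)
    then show "outputs_optimum n es w M'"
      unfolding outputs_optimum_def using S(3) by simp
  next
    have "S \<inter> {..<m} = S" using S(1) by blast
    then show "?J 0 M" using M(5) S(2) by simp
  }
qed (use M in \<open>auto simp: so_def set_cell_def inputs_def\<close>)

section \<open>Composition of the phases and the total time\<close>

definition solve_time :: nat where
  "solve_time = (n * (7 * n + 9) + 5) + (17 * m + 5) + (10 * n + 5) + (8 * n + 5) + (5 * N + 3) +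
     (2 * c * (round_time + 4) + 3) + (9 * N + 3) + (12 * m + 3) + 7"

lemma tc_solve:
  assumes M: "inputs M" "M 7 = K" "\<And>e. M 6 e \<noteq> 0 \<longleftrightarrow> e < m \<and> edge e \<in> Obl"
    and zero: "\<And>a k. a \<in> {11, 12, 13, 14, 25, 28, 38} \<Longrightarrow> M a k = 0"
  shows "tc (Seq slot_prog (Seq matrix_prog (Seq rank_prog (Seq code_prog (Seq base_prog
     (Seq (For 30 (Const 1) (Var 25) round_prog) (Seq pick_prog decode_prog))))))) M
     solve_time (outputs_optimum n es w)"
proof -
  have w1: "writes slot_prog \<subseteq> {9, 10, 20, 21, 27}" by (auto simp: slot_prog_def)
  have w2: "writes matrix_prog \<subseteq> {11, 12, 20, 21, 22, 24}" by (auto simp: matrix_prog_def)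
  have w3: "writes rank_prog \<subseteq> {8, 20, 24, 25}" by (auto simp: rank_prog_def)
  have w4: "writes code_prog \<subseteq> {8, 20, 28, 29}" by (auto simp: code_prog_def)
  have w5: "writes base_prog \<subseteq> {13, 20}" by (auto simp: base_prog_def)
  have w6: "writes (For 30 (Const 1) (Var 25) round_prog) \<subseteq> {13, 14, 30, 31, 32, 33, 34}"
    by (auto simp: round_prog_def writes_relax)
  have w7: "writes pick_prog \<subseteq> {33, 38, 39}" by (auto simp: pick_prog_def)
  have frame: "M'' a = M' a" if "same_outside W M' M''" "W \<subseteq> W'" "a \<notin> W'" for M' M'' W W' a
    using that by (auto simp: so_def)
  have slots_cong: "slots M''" if "slots M'" "\<And>a. a \<in> {9, 10, 27} \<Longrightarrow> M'' a = M' a" for M' M''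
    using that by (simp add: slots_def)
  have matrix_cong: "matrix m M''" if "matrix m M'" "\<And>a. a \<in> {11, 12} \<Longrightarrow> M'' a = M' a" for M' M''
    using that by (simp add: matrix_def)
  have inputs_cong: "inputs M''" if "inputs M'" "\<And>a. a \<in> {..4} \<Longrightarrow> M'' a = M' a" for M' M''
    using that by (simp add: inputs_def)
  \<comment> \<open>\<open>t2\<close> to \<open>t8\<close> bound the time of the phases that remain
    at each point.\<close>
  define t8 where "t8 = 12 * m + 3"
  define t7 where "t7 = (9 * N + 3) + t8 + 1"
  define t6 where "t6 = (2 * c * (round_time + 4) + 3) + t7 + 1"
  define t5 where "t5 = (5 * N + 3) + t6 + 1"
  define t4 where "t4 = (8 * n + 5) + t5 + 1"
  define t3 where "t3 = (10 * n + 5) + t4 + 1"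
  define t2 where "t2 = (17 * m + 5) + t3 + 1"
  have t1: "(n * (7 * n + 9) + 5) + t2 + 1 \<le> solve_time"
    unfolding solve_time_def t2_def t3_def t4_def t5_def t6_def t7_def t8_def by simp
  show ?thesis
  proof (rule tc_Seq[OF tc_frame[OF tc_slot_prog[OF M(1)]] _ t1])
    fix M1 assume "slots M1 \<and> same_outside (writes slot_prog) M M1"
    then have s1: "slots M1" and f1: "\<And>a. a \<notin> {9, 10, 20, 21, 27} \<Longrightarrow> M1 a = M a"
      using frame[OF _ w1] by auto
    have i1: "inputs M1" using M(1) by (rule inputs_cong) (auto intro!: f1)
    have z1: "M1 11 k = 0" "M1 12 k = 0" for k using zero f1 by simp_all
    show "tc (Seq matrix_prog (Seq rank_prog (Seq code_prog (Seq base_prog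
       (Seq (For 30 (Const 1) (Var 25) round_prog) (Seq pick_prog decode_prog)))))) M1 t2
       (outputs_optimum n es w)"
    proof (rule tc_Seq[OF tc_frame[OF tc_matrix_prog[OF i1 s1 z1]]])
      fix M2 assume "matrix m M2 \<and> same_outside (writes matrix_prog) M1 M2"
      then have m2: "matrix m M2" and f2: "\<And>a. a \<notin> {11, 12, 20, 21, 22, 24} \<Longrightarrow> M2 a = M1 a"
        using frame[OF _ w2] by auto
      have i2: "inputs M2" using i1 by (rule inputs_cong) (auto intro!: f2)
      have s2: "slots M2" using s1 by (rule slots_cong) (auto intro!: f2)
      have k2: "M2 7 = K" "M2 25 0 = 0" using M(2) zero f1 f2 by simp_all
      show "tc (Seq rank_prog (Seq code_prog (Seq base_prog
         (Seq (For 30 (Const 1) (Var 25) round_prog) (Seq pick_prog decode_prog))))) M2 t3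
         (outputs_optimum n es w)"
      proof (rule tc_Seq[OF tc_frame[OF tc_rank_prog[OF i2 s2 k2]]])
        fix M3 assume M3: "(M3 24 0 = N * 2 ^ c \<and> M3 25 0 = 2 * c \<and> (\<forall>v\<in>R. M3 8 v = N * 2 ^ rank v)) \<and>
          same_outside (writes rank_prog) M2 M3"
        then have f3: "\<And>a. a \<notin> {8, 20, 24, 25} \<Longrightarrow> M3 a = M2 a"
          using frame[OF _ w3] by auto
        have i3: "inputs M3" using i2 by (rule inputs_cong) (auto intro!: f3)
        have k3: "M3 7 = K" "M3 28 0 = 0" using k2 zero f1 f2 f3 by simp_all
        have c3: "M3 24 0 = N * 2 ^ c" "\<forall>v\<in>R. M3 8 v = N * 2 ^ rank v" using M3 by simp_all
        show "tc (Seq code_prog (Seq base_prog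
           (Seq (For 30 (Const 1) (Var 25) round_prog) (Seq pick_prog decode_prog)))) M3 t4
           (outputs_optimum n es w)"
        proof (rule tc_Seq[OF tc_frame[OF tc_code_prog[OF i3 k3 c3]]])
          fix M4 assume M4: "((\<forall>v\<in>R. M4 8 v = N * code v) \<and> M4 28 0 = N * target \<and>
              M4 29 0 = N * target + 1) \<and> same_outside (writes code_prog) M3 M4"
          then have f4: "\<And>a. a \<notin> {8, 20, 28, 29} \<Longrightarrow> M4 a = M3 a"
            using frame[OF _ w4] by auto
          have i4: "inputs M4" using i3 by (rule inputs_cong) (auto intro!: f4)
          have s4: "slots M4" using s2 by (rule slots_cong) (auto simp: f3 f4)
          have m4: "matrix m M4" using m2 by (rule matrix_cong) (auto simp: f3 f4)
          have k4: "M4 7 = K" using k3 f4 by simp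
          have r4: "ready M4"
            using M3 M4 i4 s4 m4 k4 f4 by (simp add: ready_def)
          have c4: "\<forall>v\<in>R. M4 8 v = N * code v" using M4 by simp
          have z4: "M4 13 k = 0" "M4 14 k = 0" for k using zero f1 f2 f3 f4 by simp_all
          show "tc (Seq base_prog
             (Seq (For 30 (Const 1) (Var 25) round_prog) (Seq pick_prog decode_prog))) M4 t5
             (outputs_optimum n es w)"
          proof (rule tc_Seq[OF tc_frame[OF tc_base_prog[OF i4 s4 m4 k4 c4 z4]]])
            fix M5 assume M5: "(sound M5 \<and> complete 0 M5) \<and> same_outside (writes base_prog) M4 M5"
            then have f5: "\<And>a. a \<notin> {13, 20} \<Longrightarrow> M5 a = M4 a" using frame[OF _ w5] by auto
            have r5: "ready M5"
              using M5 w5 by (intro ready_same[OF r4, of "writes base_prog"]) auto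
            show "tc (Seq (For 30 (Const 1) (Var 25) round_prog) (Seq pick_prog decode_prog)) M5 t6
               (outputs_optimum n es w)"
            proof (rule tc_Seq[OF tc_frame[OF tc_rounds[OF r5]]])
              fix M6 assume M6: "(sound M6 \<and> complete (2 * c) M6) \<and>
                  same_outside (writes (For 30 (Const 1) (Var 25) round_prog)) M5 M6"
              then have f6: "\<And>a. a \<notin> {13, 14, 30, 31, 32, 33, 34} \<Longrightarrow> M6 a = M5 a"
                using frame[OF _ w6] by blast
              have r6: "ready M6"
                using M6 w6 by (intro ready_same[OF r5, of "writes (For 30 (Const 1) (Var 25) round_prog)"]) auto
              have z6: "M6 38 0 = 0" using zero f1 f2 f3 f4 f5 f6 by simp
              show "tc (Seq pick_prog decode_prog) M6 t7 (outputs_optimum n es w)"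
              proof (rule tc_Seq[OF tc_frame[OF tc_pick_prog[OF r6 _ _ z6]]])
                fix M7 assume M7: "(\<exists>S. encodes_optimum (M7 39 0) S) \<and> same_outside (writes pick_prog) M6 M7"
                then have f7: "\<And>a. a \<notin> {33, 38, 39} \<Longrightarrow> M7 a = M6 a" using frame[OF _ w7] by blast
                have r7: "ready M7"
                  using M7 w7 by (intro ready_same[OF r6, of "writes pick_prog"]) auto
                have "M7 6 = M 6" using f1 f2 f3 f4 f5 f6 f7 by simp
                then show "tc decode_prog M7 t8 (outputs_optimum n es w)"
                  unfolding t8_def using M7 r7 M(3) by (auto simp: ready_def intro: tc_decode_prog)
              qed (use M6 in \<open>simp_all add: t7_def\<close>)
            qed (use M5 in \<open>simp_all add: t6_def\<close>)
          qed (simp add: t5_def)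
        qed (simp add: t4_def)
      qed (simp add: t3_def)
    qed (simp add: t2_def)
  qed
qed

text \<open>The dominant term is \<open>2 * c\<close> rounds over all pairs of table cells; every
  other term is a multiple of something at most \<open>?X\<close>, and all coefficients add up to
  less than 300.\<close>

lemma time_bound:
  "(5 * n + m * (6 * n + 15) + 7) + solve_time + 1 \<le> 300 * (c * ((c + 1) * 2 ^ c)\<^sup>2 * n ^ 4)"
proof -
  define Z where "Z = target + 1"
  let ?X = "c * (Z * (Z * (N * N)))"
  have pos: "1 \<le> c" "1 \<le> Z" "1 \<le> N" "1 \<le> n" using c_pos N_pos n_pos by (auto simp: Z_def)
  have le: "a \<le> b * a" "a \<le> a * b" if "1 \<le> b" for a b :: nat using that by simp_all
  have NX: "N * N \<le> ?X"
    using le(1)[OF pos(2), of "N * N"] le(1)[OF pos(2), of "Z * (N * N)"]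
      le(1)[OF pos(1), of "Z * (Z * (N * N))"] by linarith
  have N1: "N \<le> ?X" using le(1)[OF pos(3), of N] NX by linarith
  have n1: "n \<le> ?X" using le(1)[OF pos(4), of n] N1 by linarith
  have one: "1 \<le> ?X" using n1 pos by linarith
  have m1: "m \<le> ?X" using m_le N1 by linarith
  have "m * n \<le> N * n" using m_le by (intro mult_le_mono1)
  also have "\<dots> \<le> N * N" using le(1)[OF pos(4), of n] by (intro mult_le_mono2)
  finally have mn: "m * n \<le> ?X" using NX by linarith
  have c1: "c * (Z * (Z * N)) \<le> ?X" by (intro mult_le_mono2 le(2)[OF pos(3)])
  have c2: "c * (Z * Z) \<le> c * (Z * (Z * N))" by (intro mult_le_mono2 le(2)[OF pos(3)])
  have c3: "c * Z \<le> c * (Z * Z)" by (intro mult_le_mono2 le(2)[OF pos(2)])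
  have c4: "c \<le> c * Z" by (intro le(2)[OF pos(2)])
  have "c * (round_time + 4) = 17 * ?X + 7 * (c * (Z * (Z * N))) + 7 * (c * (Z * Z)) +
      7 * (c * Z) + 7 * c"
    unfolding round_time_def Z_def[symmetric] by (simp add: algebra_simps)
  \<comment> \<open>90 is \<open>2 * (17 + 4 * 7)\<close>.\<close>
  then have "2 * c * (round_time + 4) \<le> 90 * ?X" using c1 c2 c3 c4 by linarith
  moreover have "m * (6 * n + 15) = 6 * (m * n) + 15 * m" "n * (7 * n + 9) = 7 * N + 9 * n"
    by (simp_all add: algebra_simps)
  ultimately have "(5 * n + m * (6 * n + 15) + 7) + solve_time + 1 \<le> 300 * ?X"
    unfolding solve_time_def using n1 N1 one m1 mn by linarith
  also have "?X = c * ((c + 1) * 2 ^ c)\<^sup>2 * n ^ 4"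
    unfolding Z_def target_eq by (simp add: power2_eq_square power4_eq_xxxx algebra_simps)
  finally show ?thesis .
qed

end

context minpsc
begin

lemma inputs_input_memory: "inputs (input_memory n es w l params)"
  unfolding inputs_def input_memory_def load_arrays_def
  by (auto simp: edge_def case_prod_beta)

lemma input_memory_zero: "6 \<le> a \<Longrightarrow> input_memory n es w l params a i = 0"
  by (simp add: input_memory_def load_arrays_def)

text \<open>The locale of labelled components is interpreted with the array that the labelling phase
  has just computed; by \<open>num_components_eq\<close>, \<open>c\<close> does not depend on that
  array.\<close>

lemma tc_minpsc_prog:
  fixes params
  defines "c \<equiv> num_components {..<n} Obl"
  shows "tc minpsc_prog (input_memory n es w l params) (300 * (c * ((c + 1) * 2 ^ c)\<^sup>2 * n ^ 4))
    (outputs_optimum n es w) \<and> 0 < c"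
proof -
  let ?M = "input_memory n es w l params"
  note i = inputs_input_memory[of params] and z = input_memory_zero[of _ params]
  have wl: "writes label_prog \<subseteq> {6, 7, 20, 21, 22, 23}"
    by (auto simp: label_prog_def label_step_def)
  have comps: "minpsc_comps n es w l k" if "labelling Obl k" for k
    using that minpsc_axioms unfolding labelling_def minpsc_comps_def minpsc_comps_axioms_def by auto
  have labels: "tc label_prog ?M (5 * n + m * (6 * n + 15) + 7)
      (\<lambda>M'. labelled m M' \<and> same_outside (writes label_prog) ?M M')"
    using tc_frame[OF tc_label_prog[OF i]] z by simp
  then obtain M1 where "labelled m M1" unfolding tc_def by blast
  from minpsc_comps.num_components_eq[OF comps[OF labelled_Obl[OF this]]]
    minpsc_comps.c_pos[OF comps[OF labelled_Obl[OF this]]]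
  have c_pos: "0 < c" unfolding c_def by simp
  have "tc minpsc_prog ?M (300 * (c * ((c + 1) * 2 ^ c)\<^sup>2 * n ^ 4)) (outputs_optimum n es w)"
    unfolding minpsc_prog_def
  \<comment> \<open>The remaining phases get all the time that labelling leaves;
    \<open>C.time_bound\<close> rules out truncation.\<close>
  proof (rule tc_Seq[where ?T2.0 = "300 * (c * ((c + 1) * 2 ^ c)\<^sup>2 * n ^ 4) - (5 * n + m * (6 * n + 15) + 7) - 1",
        OF labels])
    fix M' assume M': "labelled m M' \<and> same_outside (writes label_prog) ?M M'"
    interpret C: minpsc_comps n es w l "M' 7" using comps labelled_Obl M' by blast
    have f: "M' a = ?M a" if "a \<notin> {6, 7, 20, 21, 22, 23}" for a
      using M' wl that by (auto simp: so_def)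
    have "inputs M'" using i M' wl by (elim inputs_same) auto
    moreover have "M' a k = 0" if "a \<in> {11, 12, 13, 14, 25, 28, 38}" for a k
      using that f z by auto
    ultimately have "tc (Seq slot_prog (Seq matrix_prog (Seq rank_prog (Seq code_prog (Seq base_prog
     (Seq (For 30 (Const 1) (Var 25) round_prog) (Seq pick_prog decode_prog))))))) M'
     C.solve_time (outputs_optimum n es w)"
      using M' by (intro C.tc_solve) (auto simp: labelled_def)
    moreover have "C.c = c" unfolding c_def C.num_components_eq ..
    ultimately show "tc (Seq slot_prog (Seq matrix_prog (Seq rank_prog (Seq code_prog (Seq base_prog
     (Seq (For 30 (Const 1) (Var 25) round_prog) (Seq pick_prog decode_prog))))))) M'
     (300 * (c * ((c + 1) * 2 ^ c)\<^sup>2 * n ^ 4) - (5 * n + m * (6 * n + 15) + 7) - 1)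
     (outputs_optimum n es w)"
      using C.time_bound by (elim tc_mono) auto
  next
    \<comment> \<open>The time bound lives in the locale, so a labelling is taken from the run
      itself.\<close>
    obtain M1 where "labelled m M1" using labels unfolding tc_def by blast
    then interpret C: minpsc_comps n es w l "M1 7" using comps labelled_Obl by blast
    have "C.c = c" unfolding c_def C.num_components_eq ..
    then show "5 * n + m * (6 * n + 15) + 7 + (300 * (c * ((c + 1) * 2 ^ c)\<^sup>2 * n ^ 4) -
        (5 * n + m * (6 * n + 15) + 7) - 1) + 1 \<le> 300 * (c * ((c + 1) * 2 ^ c)\<^sup>2 * n ^ 4)"
      using C.time_bound by simp
  qed
  then show ?thesis using c_pos by blast
qed

end

section \<open>The time bounds\<close>

text \<open>The factor \<open>sqrt (real c)\<close> will be divided out to produce the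
  \<open>1 / sqrt (real c)\<close> of the required bound.\<close>

lemma time_le_power_64:
  assumes "0 < c"
  shows "real (c * ((c + 1) * 2 ^ c)\<^sup>2 * n ^ 4) * sqrt (real c) \<le> 64 ^ c * real n ^ 4"
proof -
  have c: "real c \<le> 2 ^ c" using less_exp[of c] by (simp add: less_imp_le)
  have c1: "real (c + 1) \<le> 2 ^ c" using less_exp[of c]
    by (metis Suc_eq_plus1 Suc_leI of_nat_le_iff of_nat_numeral of_nat_power)
  have "real 1 \<le> real c" using assms by simp
  then have s: "sqrt (real c) \<le> real c"
    by (intro real_le_lsqrt) (auto simp: power2_eq_square)
  have "real (c * ((c + 1) * 2 ^ c)\<^sup>2) * sqrt (real c) = real c * sqrt (real c) * (real (c + 1))\<^sup>2 * (2 ^ c)\<^sup>2"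
    by (simp add: power2_eq_square algebra_simps)
  also have "\<dots> \<le> 2 ^ c * 2 ^ c * (2 ^ c)\<^sup>2 * (2 ^ c)\<^sup>2"
    using c c1 s by (intro mult_mono power_mono) auto
  also have "\<dots> = (64::real) ^ c"
    by (simp add: power2_eq_square power_mult_distrib[symmetric])
  finally have "real (c * ((c + 1) * 2 ^ c)\<^sup>2) * sqrt (real c) * real n ^ 4 \<le> 64 ^ c * real n ^ 4"
    by (intro mult_right_mono) auto
  then show ?thesis by (simp add: mult_ac)
qed

text \<open>Rough estimates suffice: \<open>e\<close> is at least \<open>1 + 1 + 1 / 2\<close>, and
  \<open>pi < 4\<close> gives \<open>sqrt (2 * pi) \<le> 3\<close>; then
  \<open>36 * 25 / 4 = 225\<close> stands against \<open>64 * 3 = 192\<close>.\<close>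

lemma base_ge_64: "64 \<le> 36 * (exp 1)\<^sup>2 / sqrt (2 * pi)"
proof -
  have "5 / 2 \<le> exp (1::real)" using exp_lower_Taylor_quadratic[of 1] by simp
  then have "(5 / 2)\<^sup>2 \<le> (exp (1::real))\<^sup>2" by (intro power_mono) auto
  then have "25 / 4 \<le> (exp (1::real))\<^sup>2" by (simp add: power2_eq_square)
  moreover have "sqrt (2 * pi) \<le> 3"
    using pi_less_4 by (intro real_le_lsqrt) (auto simp: power2_eq_square)
  ultimately have "64 * sqrt (2 * pi) \<le> 36 * (exp 1)\<^sup>2" by linarith
  then show ?thesis using pi_gt_zero by (simp add: field_simps)
qed

text \<open>For \<open>c \<ge> 2\<close>, write \<open>64 ^ c\<close> as 2 to the power
  \<open>6 * c\<close>, raise the base 2 to \<open>c\<close> and multiply the exponent by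
  \<open>log 2 c \<ge> 1\<close>. The leading 64 is for \<open>c = 1\<close>, where the power of
  \<open>c\<close> is 1.\<close>

lemma power_64_le:
  assumes "0 < c"
  shows "64 ^ c \<le> 64 * real c powr (6 * (real c * log 2 (real c)))"
proof (cases "c = 1")
  case True
  then show ?thesis by simp
next
  case False
  then have c: "2 \<le> real c" using assms by linarith
  then have "1 \<le> log 2 (real c)" by (simp add: le_log_iff)
  then have l: "6 * real c \<le> 6 * (real c * log 2 (real c))" using c by simp
  have "(64::real) ^ c = 2 powr (6 * real c)"
    by (simp add: powr_powr[symmetric] powr_realpow)
  also have "\<dots> \<le> real c powr (6 * real c)" using c by (intro powr_mono2) auto
  also have "\<dots> \<le> real c powr (6 * (real c * log 2 (real c)))" using l c by (intro powr_mono) auto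
  finally show ?thesis using powr_ge_zero[of "real c" "6 * (real c * log 2 (real c))"] by linarith
qed

theorem theorem1:
  shows
    "(\<exists>P :: com. \<exists>C :: real.
        \<forall>(n :: nat) es w l (\<epsilon> :: real) p q.
          minpsc_input n es w l \<and> 0 < \<epsilon> \<and> \<epsilon> < 1 \<and> represents p q \<epsilon> \<longrightarrow>
          (let c = num_components {..<n} (obligatory_edges (edges_of es) w l);
               M = input_memory n es w l [p, q];
               T = C * (max 1 (ln (1 / \<epsilon>)) * (36 * (exp 1)\<^sup>2 / sqrt (2 * pi)) ^ c *
                     (1 / sqrt (real c)) * real n ^ 4)
           in halts_within P M T \<and> success_prob P M T (outputs_optimum n es w) \<ge> 1 - \<epsilon>))
     \<and>
     (\<exists>P :: com. \<exists>(C :: real) (a :: real) (d :: nat).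
        deterministic P \<and>
        (\<forall>(n :: nat) es w l.
          minpsc_input n es w l \<longrightarrow>
          (let c = num_components {..<n} (obligatory_edges (edges_of es) w l);
               M = input_memory n es w l [];
               T = C * real c powr (a * (real c * log 2 (real c))) * real n ^ d
           in halts_within P M T \<and> success_prob P M T (outputs_optimum n es w) = 1)))"
proof (intro conjI)
  show "\<exists>P :: com. \<exists>C :: real.
        \<forall>(n :: nat) es w l (\<epsilon> :: real) p q.
          minpsc_input n es w l \<and> 0 < \<epsilon> \<and> \<epsilon> < 1 \<and> represents p q \<epsilon> \<longrightarrow>
          (let c = num_components {..<n} (obligatory_edges (edges_of es) w l);
               M = input_memory n es w l [p, q];
               T = C * (max 1 (ln (1 / \<epsilon>)) * (36 * (exp 1)\<^sup>2 / sqrt (2 * pi)) ^ c *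
                     (1 / sqrt (real c)) * real n ^ 4)
           in halts_within P M T \<and> success_prob P M T (outputs_optimum n es w) \<ge> 1 - \<epsilon>)"
  proof (rule exI[of _ minpsc_prog], rule exI[of _ 300], intro allI impI)
    fix n es w l and \<epsilon> :: real and p q
    assume a: "minpsc_input n es w l \<and> 0 < \<epsilon> \<and> \<epsilon> < 1 \<and> represents p q \<epsilon>"
    interpret minpsc n es w l using a by unfold_locales simp
    define c where "c = num_components {..<n} Obl"
    let ?B = "36 * (exp 1)\<^sup>2 / sqrt (2 * pi) :: real"
    let ?T = "300 * (max 1 (ln (1 / \<epsilon>)) * ?B ^ c * (1 / sqrt (real c)) * real n ^ 4)"
    let ?X = "c * ((c + 1) * 2 ^ c)\<^sup>2 * n ^ 4"
    note tc = tc_minpsc_prog[of "[p, q]", folded c_def]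
    have "real ?X * sqrt (real c) \<le> 64 ^ c * real n ^ 4" using tc by (intro time_le_power_64) simp
    also have "\<dots> \<le> ?B ^ c * real n ^ 4"
      by (intro mult_right_mono power_mono base_ge_64) auto
    also have "\<dots> \<le> max 1 (ln (1 / \<epsilon>)) * (?B ^ c * real n ^ 4)"
      using mult_right_mono[of 1 "max 1 (ln (1 / \<epsilon>))" "?B ^ c * real n ^ 4"] by simp
    finally have "real ?X \<le> max 1 (ln (1 / \<epsilon>)) * ?B ^ c * (1 / sqrt (real c)) * real n ^ 4"
      using tc by (simp add: field_simps)
    then have T: "real (300 * ?X) \<le> ?T" by simp
    show "let c = num_components {..<n} (obligatory_edges (edges_of es) w l);
               M = input_memory n es w l [p, q];
               T = 300 * (max 1 (ln (1 / \<epsilon>)) * (36 * (exp 1)\<^sup>2 / sqrt (2 * pi)) ^ c *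
                     (1 / sqrt (real c)) * real n ^ 4)
           in halts_within minpsc_prog M T \<and>
              success_prob minpsc_prog M T (outputs_optimum n es w) \<ge> 1 - \<epsilon>"
      unfolding Let_def c_def[symmetric]
      using tc_halts[OF conjunct1[OF tc] deterministic_minpsc_prog T] a by simp
  qed
next
  show "\<exists>P :: com. \<exists>(C :: real) (a :: real) (d :: nat).
        deterministic P \<and>
        (\<forall>(n :: nat) es w l.
          minpsc_input n es w l \<longrightarrow>
          (let c = num_components {..<n} (obligatory_edges (edges_of es) w l);
               M = input_memory n es w l [];
               T = C * real c powr (a * (real c * log 2 (real c))) * real n ^ d
           in halts_within P M T \<and> success_prob P M T (outputs_optimum n es w) = 1))"
  \<comment> \<open>19200 is \<open>300 * 64\<close>, with 300 from \<open>time_bound\<close> and 64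
    from \<open>power_64_le\<close>.\<close>
  proof (rule exI[of _ minpsc_prog], rule exI[of _ 19200], rule exI[of _ 6], rule exI[of _ 4],
      intro conjI allI impI deterministic_minpsc_prog)
    fix n es w l
    assume a: "minpsc_input n es w l"
    interpret minpsc n es w l using a by unfold_locales
    define c where "c = num_components {..<n} Obl"
    let ?T = "19200 * real c powr (6 * (real c * log 2 (real c))) * real n ^ 4"
    let ?X = "c * ((c + 1) * 2 ^ c)\<^sup>2 * n ^ 4"
    note tc = tc_minpsc_prog[of "[]", folded c_def]
    have "1 \<le> sqrt (real c)" using tc by simp
    then have "real ?X * 1 \<le> real ?X * sqrt (real c)" by (intro mult_left_mono) simp_all
    also have "\<dots> \<le> 64 ^ c * real n ^ 4" using tc by (intro time_le_power_64) simp
    also have "\<dots> \<le> 64 * real c powr (6 * (real c * log 2 (real c))) * real n ^ 4"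
      using tc by (intro mult_right_mono power_64_le) simp_all
    finally have T: "real (300 * ?X) \<le> ?T" by (simp add: mult_ac)
    show "let c = num_components {..<n} (obligatory_edges (edges_of es) w l);
               M = input_memory n es w l [];
               T = 19200 * real c powr (6 * (real c * log 2 (real c))) * real n ^ 4
           in halts_within minpsc_prog M T \<and>
              success_prob minpsc_prog M T (outputs_optimum n es w) = 1"
      unfolding Let_def c_def[symmetric]
      using tc_halts[OF conjunct1[OF tc] deterministic_minpsc_prog T] by simp
  qed
qed

end
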